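(* Let $1<p,q<\infty$. Let $u$ and $v$ be non-negative measurable functions on $\Omega\times\mathbb{C}^n$ and $\mathbb{H}^n$ respectively, with $u$ and $v^{-p'}$ locally integrable and $v$ radial, and suppose that Pitt's inequality holds, i.e. there is a constant $C$ such that for all $f\in\mathcal{S}(\mathbb{H}^n)$, $$\left(\int_{\Omega\times\mathbb{C}^n}|\tilde f(a,w)|^q\,u(a,w)^q\,dw\,d\nu_2(a)\right)^{1/q}\le C\left(\int_{\mathbb{H}^n}|f(z,t)|^p\,v(z,t)^p\,dz\,dt\right)^{1/p}.$$ Then the following hold. (i) For each integer $k\ge1$, $$\sup_{s>0}\left(\int_{R_{k,s}}\int_{|w|^2<2\beta_k s}u(\lambda,(2k+n)|\lambda|,w)^q\,|\lambda|^{2n}\,dw\,d\lambda\right)^{1/q}\left(\int_{|z|^2<2\beta_k s}\int_{|t|<s}v(z,t)^{-p'}\,dz\,dt\right)^{1/p'}<\infty,$$ where $\beta_k=\frac{j_{n-1,1}^2}{4M_{k,n}}$, $M_{k,n}=k+\frac n2$, and $R_{k,s}=\{(\lambda,(2k+n)|\lambda|):|\lambda|<1/s\}$. (ii) For $k=0$, with $R_{0,s}=\{(\lambda,n|\lambda|):|\lambda|<1/s\}$, $$\sup_{s>0}\left(\int_{R_{0,s}}\int_{|w|^2<2s}u(\lambda,n|\lambda|,w)^q\,|\lambda|^{2n}\,dw\,d\lambda\right)^{1/q}\left(\int_{|z|^2<2s}\int_{|t|<s}v(z,t)^{-p'}\,dz\,dt\right)^{1/p'}<\infty.$$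
   Context: The Heisenberg group $\mathbb{H}^n=\mathbb{C}^n\times\mathbb{R}$ ($n\ge1$) has group law $(z,t)(w,s)=(z+w,\,t+s+\frac12\operatorname{Im}(z\cdot\bar w))$, with Lebesgue (Haar) measure $dz\,dt$; $\mathcal{S}(\mathbb{H}^n)$ is the Schwartz space on $\mathbb{C}^n\times\mathbb{R}$. A function $v(z,t)$ on $\mathbb{H}^n$ is radial if it is radial in the first variable $z$, i.e. depends only on $(|z|,t)$. For $\delta>-1$, $k\in\{0,1,2,\dots\}$, the Laguerre polynomial is $L_k^\delta(t)=\frac{t^{-\delta}e^t}{k!}\left(\frac{d}{dt}\right)^k(e^{-t}t^{k+\delta})$. For $\lambda\in\mathbb{R}^*=\mathbb{R}\setminus\{0\}$ put $\varphi^{n-1}_{k,\lambda}(z)=L^{n-1}_k(\frac12|\lambda||z|^2)e^{-\frac14|\lambda||z|^2}$ and $e^{n-1}_{k,\lambda}(z,t)=e^{i\lambda t}\varphi^{n-1}_{k,\lambda}(z)$. The Heisenberg fan $\Omega$ is the union of the rays $R_k=\{(\lambda,(2k+n)|\lambda|):\lambda\in\mathbb{R}^*\}$, $k=0,1,2,\dots$, and $R_\infty=\{(0,\tau):\tau\ge0\}$. The Strichartz Fourier transform of $f$ is the function on $\Omega\times\mathbb{C}^n$ given by $\widehat f(a,w)=\int_{\mathbb{H}^n}f(z,t)\,e_a((z,t)^{-1}(w,0))\,dz\,dt$ for $a=(\lambda,(2k+n)|\lambda|)\in R_k$, where $e_a=e^{n-1}_{k,\lambda}$, and $\widehat f(0,\tau,w)=(n-1)!\,2^{n-1}\int_{\mathbb{H}^n}f(z,t)\frac{J_{n-1}(\sqrt\tau|w-z|)}{(\sqrt\tau|w-z|)^{n-1}}\,dz\,dt$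 on $R_\infty$ ($J_{n-1}$ the Bessel function). The normalized transform is $\tilde f(a,w)=\frac{k!(n-1)!}{(k+n-1)!}\widehat f(a,w)$ for $a\in R_k$ and $\tilde f(0,\tau,w)=\widehat f(0,\tau,w)$. The measure $\nu_2$ on $\Omega$ is defined by $$\int_\Omega\phi(a)\,d\nu_2(a)=(2\pi)^{-2n-1}\int_{-\infty}^\infty\left(\sum_{k=0}^\infty\left(\frac{(k+n-1)!}{k!(n-1)!}\right)^2\phi(\lambda,(2k+n)|\lambda|)\right)|\lambda|^{2n}\,d\lambda.$$ $j_{\nu,1}$ denotes the first positive zero of the Bessel function $J_\nu$. Integration over $R_{k,s}$ with respect to $d\lambda$ means integration over $\{\lambda:|\lambda|<1/s\}$. $p'$ is the Hölder conjugate of $p$.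
   Formalization: It is additionally assumed that v^p is locally integrable (automatic if the right side of Pitt's inequality is finite for every Schwartz f); without it, the inequality can hold vacuously with infinite right side and the conclusion fails. *)

theory Defs
  imports "HOL-Analysis.Analysis"
begin

section \<open>The Heisenberg group\<close>

text \<open>
  The dimension \<open>n \<ge> 1\<close> is \<open>CARD('n)\<close>. The norm of \<^typ>\<open>complex ^ 'n\<close> is the Hermitian
  norm, and \<^const>\<open>lborel\<close> on \<open>'n heis\<close> is the Haar measure \<open>dz dt\<close>.
\<close>

type_synonym 'n heis = "(complex ^ 'n) \<times> real"

definition heis_mult :: "'n::finite heis \<Rightarrow> 'n heis \<Rightarrow> 'n heis" where
  "heis_mult g h =
     (fst g + fst h, snd g + snd h + 1/2 * Im (\<Sum>i\<in>UNIV. fst g $ i * cnj (fst h $ i)))"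

definition heis_inv :: "'n::finite heis \<Rightarrow> 'n heis" where
  "heis_inv g = (- fst g, - snd g)"

lemma heis_mult_inv:
  "heis_mult g (heis_inv g) = (0, 0)" "heis_mult (heis_inv g) g = (0, 0)"
proof -
  have "(\<Sum>i\<in>UNIV. fst g $ i * cnj (fst g $ i)) \<in> \<real>"
    by (intro sum_in_Reals) (simp add: complex_mult_cnj)
  then show "heis_mult g (heis_inv g) = (0, 0)" "heis_mult (heis_inv g) g = (0, 0)"
    by (simp_all add: heis_mult_def heis_inv_def sum_negf complex_is_Real_iff)
qed

definition radial :: "('n::finite heis \<Rightarrow> 'b) \<Rightarrow> bool" where
  "radial v \<longleftrightarrow> (\<forall>z z' t. norm z = norm z' \<longrightarrow> v (z, t) = v (z', t))"

section \<open>Schwartz functions\<close>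

fun iter_pderiv :: "'a::euclidean_space list \<Rightarrow> ('a \<Rightarrow> complex) \<Rightarrow> 'a \<Rightarrow> complex" where
  "iter_pderiv [] f = f"
| "iter_pderiv (b # bs) f = (\<lambda>x. frechet_derivative (iter_pderiv bs f) (at x) b)"

text \<open>A list of basis vectors plays the role of a multi-index.\<close>

definition schwartz :: "('a::euclidean_space \<Rightarrow> complex) \<Rightarrow> bool" where
  "schwartz f \<longleftrightarrow> (\<forall>bs. set bs \<subseteq> Basis \<longrightarrow>
     (\<forall>x. iter_pderiv bs f differentiable (at x)) \<and>
     (\<forall>N::nat. bounded (range (\<lambda>x. (1 + norm x) ^ N *\<^sub>R iter_pderiv bs f x))))"

section \<open>Laguerre polynomials and Bessel functions\<close>

text \<open>
  The Rodrigues formula only makes sense for \<open>t > 0\<close>; it determines the polynomial, and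
  thereby the value at \<open>0\<close> (see \<open>laguerre_rodrigues\<close> below).
\<close>

definition laguerre :: "nat \<Rightarrow> real \<Rightarrow> real poly" where
  "laguerre k \<delta> = (THE p. \<forall>t>0. poly p t =
     t powr (- \<delta>) * exp t / fact k * (deriv ^^ k) (\<lambda>s. exp (- s) * s powr (real k + \<delta>)) t)"

lemma iter_deriv_exp_powr:
  assumes "t > 0"
  shows "(deriv ^^ j) (\<lambda>s. exp (- s) * s powr a) t =
    exp (- t) * (\<Sum>i\<le>j. real (j choose i) * (-1) ^ (j - i) * (\<Prod>l<i. a - real l) * t powr (a - real i))"
  using assms
proof (induction j arbitrary: t)
  case 0
  then show ?case by simp
next
  case (Suc j)
  define c where "c j i = real (j choose i) * (-1) ^ (j - i) * (\<Prod>l<i. a - real l)" for j i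
  have ev: "eventually (\<lambda>s. (deriv ^^ j) (\<lambda>s. exp (- s) * s powr a) s =
      exp (- s) * (\<Sum>i\<le>j. c j i * s powr (a - real i))) (nhds t)"
    using eventually_nhds_in_open[of "{0<..}" t] Suc.prems
    by (auto elim!: eventually_mono simp: Suc.IH c_def)
  have d: "((\<lambda>s. exp (- s) * (\<Sum>i\<le>j. c j i * s powr (a - real i))) has_real_derivative
      (exp (- t) * (\<Sum>i\<le>j. c j i * ((a - real i) * t powr (a - real i - 1)))
       - exp (- t) * (\<Sum>i\<le>j. c j i * t powr (a - real i)))) (at t)"
    using Suc.prems by (auto intro!: derivative_eq_intros simp: mult_ac)
  have "(deriv ^^ Suc j) (\<lambda>s. exp (- s) * s powr a) t =
      deriv (\<lambda>s. exp (- s) * (\<Sum>i\<le>j. c j i * s powr (a - real i))) t"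
    using deriv_cong_ev[OF ev refl] by simp
  also have "\<dots> = exp (- t) * ((\<Sum>i\<le>j. c j i * (a - real i) * t powr (a - real (Suc i)))
       - (\<Sum>i\<le>j. c j i * t powr (a - real i)))"
    using DERIV_imp_deriv[OF d] by (simp add: algebra_simps)
  also have "(\<Sum>i\<le>j. c j i * (a - real i) * t powr (a - real (Suc i)))
       - (\<Sum>i\<le>j. c j i * t powr (a - real i)) = (\<Sum>i\<le>Suc j. c (Suc j) i * t powr (a - real i))"
  proof -
    have "(\<Sum>i\<le>Suc j. c (Suc j) i * t powr (a - real i)) =
        c (Suc j) 0 * t powr a + (\<Sum>i\<le>j. c (Suc j) (Suc i) * t powr (a - real (Suc i)))"
      by (subst sum.atMost_Suc_shift) simp
    also have "(\<Sum>i\<le>j. c (Suc j) (Suc i) * t powr (a - real (Suc i))) =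
        (\<Sum>i\<le>j. c j i * (a - real i) * t powr (a - real (Suc i))
          - c j (Suc i) * t powr (a - real (Suc i)))"
    proof (rule sum.cong)
      fix i assume "i \<in> {..j}"
      have "c (Suc j) (Suc i) = c j i * (a - real i) - c j (Suc i)"
      proof (cases "i = j")
        case True then show ?thesis by (simp add: c_def)
      next
        case False
        then have "j - i = Suc (j - Suc i)" using \<open>i \<in> {..j}\<close> by auto
        then show ?thesis by (simp add: c_def algebra_simps)
      qed
      then show "c (Suc j) (Suc i) * t powr (a - real (Suc i)) =
        c j i * (a - real i) * t powr (a - real (Suc i)) - c j (Suc i) * t powr (a - real (Suc i))"
        by (simp only: left_diff_distrib)
    qed simp
    also have "c (Suc j) 0 * t powr a + \<dots> =
       (\<Sum>i\<le>j. c j i * (a - real i) * t powr (a - real (Suc i)))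
       - (c j 0 * t powr a + (\<Sum>i\<le>j. c j (Suc i) * t powr (a - real (Suc i))))"
      by (simp add: sum_subtractf c_def)
    also have "c j 0 * t powr a + (\<Sum>i\<le>j. c j (Suc i) * t powr (a - real (Suc i))) =
       (\<Sum>i\<le>Suc j. c j i * t powr (a - real i))"
      by (subst sum.atMost_Suc_shift) simp
    also have "\<dots> = (\<Sum>i\<le>j. c j i * t powr (a - real i))"
      by (simp add: c_def)
    finally show ?thesis by simp
  qed
  finally show ?case by (simp add: c_def)
qed

lemma laguerre_ex1:
  "\<exists>!p. \<forall>t>0. poly p t =
     t powr (- \<delta>) * exp t / fact k * (deriv ^^ k) (\<lambda>s. exp (- s) * s powr (real k + \<delta>)) t"
proof (rule ex_ex1I)
  define p where "p = (\<Sum>i\<le>k. monom (real (k choose i) * (-1) ^ (k - i) *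
    (\<Prod>l<i. real k + \<delta> - real l) / fact k) (k - i))"
  have "poly p t =
     t powr (- \<delta>) * exp t / fact k * (deriv ^^ k) (\<lambda>s. exp (- s) * s powr (real k + \<delta>)) t"
    if t: "t > 0" for t
  proof -
    have pw: "t powr (- \<delta>) * t powr (real k + \<delta> - real i) = t ^ (k - i)" if "i \<le> k" for i
      using that t by (simp flip: powr_add powr_realpow add: of_nat_diff)
    have "t powr (- \<delta>) * exp t / fact k * (deriv ^^ k) (\<lambda>s. exp (- s) * s powr (real k + \<delta>)) t
      = (\<Sum>i\<le>k. real (k choose i) * (-1) ^ (k - i) * (\<Prod>l<i. real k + \<delta> - real l) / fact k
          * (t powr (- \<delta>) * t powr (real k + \<delta> - real i)))"
      unfolding iter_deriv_exp_powr[OF t]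
      by (simp add: exp_minus sum_distrib_left sum_divide_distrib field_simps)
    also have "\<dots> = poly p t"
      unfolding p_def poly_sum by (intro sum.cong) (auto simp: pw poly_monom)
    finally show ?thesis by simp
  qed
  then show "\<exists>p. \<forall>t>0. poly p t =
     t powr (- \<delta>) * exp t / fact k * (deriv ^^ k) (\<lambda>s. exp (- s) * s powr (real k + \<delta>)) t"
    by blast
next
  fix p q :: "real poly"
  assume "\<forall>t>0. poly p t =
     t powr (- \<delta>) * exp t / fact k * (deriv ^^ k) (\<lambda>s. exp (- s) * s powr (real k + \<delta>)) t"
    and "\<forall>t>0. poly q t =
     t powr (- \<delta>) * exp t / fact k * (deriv ^^ k) (\<lambda>s. exp (- s) * s powr (real k + \<delta>)) t"
  then have "{0<..} \<subseteq> {t. poly (p - q) t = 0}" by auto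
  then have "\<not> finite {t. poly (p - q) t = 0}"
    using infinite_Ioi[of "0::real"] finite_subset by blast
  then show "p = q" using poly_roots_finite[of "p - q"] by auto
qed

lemma laguerre_rodrigues:
  assumes "t > 0"
  shows "poly (laguerre k \<delta>) t =
     t powr (- \<delta>) * exp t / fact k * (deriv ^^ k) (\<lambda>s. exp (- s) * s powr (real k + \<delta>)) t"
  using theI'[OF laguerre_ex1[of \<delta> k]] assms unfolding laguerre_def by blast

definition bessel_J :: "nat \<Rightarrow> real \<Rightarrow> real" where
  "bessel_J m x = (\<Sum>j. (-1) ^ j / (fact j * fact (j + m)) * (x / 2) ^ (2 * j + m))"

text \<open>\<open>J\<^sub>m(x) / x\<^sup>m\<close> with its removable singularity at \<open>0\<close> filled in.\<close>

definition bessel_J_quot :: "nat \<Rightarrow> real \<Rightarrow> real" where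
  "bessel_J_quot m x = (if x = 0 then 1 / (2 ^ m * fact m) else bessel_J m x / x ^ m)"

definition bessel_first_zero :: "nat \<Rightarrow> real" where
  "bessel_first_zero m = (LEAST x. 0 < x \<and> bessel_J m x = 0)"

section \<open>The Heisenberg fan and the measure \<open>\<nu>\<^sub>2\<close>\<close>

definition fan_ray :: "nat \<Rightarrow> nat \<Rightarrow> (real \<times> real) set" where
  "fan_ray n k = {(l, real (2 * k + n) * \<bar>l\<bar>) |l. l \<noteq> 0}"

definition fan_ray_inf :: "(real \<times> real) set" where
  "fan_ray_inf = {(0, \<tau>) |\<tau>. \<tau> \<ge> 0}"

definition heisenberg_fan :: "nat \<Rightarrow> (real \<times> real) set" where
  "heisenberg_fan n = (\<Union>k. fan_ray n k) \<union> fan_ray_inf"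

definition fan_index :: "nat \<Rightarrow> real \<times> real \<Rightarrow> nat" where
  "fan_index n a = (THE k. a \<in> fan_ray n k)"

lemma fan_index_eq: "a \<in> fan_ray n k \<Longrightarrow> fan_index n a = k"
  unfolding fan_index_def by (rule the_equality) (auto simp: fan_ray_def)

text \<open>Constructed as an image measure; \<open>nn_integral_nu2\<close> is the defining formula.\<close>

definition nu2 :: "nat \<Rightarrow> (real \<times> real) measure" where
  "nu2 n = distr
     (density (count_space UNIV \<Otimes>\<^sub>M lborel)
       (\<lambda>(k, l). ennreal (1 / (2 * pi) ^ (2 * n + 1) *
          (fact (k + n - 1) / (fact k * fact (n - 1)))\<^sup>2 * \<bar>l\<bar> ^ (2 * n))))
     (restrict_space borel (heisenberg_fan n))
     (\<lambda>(k, l). (l, real (2 * k + n) * \<bar>l\<bar>))"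

lemma space_nu2: "space (nu2 n) = heisenberg_fan n"
  by (simp add: nu2_def space_restrict_space)

lemma measurable_nat_pair:
  assumes "\<And>k. f k \<in> M \<rightarrow>\<^sub>M N"
  shows "(\<lambda>(k::nat, l). f k l) \<in> count_space UNIV \<Otimes>\<^sub>M M \<rightarrow>\<^sub>M N"
  using assms by (intro measurable_pair_measure_countable1) auto

lemma nn_integral_nu2:
  assumes \<phi>: "\<phi> \<in> borel_measurable (restrict_space borel (heisenberg_fan n))"
  shows "(\<integral>\<^sup>+a. \<phi> a \<partial>nu2 n) = ennreal (1 / (2 * pi) ^ (2 * n + 1)) *
    (\<integral>\<^sup>+l. (\<Sum>k. ennreal ((fact (k + n - 1) / (fact k * fact (n - 1)))\<^sup>2) *
       \<phi> (l, real (2 * k + n) * \<bar>l\<bar>)) * ennreal (\<bar>l\<bar> ^ (2 * n)) \<partial>lborel)"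
proof -
  define T where "T k l = (l, real (2 * k + n) * \<bar>l\<bar>)" for k and l :: real
  define c where "c = 1 / (2 * pi) ^ (2 * n + 1)"
  define d where "d k = ((fact (k + n - 1) / (fact k * fact (n - 1)))\<^sup>2 :: real)" for k
  have nn: "c \<ge> 0" "\<And>k. d k \<ge> 0" by (auto simp: c_def d_def)
  have Tk: "T k \<in> lborel \<rightarrow>\<^sub>M restrict_space borel (heisenberg_fan n)" for k
  proof (rule measurable_restrict_space2)
    show "T k \<in> space lborel \<rightarrow> heisenberg_fan n"
      by (auto simp: T_def heisenberg_fan_def fan_ray_def fan_ray_inf_def)
    show "T k \<in> lborel \<rightarrow>\<^sub>M borel"
      unfolding T_def by (auto intro!: borel_measurable_Pair)
  qed
  have T: "(\<lambda>(k, l). T k l) \<in> count_space UNIV \<Otimes>\<^sub>M lborel \<rightarrow>\<^sub>M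
      restrict_space borel (heisenberg_fan n)"
    by (rule measurable_nat_pair[OF Tk])
  have w: "(\<lambda>(k, l). ennreal (c * d k * \<bar>l\<bar> ^ (2 * n)))
      \<in> borel_measurable (count_space UNIV \<Otimes>\<^sub>M lborel)"
    by (rule measurable_nat_pair) auto
  have \<phi>T [measurable]: "(\<lambda>l. \<phi> (T k l)) \<in> borel_measurable borel" for k
    using measurable_compose[OF Tk \<phi>] by simp
  have \<phi>T2: "(\<lambda>(k, l). \<phi> (T k l)) \<in> borel_measurable (count_space UNIV \<Otimes>\<^sub>M lborel)"
    by (rule measurable_nat_pair) auto
  interpret P: pair_sigma_finite "count_space (UNIV :: nat set)" "lborel :: real measure"
    by (intro pair_sigma_finite.intro sigma_finite_measure_count_space lborel.sigma_finite_measure_axioms)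
  have "nu2 n = distr (density (count_space UNIV \<Otimes>\<^sub>M lborel)
       (\<lambda>(k, l). ennreal (c * d k * \<bar>l\<bar> ^ (2 * n))))
     (restrict_space borel (heisenberg_fan n)) (\<lambda>(k, l). T k l)"
    by (simp add: nu2_def c_def d_def T_def)
  then have "(\<integral>\<^sup>+a. \<phi> a \<partial>nu2 n) =
      (\<integral>\<^sup>+x. (case x of (k, l) \<Rightarrow> ennreal (c * d k * \<bar>l\<bar> ^ (2 * n))) * (case x of (k, l) \<Rightarrow> \<phi> (T k l))
        \<partial>(count_space UNIV \<Otimes>\<^sub>M lborel))"
    using T w \<phi> \<phi>T2 by (simp add: nn_integral_distr nn_integral_density case_prod_unfold)
  also have "\<dots> = (\<integral>\<^sup>+x. (case x of (k, l) \<Rightarrow> ennreal (c * d k * \<bar>l\<bar> ^ (2 * n)) * \<phi> (T k l))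
        \<partial>(count_space UNIV \<Otimes>\<^sub>M lborel))"
    by (simp add: case_prod_unfold)
  also have "\<dots> = (\<integral>\<^sup>+l. \<integral>\<^sup>+k. ennreal (c * d k * \<bar>l\<bar> ^ (2 * n)) * \<phi> (T k l) \<partial>count_space UNIV \<partial>lborel)"
    by (subst P.nn_integral_snd[symmetric]) (auto intro!: measurable_nat_pair)
  also have "\<dots> = (\<integral>\<^sup>+l. ennreal c * ((\<Sum>k. ennreal (d k) * \<phi> (T k l)) * ennreal (\<bar>l\<bar> ^ (2 * n))) \<partial>lborel)"
  proof (rule nn_integral_cong)
    fix l :: real
    show "(\<integral>\<^sup>+k. ennreal (c * d k * \<bar>l\<bar> ^ (2 * n)) * \<phi> (T k l) \<partial>count_space UNIV) =
      ennreal c * ((\<Sum>k. ennreal (d k) * \<phi> (T k l)) * ennreal (\<bar>l\<bar> ^ (2 * n)))"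
      using nn by (simp add: nn_integral_count_space_nat ennreal_mult mult_ac
          flip: ennreal_suminf_cmult ennreal_suminf_multc)
  qed
  also have "\<dots> = ennreal c * (\<integral>\<^sup>+l. (\<Sum>k. ennreal (d k) * \<phi> (T k l)) * ennreal (\<bar>l\<bar> ^ (2 * n)) \<partial>lborel)"
    by (rule nn_integral_cmult) measurable
  finally show ?thesis by (simp add: c_def d_def T_def)
qed

section \<open>The Strichartz Fourier transform\<close>

definition laguerre_fun :: "nat \<Rightarrow> real \<Rightarrow> complex ^ 'n::finite \<Rightarrow> real" where
  "laguerre_fun k l z =
     poly (laguerre k (real (CARD('n) - 1))) (1/2 * \<bar>l\<bar> * (norm z)\<^sup>2) * exp (- (1/4) * \<bar>l\<bar> * (norm z)\<^sup>2)"

definition joint_eigenfun :: "nat \<Rightarrow> real \<Rightarrow> 'n::finite heis \<Rightarrow> complex" where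
  "joint_eigenfun k l h = exp (\<i> * of_real (l * snd h)) * of_real (laguerre_fun k l (fst h))"

text \<open>Only meaningful for \<open>a \<in> heisenberg_fan CARD('n)\<close>; there \<open>fst a = 0\<close> iff \<open>a\<close> lies on
  \<open>fan_ray_inf\<close>.\<close>

definition strichartz_ft ::
    "('n::finite heis \<Rightarrow> complex) \<Rightarrow> real \<times> real \<Rightarrow> complex ^ 'n \<Rightarrow> complex" where
  "strichartz_ft f a w =
     (if fst a \<noteq> 0
      then LINT h|lborel. f h *
             joint_eigenfun (fan_index CARD('n) a) (fst a) (heis_mult (heis_inv h) (w, 0))
      else fact (CARD('n) - 1) * 2 ^ (CARD('n) - 1) *
             (LINT h|lborel. f h *
                of_real (bessel_J_quot (CARD('n) - 1) (sqrt (snd a) * norm (w - fst h)))))"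

definition normalized_ft ::
    "('n::finite heis \<Rightarrow> complex) \<Rightarrow> real \<times> real \<Rightarrow> complex ^ 'n \<Rightarrow> complex" where
  "normalized_ft f a w =
     (if fst a \<noteq> 0
      then of_real (fact (fan_index CARD('n) a) * fact (CARD('n) - 1) /
             fact (fan_index CARD('n) a + CARD('n) - 1)) * strichartz_ft f a w
      else strichartz_ft f a w)"

section \<open>Weights\<close>

text \<open>Power of an extended non-negative number with exponent \<open>r > 0\<close>.\<close>

definition ennreal_powr :: "ennreal \<Rightarrow> real \<Rightarrow> ennreal" where
  "ennreal_powr x r = (if x = \<infinity> then \<infinity> else ennreal (enn2real x powr r))"

text \<open>\<open>x\<^sup>-\<^sup>r\<close> for real \<open>x \<ge> 0\<close> and \<open>r > 0\<close>, with value \<open>\<infinity>\<close> at \<open>x = 0\<close>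
  (whereas \<open>0 powr (-r) = 0\<close>).\<close>

definition neg_powr :: "real \<Rightarrow> real \<Rightarrow> ennreal" where
  "neg_powr x r = inverse (ennreal (x powr r))"

definition locally_integrable :: "'a::topological_space measure \<Rightarrow> ('a \<Rightarrow> ennreal) \<Rightarrow> bool" where
  "locally_integrable M g \<longleftrightarrow> g \<in> borel_measurable (completion M) \<and>
     (\<forall>K. compact K \<and> K \<subseteq> space M \<longrightarrow> (\<integral>\<^sup>+x\<in>K. g x \<partial>M) < \<infinity>)"

end

theory Submission
  imports Defs "HOL-Probability.Characteristic_Functions"
begin

text \<open>
  Test Pitt's inequality on radial functions \<open>f\<close> supported in
  \<open>\<bar>z\<bar>\<^sup>2 < 2 \<beta>\<^sub>k s\<close>, \<open>\<bar>t\<bar> < s\<close>. The \<open>\<lambda>\<close>-twisted convolution of a radial function with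
  \<open>\<phi>\<^sub>k\<close> is a multiple of \<open>\<phi>\<^sub>k\<close>, so for \<open>a = (\<lambda>, (2k+n) \<bar>\<lambda>\<bar>)\<close> the transform is
  \<open>\<phi>\<^sub>k(w)\<close> times the integral of \<open>f(z,t) exp (- i \<lambda> t) \<phi>\<^sub>k(z)\<close>, up to a constant depending
  only on \<open>k\<close> and \<open>n\<close>. If \<open>\<bar>\<lambda>\<bar> < 1/s\<close> then
  \<open>cos (\<lambda> t) \<ge> cos 1\<close>, and \<open>\<phi>\<^sub>k\<close> is bounded below on the ball because the first
  zero of \<open>L\<^sub>k\<close> exceeds \<open>\<beta>\<^sub>k\<close> (Sturm comparison with the Bessel equation). Hence the
  transform dominates the integral of \<open>f\<close> on the relevant part of the ray, and the choice
  \<open>f = v powr (- p')\<close>, reached through smooth approximations, gives the claim.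
\<close>

section \<open>Laguerre polynomials and the first Bessel zero\<close>

text \<open>The radius is tuned so that the Laguerre argument |\<lambda>| |z|^2 / 2 stays below
  \<open>\<beta>\<^sub>k\<close> for |\<lambda>| < 1/s. The number \<open>\<beta>\<^sub>k\<close>
  comes from the equation of F(x) = exp(-x/2) L_k(x), namely (x^n F')' + x^(n-1) (M - x/4) F = 0
  with M = k + n/2. Dropping x/4 leaves Bessel's equation in the variable M x, whose regular
  solution first vanishes at j^2/(4 M); the dropped term has the sign that pushes the zero of F to
  the right. Two obstacles shape the rest. The integral of u^q is not known to be finite beforehand,
  so its root is replaced by arbitrary finite lower bounds. And Pitt's inequality is given for
  Schwartz functions only, while v^(-p') may be unbounded and is measurable merely up to null sets.
  The approximants must be smooth, non-negative and functions of (|z|^2, t) at once; a bump times a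
  squared polynomial is all three. In the limit the two sides are A D and C D^(1/p), with D the
  integral of v^(-p'); D is finite by local integrability, so D^(1/p) cancels.\<close>

lemma laguerre_eq:
  "laguerre k (real m) = (\<Sum>j\<le>k. monom ((-1) ^ j * real ((k + m) choose (k - j)) / fact j) j)"
proof -
  define Q where "Q = (\<Sum>j\<le>k. monom ((-1) ^ j * real ((k + m) choose (k - j)) / fact j) j)"
  have Q: "poly Q y = (\<Sum>j\<le>k. (-1) ^ j * real ((k + m) choose (k - j)) / fact j * y ^ j)" for y
    by (simp add: Q_def poly_sum poly_monom)
  have pr: "(\<Prod>l<i. real k + real m - real l) = fact i * real ((k + m) choose i)" for i
    by (simp add: binomial_gbinomial gbinomial_prod_rev atLeast0LessThan)
  have "poly Q t = t powr (- real m) * exp t / fact k *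
      (deriv ^^ k) (\<lambda>s. exp (- s) * s powr (real k + real m)) t" if t: "t > 0" for t
  proof -
    have pw: "t powr (- real m) * t powr (real k + real m - real i) = t ^ (k - i)" if "i \<le> k" for i
      using that t by (simp flip: powr_add powr_realpow add: of_nat_diff)
    have "t powr (- real m) * exp t / fact k *
        (deriv ^^ k) (\<lambda>s. exp (- s) * s powr (real k + real m)) t
      = (\<Sum>i\<le>k. real (k choose i) * (-1) ^ (k - i) * (fact i * real ((k + m) choose i)) / fact k
          * (t powr (- real m) * t powr (real k + real m - real i)))"
      unfolding iter_deriv_exp_powr[OF t] pr
      by (simp add: exp_minus sum_distrib_left sum_divide_distrib field_simps)
    also have "\<dots> = (\<Sum>i\<le>k. (-1) ^ (k - i) * real ((k + m) choose i) / fact (k - i) * t ^ (k - i))"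
    proof (rule sum.cong)
      fix i assume i: "i \<in> {..k}"
      then have "real (k choose i) = fact k / (fact i * fact (k - i))"
        by (simp add: binomial_fact)
      then show "real (k choose i) * (-1) ^ (k - i) * (fact i * real ((k + m) choose i)) / fact k
          * (t powr (- real m) * t powr (real k + real m - real i))
        = (-1) ^ (k - i) * real ((k + m) choose i) / fact (k - i) * t ^ (k - i)"
        using i by (simp add: pw)
    qed simp
    also have "\<dots> = (\<Sum>j\<le>k. (-1) ^ j * real ((k + m) choose (k - j)) / fact j * t ^ j)"
      by (rule sum.reindex_bij_witness[of _ "\<lambda>j. k - j" "\<lambda>j. k - j"]) auto
    finally show ?thesis by (simp add: Q)
  qed
  then have "laguerre k (real m) = Q"
    unfolding laguerre_def by (intro the1_equality laguerre_ex1) auto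
  then show ?thesis by (simp add: Q_def)
qed

lemma poly_laguerre:
  "poly (laguerre k (real m)) x =
     (\<Sum>j\<le>k. (-1) ^ j * real ((k + m) choose (k - j)) / fact j * x ^ j)"
  by (simp add: laguerre_eq poly_sum poly_monom)

lemma coeff_laguerre:
  "coeff (laguerre k (real m)) j =
     (if j \<le> k then (-1) ^ j * real ((k + m) choose (k - j)) / fact j else 0)"
  by (simp add: laguerre_eq coeff_sum)

text \<open>The coefficients alternate in sign, so nothing cancels at a negative argument. This lets
  the generating function at negative arguments control the polynomials at positive ones.\<close>

lemma abs_poly_laguerre_le: "\<bar>poly (laguerre k (real m)) x\<bar> \<le> poly (laguerre k (real m)) (- \<bar>x\<bar>)"
proof -
  have e: "(-1) ^ j * (- \<bar>x\<bar>) ^ j = \<bar>x\<bar> ^ j" for j :: nat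
    by (simp flip: power_mult_distrib)
  have "(-1) ^ j * c / fact j * (- \<bar>x\<bar>) ^ j = c / fact j * \<bar>x\<bar> ^ j" for j and c :: real
    using e[of j] by (simp add: field_simps)
  then have "poly (laguerre k (real m)) (- \<bar>x\<bar>) =
      (\<Sum>j\<le>k. \<bar>(-1) ^ j * real ((k + m) choose (k - j)) / fact j * x ^ j\<bar>)"
    unfolding poly_laguerre by (intro sum.cong) (simp_all add: abs_mult power_abs e)
  moreover have "\<bar>poly (laguerre k (real m)) x\<bar> \<le>
      (\<Sum>j\<le>k. \<bar>(-1) ^ j * real ((k + m) choose (k - j)) / fact j * x ^ j\<bar>)"
    unfolding poly_laguerre by (rule sum_abs)
  ultimately show ?thesis by simp
qed

lemma poly_laguerre_0: "poly (laguerre k (real m)) 0 = real ((k + m) choose k)"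
proof -
  have "poly (laguerre k (real m)) 0 = (\<Sum>j\<in>{0}. (-1) ^ j * real ((k + m) choose (k - j)) / fact j * 0 ^ j)"
    unfolding poly_laguerre by (rule sum.mono_neutral_right) auto
  then show ?thesis by simp
qed

section \<open>Generating function of the Laguerre polynomials\<close>

lemma neg_binomial_sums:
  fixes r :: real
  assumes "\<bar>r\<bar> < 1"
  shows "(\<lambda>i. real ((i + N) choose i) * r ^ i) sums (1 / (1 - r) ^ Suc N)"
proof -
  have "(\<lambda>i. (- real (Suc N) gchoose i) * (- r) ^ i) sums (1 + - r) powr (- real (Suc N))"
    by (rule gen_binomial_real) (use assms in auto)
  moreover have "(- real (Suc N) gchoose i) * (- r) ^ i = real ((i + N) choose i) * r ^ i" for i
  proof -
    have "(- real (Suc N) gchoose i) = (-1) ^ i * (real (i + N) gchoose i)"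
      by (subst gbinomial_minus) (simp add: algebra_simps)
    then show ?thesis
      by (subst power_minus) (simp add: binomial_gbinomial mult_ac)
  qed
  moreover have "(1 + - r) powr (- real (Suc N)) = 1 / (1 - r) ^ Suc N"
    using assms by (simp add: powr_minus powr_realpow divide_simps del: of_nat_Suc power_Suc)
  ultimately show ?thesis by simp
qed

text \<open>Writing \<open>k = j + i\<close>, with \<open>j\<close> the power of \<open>x\<close>,
  gives a double series: the sum over \<open>i\<close> is a negative binomial series with
  \<open>N = j + m\<close>, after which the sum over \<open>j\<close> is an exponential
  series.\<close>

lemma laguerre_generating_function:
  fixes r x :: real
  assumes r: "\<bar>r\<bar> < 1"
  shows "(\<lambda>k. r ^ k * poly (laguerre k (real m)) x) sums (exp (- x * r / (1 - r)) / (1 - r) ^ Suc m)"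
proof -
  define h where "h x r = (\<lambda>(j, i). ((- x) ^ j / fact j * r ^ j) * (real ((i + (j + m)) choose i) * r ^ i))"
    for x r :: real
  have inner: "(\<lambda>i. h x r (j, i)) sums ((- x) ^ j / fact j * r ^ j * (1 / (1 - r) ^ Suc (j + m)))"
    if "\<bar>r\<bar> < 1" for x r j
    unfolding h_def prod.case by (intro sums_mult neg_binomial_sums that)
  have outer: "(\<lambda>j. (- x) ^ j / fact j * r ^ j * (1 / (1 - r) ^ Suc (j + m))) sums
      (exp (- x * r / (1 - r)) / (1 - r) ^ Suc m)" if "\<bar>r\<bar> < 1" for x r :: real
  proof -
    have "(\<lambda>j. ((- x * r / (1 - r)) ^ j /\<^sub>R fact j) / (1 - r) ^ Suc m) sums
      (exp (- x * r / (1 - r)) / (1 - r) ^ Suc m)"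
      by (intro sums_divide exp_converges)
    also have "(\<lambda>j. ((- x * r / (1 - r)) ^ j /\<^sub>R fact j) / (1 - r) ^ Suc m) =
      (\<lambda>j. (- x) ^ j / fact j * r ^ j * (1 / (1 - r) ^ Suc (j + m)))"
    proof
      fix j
      have "(- x * r / (1 - r)) ^ j = (- x) ^ j * r ^ j / (1 - r) ^ j"
        by (simp only: power_mult_distrib power_divide)
      then show "((- x * r / (1 - r)) ^ j /\<^sub>R fact j) / (1 - r) ^ Suc m =
          (- x) ^ j / fact j * r ^ j * (1 / (1 - r) ^ Suc (j + m))"
        by (simp only: power_add power_Suc) (simp add: field_simps)
    qed
    finally show ?thesis .
  qed
  \<comment> \<open>Passing from \<open>(x, r)\<close> to
    \<open>(- \<bar>x\<bar>, \<bar>r\<bar>)\<close> replaces every term by its absolute value, so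
    the same closed forms yield the absolute summability that permits resumming along the diagonals
    \<open>j + i = k\<close>.\<close>
  have nrm: "norm (h x r z) = h (- \<bar>x\<bar>) \<bar>r\<bar> z" for z
    by (cases z) (simp add: h_def abs_mult power_abs)
  have nn: "h (- \<bar>x\<bar>) \<bar>r\<bar> z \<ge> 0" for z
    by (cases z) (simp add: h_def)
  have r': "\<bar>\<bar>r\<bar>\<bar> < 1" using r by simp
  have "h (- \<bar>x\<bar>) \<bar>r\<bar> summable_on (UNIV \<times> UNIV)"
  proof (rule summable_on_SigmaI)
    fix j :: nat
    show "((\<lambda>i. h (- \<bar>x\<bar>) \<bar>r\<bar> (j, i)) has_sum
        ((- (- \<bar>x\<bar>)) ^ j / fact j * \<bar>r\<bar> ^ j * (1 / (1 - \<bar>r\<bar>) ^ Suc (j + m)))) UNIV"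
      using inner[OF r', of "- \<bar>x\<bar>" j] nn by (intro sums_nonneg_imp_has_sum) auto
  next
    have "((\<lambda>j. (- (- \<bar>x\<bar>)) ^ j / fact j * \<bar>r\<bar> ^ j * (1 / (1 - \<bar>r\<bar>) ^ Suc (j + m))) has_sum
        (exp (- (- \<bar>x\<bar>) * \<bar>r\<bar> / (1 - \<bar>r\<bar>)) / (1 - \<bar>r\<bar>) ^ Suc m)) UNIV"
      using outer[OF r', of "- \<bar>x\<bar>"] r by (intro sums_nonneg_imp_has_sum) auto
    then show "(\<lambda>j. (- (- \<bar>x\<bar>)) ^ j / fact j * \<bar>r\<bar> ^ j * (1 / (1 - \<bar>r\<bar>) ^ Suc (j + m))) summable_on UNIV"
      by (rule has_sum_imp_summable)
  qed (use nn in auto)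
  then have summ: "h x r summable_on (UNIV \<times> UNIV)"
    by (intro abs_summable_summable[where f = "h x r"]) (simp only: nrm)
  have abs: "summable (\<lambda>i. norm (h x r (j, i)))" for j
    unfolding nrm by (rule sums_summable[OF inner[OF r']])
  have abs': "summable (\<lambda>j. norm ((- x) ^ j / fact j * r ^ j * (1 / (1 - r) ^ Suc (j + m))))"
  proof -
    have "(\<lambda>j. norm ((- x) ^ j / fact j * r ^ j * (1 / (1 - r) ^ Suc (j + m)))) =
      (\<lambda>j. norm ((- x * r / (1 - r)) ^ j /\<^sub>R fact j) / (1 - r) ^ Suc m)"
      using r by (auto simp: fun_eq_iff power_mult_distrib power_divide power_add divide_simps abs_mult power_abs)
    then show ?thesis
      using summable_norm_exp[of "- x * r / (1 - r)"] by (simp only: summable_divide)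
  qed
  have hs: "(h x r has_sum (exp (- x * r / (1 - r)) / (1 - r) ^ Suc m)) (UNIV \<times> UNIV)"
  proof (rule has_sum_SigmaI)
    show "((\<lambda>i. h x r (j, i)) has_sum ((- x) ^ j / fact j * r ^ j * (1 / (1 - r) ^ Suc (j + m)))) UNIV" for j
      by (rule norm_summable_imp_has_sum[OF abs inner[OF r]])
    show "((\<lambda>j. (- x) ^ j / fact j * r ^ j * (1 / (1 - r) ^ Suc (j + m))) has_sum
        (exp (- x * r / (1 - r)) / (1 - r) ^ Suc m)) UNIV"
      by (rule norm_summable_imp_has_sum[OF abs' outer[OF r]])
  qed (rule summ)
  define g where "g = (\<lambda>(k, j). r ^ k * ((-1) ^ j * real ((k + m) choose (k - j)) / fact j * x ^ j))"
  have "(g has_sum (exp (- x * r / (1 - r)) / (1 - r) ^ Suc m)) (Sigma UNIV (\<lambda>k. {..k}))"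
  proof (subst has_sum_reindex_bij_witness[of _ "\<lambda>(j, i). (j + i, j)" "\<lambda>(k, j). (j, k - j)" _ "h x r"])
    fix a :: "nat \<times> nat" assume "a \<in> Sigma UNIV (\<lambda>k. {..k})"
    then obtain k j where a: "a = (k, j)" "j \<le> k" by (cases a) auto
    then show "h x r (case a of (k, j) \<Rightarrow> (j, k - j)) = g a"
      by (simp only: h_def g_def prod.case, subst power_minus)
        (simp add: mult_ac flip: power_add)
  qed (use hs in auto)
  then have "((\<lambda>k. \<Sum>j\<in>{..k}. g (k, j)) has_sum (exp (- x * r / (1 - r)) / (1 - r) ^ Suc m)) UNIV"
    by (rule has_sum_SigmaD) (auto intro: has_sum_finite)
  then have "(\<lambda>k. \<Sum>j\<in>{..k}. g (k, j)) sums (exp (- x * r / (1 - r)) / (1 - r) ^ Suc m)"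
    by (rule has_sum_imp_sums)
  then show ?thesis
    by (simp add: g_def poly_laguerre sum_distrib_left)
qed

section \<open>Bessel's equation and Sturm comparison\<close>

lemma first_zero:
  fixes F :: "real \<Rightarrow> real"
  assumes cont: "continuous_on {0..X} F" and pos: "F 0 > 0" and X: "0 \<le> X" "F X \<le> 0"
  obtains \<xi> where "0 < \<xi>" "\<xi> \<le> X" "F \<xi> = 0" "\<And>y. 0 \<le> y \<Longrightarrow> y < \<xi> \<Longrightarrow> F y > 0"
proof -
  define Z where "Z = {0..X} \<inter> F -` {0}"
  have ivt: "\<exists>x\<ge>0. x \<le> y \<and> F x = 0" if "0 \<le> y" "y \<le> X" "F y \<le> 0" for y
    using IVT2'[of F y 0 0] that pos continuous_on_subset[OF cont, of "{0..y}"] by auto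
  have cl: "closed Z"
    unfolding Z_def by (rule continuous_closed_preimage[OF cont]) auto
  have ne: "Z \<noteq> {}" using ivt[OF X(1) _ X(2)] by (auto simp: Z_def)
  have bdd: "bdd_below Z" by (rule bdd_belowI[of _ 0]) (auto simp: Z_def)
  have inZ: "Inf Z \<in> Z" by (rule closed_contains_Inf[OF ne bdd cl])
  show thesis
  proof
    show "F (Inf Z) = 0" "Inf Z \<le> X" using inZ by (auto simp: Z_def)
    show "0 < Inf Z" using inZ pos by (auto simp: Z_def less_le)
  next
    fix y assume y: "0 \<le> y" "y < Inf Z"
    show "F y > 0"
    proof (rule ccontr)
      assume "\<not> F y > 0"
      with ivt[of y] y inZ obtain x where "0 \<le> x" "x \<le> y" "F x = 0" by (auto simp: Z_def)
      then have "x \<in> Z" using y inZ by (auto simp: Z_def)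
      from cInf_lower[OF this bdd] \<open>x \<le> y\<close> y show False by simp
    qed
  qed
qed

definition bessel_coeff :: "nat \<Rightarrow> nat \<Rightarrow> real" where
  "bessel_coeff m j = (-1) ^ j / (fact j * fact (j + m))"

text \<open>This is x^(-m/2) J_m(2 sqrt x), extended to an entire function. In this variable
  Bessel's equation has the same leading part (x^(m+1) y')' as Laguerre's, which makes the two
  comparable.\<close>

definition bessel_series :: "nat \<Rightarrow> real \<Rightarrow> real" where
  "bessel_series m x = (\<Sum>j. bessel_coeff m j * x ^ j)"

definition bessel_series' :: "nat \<Rightarrow> real \<Rightarrow> real" where
  "bessel_series' m x = (\<Sum>j. diffs (bessel_coeff m) j * x ^ j)"

lemma summable_bessel_series: "summable (\<lambda>j. bessel_coeff m j * x ^ j)"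
proof (rule summable_comparison_test')
  show "summable (\<lambda>j. \<bar>x\<bar> ^ j /\<^sub>R fact j)"
    by (rule sums_summable[OF exp_converges])
  fix j :: nat
  have "1 / (fact j * fact (j + m)) \<le> (1 / fact j :: real)"
    by (simp add: field_simps fact_ge_1)
  then have "1 / (fact j * fact (j + m)) * \<bar>x\<bar> ^ j \<le> (1 / fact j) * \<bar>x\<bar> ^ j"
    by (intro mult_right_mono) auto
  then show "norm (bessel_coeff m j * x ^ j) \<le> \<bar>x\<bar> ^ j /\<^sub>R fact j"
    by (simp add: bessel_coeff_def abs_mult power_abs divide_inverse_commute)
qed

lemma bessel_series_0: "bessel_series m 0 = 1 / fact m"
  unfolding bessel_series_def powser_zero by (simp add: bessel_coeff_def)

lemma has_real_derivative_bessel_series: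
  "(bessel_series m has_real_derivative bessel_series' m x) (at x)"
  unfolding bessel_series_def[abs_def] bessel_series'_def
  by (rule termdiffs_strong_converges_everywhere[OF summable_bessel_series])

lemma continuous_on_bessel_series: "continuous_on S (bessel_series m)"
  by (intro continuous_at_imp_continuous_on ballI DERIV_isCont[OF has_real_derivative_bessel_series])

text \<open>Bessel's equation in self-adjoint form. On coefficients it says (n + m + 1) d_n = - c_n,
  where c are the Bessel coefficients and d those of the differentiated series.\<close>

lemma bessel_series_ode:
  "((\<lambda>x. x ^ Suc m * bessel_series' m x) has_real_derivative - (x ^ m * bessel_series m x)) (at x)"
proof -
  define d where "d = diffs (bessel_coeff m)"
  have summ: "summable (\<lambda>n. d n * y ^ n)" "summable (\<lambda>n. diffs d n * y ^ n)" for y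
    using termdiff_converges_all[OF summable_bessel_series] termdiff_converges_all
    unfolding d_def by blast+
  define D where "D = (\<Sum>n. d n * x ^ n)"
  define D2 where "D2 = (\<Sum>n. diffs d n * x ^ n)"
  have der: "(bessel_series' m has_real_derivative D2) (at x)"
    unfolding bessel_series'_def[abs_def] D2_def d_def[symmetric]
    by (rule termdiffs_strong_converges_everywhere[OF summ(1)])
  have "(\<lambda>n. real n * d n * x ^ n) sums (D2 * x)"
  proof -
    have "(\<lambda>n. diffs d n * x ^ n * x) sums (D2 * x)"
      unfolding D2_def by (intro sums_mult2 summable_sums summ)
    then have "(\<lambda>n. real (Suc n) * d (Suc n) * x ^ Suc n) sums (D2 * x)"
      by (simp add: diffs_def mult_ac)
    then show ?thesis by (subst (asm) sums_Suc_iff) simp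
  qed
  moreover have "(\<lambda>n. real (Suc m) * (d n * x ^ n)) sums (real (Suc m) * D)"
    unfolding D_def by (intro sums_mult summable_sums summ)
  ultimately have "(\<lambda>n. real n * d n * x ^ n + real (Suc m) * (d n * x ^ n)) sums
      (D2 * x + real (Suc m) * D)"
    by (rule sums_add)
  moreover have "real n * d n * x ^ n + real (Suc m) * (d n * x ^ n) = - (bessel_coeff m n * x ^ n)" for n
  proof -
    have "(real n + real (Suc m)) * d n = - bessel_coeff m n"
      by (simp add: d_def diffs_def bessel_coeff_def field_simps del: of_nat_Suc)
        (simp add: algebra_simps)
    then show ?thesis by (metis distrib_right mult.assoc mult_minus_left)
  qed
  ultimately have "(\<lambda>n. - (bessel_coeff m n * x ^ n)) sums (D2 * x + real (Suc m) * D)"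
    by simp
  moreover have "(\<lambda>n. - (bessel_coeff m n * x ^ n)) sums (- bessel_series m x)"
    unfolding bessel_series_def by (intro sums_minus summable_sums summable_bessel_series)
  ultimately have eq: "D2 * x + real (Suc m) * D = - bessel_series m x"
    by (rule sums_unique2)
  have Dx: "bessel_series' m x = D" by (simp add: bessel_series'_def D_def d_def)
  have "((\<lambda>x. x ^ Suc m * bessel_series' m x) has_real_derivative
      (real (Suc m) * x ^ m * bessel_series' m x + x ^ Suc m * D2)) (at x)"
    using DERIV_mult[OF DERIV_pow[of "Suc m" x] der] by (simp add: mult_ac)
  also have "real (Suc m) * x ^ m * bessel_series' m x + x ^ Suc m * D2 =
      x ^ m * (D2 * x + real (Suc m) * D)"
    by (simp add: Dx algebra_simps)
  finally show ?thesis by (simp only: eq mult_minus_right)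
qed

text \<open>Comparing coefficients leaves the two-term recurrence \<open>rec\<close>, which for
  \<open>j < k\<close> is the ratio of neighbouring binomial coefficients and at
  \<open>j = k\<close> breaks off through the factor \<open>k - j\<close>.\<close>

lemma laguerre_ode:
  "pCons 0 (pderiv (pderiv (laguerre k (real m)))) + [:real (Suc m), -1:] * pderiv (laguerre k (real m))
     + smult (real k) (laguerre k (real m)) = 0"
proof (rule poly_eqI)
  fix j
  define L where "L = laguerre k (real m)"
  have rec: "real (Suc j) * real (j + Suc m) * coeff L (Suc j) + (real k - real j) * coeff L j = 0"
  proof (cases "j < k")
    case True
    define i where "i = k - Suc j"
    have k: "k = Suc (i + j)" using True by (simp add: i_def)
    have "Suc i * ((k + m) choose Suc i) = (k + m - i) * ((k + m) choose i)"
      by (metis binomial_absorb_comp binomial_absorption diff_Suc_1 mult.commute Suc_diff_1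
          binomial_absorb_comp Suc_times_binomial_add k)
    then have "real (Suc i) * real ((k + m) choose Suc i) = real (j + Suc m) * real ((k + m) choose i)"
      unfolding of_nat_mult[symmetric] by (simp add: k)
    moreover have "coeff L (Suc j) = - ((-1) ^ j * real ((k + m) choose i) / (real (Suc j) * fact j))"
      using True by (simp add: L_def coeff_laguerre i_def)
    moreover have "k - j = Suc i" by (simp add: k)
    then have "coeff L j = (-1) ^ j * real ((k + m) choose Suc i) / fact j"
      using True by (simp add: L_def coeff_laguerre del: binomial_Suc_Suc)
    moreover have "real k - real j = real (Suc i)" by (simp add: k)
    ultimately show ?thesis
      by (simp add: mult_ac del: of_nat_Suc binomial_Suc_Suc)
  next
    case False
    then show ?thesis by (cases "j = k") (auto simp: L_def coeff_laguerre)
  qed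
  have "coeff (pCons 0 (pderiv (pderiv L)) + [:real (Suc m), -1:] * pderiv L + smult (real k) L) j =
    real (Suc j) * real (j + Suc m) * coeff L (Suc j) + (real k - real j) * coeff L j"
    by (cases j) (simp_all add: coeff_pderiv algebra_simps)
  then show "coeff (pCons 0 (pderiv (pderiv (laguerre k (real m))))
      + [:real (Suc m), -1:] * pderiv (laguerre k (real m))
     + smult (real k) (laguerre k (real m))) j = coeff 0 j"
    using rec by (simp add: L_def)
qed

text \<open>
  Sturm comparison: with \<open>F(x) = exp (-x/2) L(x)\<close> and \<open>G(x) = B(M x)\<close>, the function
  \<open>x\<^sup>m\<^sup>+\<^sup>1 (F' G - F G')\<close> has derivative \<open>x\<^sup>m\<^sup>+\<^sup>1 F G / 4\<close>.
\<close>

lemma laguerre_sturm_comparison: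
  fixes k m :: nat
  defines "M \<equiv> real k + real (Suc m) / 2"
  assumes nonneg: "\<And>x. 0 \<le> x \<Longrightarrow> x \<le> X \<Longrightarrow> bessel_series m (M * x) \<ge> 0"
    and pos: "\<And>x. 0 < x \<Longrightarrow> x < X \<Longrightarrow> bessel_series m (M * x) > 0"
    and x: "0 \<le> x" "x \<le> X"
  shows "poly (laguerre k (real m)) x > 0"
proof (rule ccontr)
  assume neg: "\<not> poly (laguerre k (real m)) x > 0"
  have M: "M > 0" by (simp add: M_def add_nonneg_pos)
  define L where "L = laguerre k (real m)"
  define F where "F x = exp (- x / 2) * poly L x" for x
  define F' where "F' x = exp (- x / 2) * (poly (pderiv L) x - poly L x / 2)" for x
  define G where "G x = bessel_series m (M * x)" for x
  define P where "P x = x ^ Suc m * F' x" for x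
  define R where "R x = x ^ Suc m * (M * bessel_series' m (M * x))" for x
  have dF: "(F has_real_derivative F' x) (at x)" for x
    unfolding F_def[abs_def] F'_def by (auto intro!: derivative_eq_intros simp: algebra_simps)
  have dG: "(G has_real_derivative M * bessel_series' m (M * x)) (at x)" for x
  proof -
    have "((\<lambda>x. bessel_series m (M * x)) has_real_derivative bessel_series' m (M * x) * M) (at x)"
      by (rule DERIV_chain2[OF has_real_derivative_bessel_series]) (auto intro!: derivative_eq_intros)
    then show ?thesis by (simp add: G_def[abs_def] mult.commute)
  qed
  \<comment> \<open>The factor exp(-x/2) absorbs the term - x L' of Laguerre's equation; this is
    where \<open>M\<close> and the extra x/4 arise. Without x/4 it would be the equation of
    \<open>G\<close>.\<close>
  have dP: "(P has_real_derivative - (x ^ m * (M - x / 4) * F x)) (at x)" for x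
  proof -
    have "poly (pCons 0 (pderiv (pderiv L)) + [:real (Suc m), -1:] * pderiv L + smult (real k) L) x = 0"
      using laguerre_ode[of k m] by (simp only: L_def poly_0)
    then have ode: "x * poly (pderiv (pderiv L)) x =
        - (real (Suc m) - x) * poly (pderiv L) x - real k * poly L x"
      by (simp add: algebra_simps)
    have dF': "(F' has_real_derivative (exp (- x / 2) * (poly (pderiv (pderiv L)) x - poly (pderiv L) x / 2)
         - exp (- x / 2) / 2 * (poly (pderiv L) x - poly L x / 2))) (at x)"
      unfolding F'_def[abs_def] by (auto intro!: derivative_eq_intros simp: field_simps)
    have "(P has_real_derivative (real (Suc m) * x ^ m * F' x + x ^ Suc m *
       (exp (- x / 2) * (poly (pderiv (pderiv L)) x - poly (pderiv L) x / 2)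
         - exp (- x / 2) / 2 * (poly (pderiv L) x - poly L x / 2)))) (at x)"
      unfolding P_def[abs_def] using DERIV_mult[OF DERIV_pow[of "Suc m" x] dF'] by (simp add: mult_ac)
    also have "real (Suc m) * x ^ m * F' x + x ^ Suc m *
       (exp (- x / 2) * (poly (pderiv (pderiv L)) x - poly (pderiv L) x / 2)
         - exp (- x / 2) / 2 * (poly (pderiv L) x - poly L x / 2)) =
        x ^ m * exp (- x / 2) * (x * poly (pderiv (pderiv L)) x
        - x * poly (pderiv L) x + x * poly L x / 4
        + real (Suc m) * (poly (pderiv L) x - poly L x / 2))"
      by (simp add: F'_def algebra_simps)
    also have "\<dots> = - (x ^ m * (M - x / 4) * F x)"
      by (simp add: ode F_def M_def algebra_simps add_divide_distrib)
    finally show ?thesis .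
  qed
  have dR: "(R has_real_derivative - (M * x ^ m * G x)) (at x)" for x
  proof -
    have "((\<lambda>x. (M * x) ^ Suc m * bessel_series' m (M * x)) has_real_derivative
       - ((M * x) ^ m * bessel_series m (M * x)) * M) (at x)"
      by (rule DERIV_chain2[OF bessel_series_ode]) (auto intro!: derivative_eq_intros)
    from DERIV_cmult[OF this, of "1 / M ^ m"] show ?thesis
      using M by (simp add: R_def[abs_def] G_def power_mult_distrib mult_ac)
  qed
  define W where "W x = P x * G x - F x * R x" for x
  have dW: "(W has_real_derivative x ^ Suc m / 4 * F x * G x) (at x)" for x
  proof -
    have "(W has_real_derivative (- (x ^ m * (M - x / 4) * F x) * G x + (M * bessel_series' m (M * x)) * P x
       - (F' x * R x + - (M * x ^ m * G x) * F x))) (at x)"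
      unfolding W_def[abs_def] by (intro DERIV_diff DERIV_mult dP dG dF dR)
    also have "- (x ^ m * (M - x / 4) * F x) * G x + (M * bessel_series' m (M * x)) * P x
       - (F' x * R x + - (M * x ^ m * G x) * F x) = x ^ Suc m / 4 * F x * G x"
      by (simp add: P_def R_def algebra_simps)
    finally show ?thesis .
  qed
  have F0: "F 0 > 0" by (simp add: F_def L_def poly_laguerre_0)
  have cF: "continuous_on S F" for S
    by (intro continuous_at_imp_continuous_on ballI DERIV_isCont[OF dF])
  have "F x \<le> 0" using neg by (simp add: F_def L_def mult_le_0_iff)
  then obtain \<xi> where \<xi>: "0 < \<xi>" "\<xi> \<le> x" "F \<xi> = 0" "\<And>y. 0 \<le> y \<Longrightarrow> y < \<xi> \<Longrightarrow> F y > 0"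
    using first_zero[OF cF F0 x(1)] by metis
  \<comment> \<open>\<open>W\<close> vanishes at 0 because \<open>P\<close> and \<open>R\<close> do,
    and it increases strictly up to the first zero \<open>\<xi>\<close> of \<open>F\<close>. There
    only \<open>P \<xi> * G \<xi>\<close> survives, and it cannot be positive: \<open>F\<close>
    descends to its zero from above while \<open>G\<close> is non-negative.\<close>
  have "W 0 < W \<xi>"
  proof (rule DERIV_pos_imp_increasing_open[OF \<xi>(1)])
    fix y assume y: "0 < y" "y < \<xi>"
    then have "y ^ Suc m / 4 * F y * G y > 0"
      using \<xi>(2) \<xi>(4)[of y] x pos[of y] unfolding G_def by (intro mult_pos_pos) auto
    then show "\<exists>d. (W has_real_derivative d) (at y) \<and> 0 < d" using dW by blast
  qed (intro continuous_at_imp_continuous_on ballI DERIV_isCont[OF dW])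
  then have "P \<xi> * G \<xi> > 0" by (simp add: W_def \<xi>(3) P_def R_def)
  moreover have "G \<xi> \<ge> 0" using nonneg[of \<xi>] \<xi> x by (simp add: G_def)
  moreover have "F' \<xi> \<le> 0"
  proof (rule ccontr)
    assume "\<not> F' \<xi> \<le> 0"
    then obtain d where d: "d > 0" "\<And>h. 0 < h \<Longrightarrow> h < d \<Longrightarrow> F (\<xi> - h) < F \<xi>"
      using DERIV_pos_inc_left[OF dF, of \<xi>] by (auto simp: not_le)
    define h where "h = min (d / 2) (\<xi> / 2)"
    have "0 < h" "h < d" "h < \<xi>" using d \<xi> by (auto simp: h_def)
    with d(2)[of h] \<xi>(3) \<xi>(4)[of "\<xi> - h"] show False by simp
  qed
  ultimately show False
    using mult_nonneg_nonpos[OF _ mult_nonpos_nonneg, of "\<xi> ^ Suc m" "F' \<xi>" "G \<xi>"] \<xi>(1)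
    by (simp add: P_def mult.assoc del: power_Suc)
qed

lemma bessel_J_eq: "bessel_J m x = (x / 2) ^ m * bessel_series m (x\<^sup>2 / 4)"
proof -
  have "bessel_coeff m j * (x\<^sup>2 / 4) ^ j * (x / 2) ^ m =
      (-1) ^ j / (fact j * fact (j + m)) * (x / 2) ^ (2 * j + m)" for j
    by (simp add: bessel_coeff_def power_add power_mult power_divide)
  then show ?thesis
    unfolding bessel_J_def bessel_series_def
    using suminf_mult2[OF summable_bessel_series[of m "x\<^sup>2 / 4"], of "(x / 2) ^ m"]
    by (simp add: mult.commute)
qed

text \<open>
  That \<open>J\<^sub>m\<close> has a positive zero also follows by comparison, because \<open>L\<^sub>1\<close> has the
  positive zero \<open>m + 1\<close>.
\<close>

lemma bessel_first_zero:
  "bessel_first_zero m > 0"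
  "bessel_series m ((bessel_first_zero m)\<^sup>2 / 4) = 0"
  "0 \<le> y \<Longrightarrow> y < (bessel_first_zero m)\<^sup>2 / 4 \<Longrightarrow> bessel_series m y > 0"
proof -
  have "\<exists>y>0. bessel_series m y \<le> 0"
  proof (rule ccontr)
    assume "\<not> ?thesis"
    then have pos: "bessel_series m y > 0" if "y > 0" for y using that by (auto simp: not_le)
    then have nn: "bessel_series m y \<ge> 0" if "y \<ge> 0" for y
      using that bessel_series_0[of m] by (cases "y = 0") (auto intro: less_imp_le)
    have "poly (laguerre 1 (real m)) (real (Suc m)) > 0"
      by (rule laguerre_sturm_comparison[where X = "real (Suc m)"]) (auto intro!: pos nn mult_pos_pos add_pos_nonneg)
    then show False by (simp add: poly_laguerre)
  qed
  then obtain Y where Y: "Y > 0" "bessel_series m Y \<le> 0" by blast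
  have 0: "bessel_series m 0 > 0" by (simp add: bessel_series_0)
  obtain \<xi> where \<xi>: "0 < \<xi>" "bessel_series m \<xi> = 0" "\<And>y. 0 \<le> y \<Longrightarrow> y < \<xi> \<Longrightarrow> bessel_series m y > 0"
    using first_zero[OF continuous_on_bessel_series 0 less_imp_le[OF Y(1)] Y(2)] by metis
  \<comment> \<open>\<open>LEAST\<close> over the reals has the intended meaning only if the minimum
    is attained, so the closed form is proved by exhibiting it: the first zero of the series,
    transported by x^2/4.\<close>
  have "bessel_first_zero m = 2 * sqrt \<xi>"
    unfolding bessel_first_zero_def
  proof (rule Least_equality)
    show "0 < 2 * sqrt \<xi> \<and> bessel_J m (2 * sqrt \<xi>) = 0"
      using \<xi> by (simp add: bessel_J_eq power_mult_distrib)
  next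
    fix x assume "0 < x \<and> bessel_J m x = 0"
    then have "0 < x" "bessel_series m (x\<^sup>2 / 4) = 0" by (auto simp: bessel_J_eq)
    then have "\<xi> \<le> x\<^sup>2 / 4" using \<xi>(3)[of "x\<^sup>2 / 4"] by (auto simp: not_less[symmetric])
    then have "sqrt \<xi> \<le> sqrt (x\<^sup>2 / 4)" by simp
    then show "2 * sqrt \<xi> \<le> x" using \<open>0 < x\<close> by (simp add: real_sqrt_divide)
  qed
  with \<xi> show "bessel_first_zero m > 0" "bessel_series m ((bessel_first_zero m)\<^sup>2 / 4) = 0"
    "0 \<le> y \<Longrightarrow> y < (bessel_first_zero m)\<^sup>2 / 4 \<Longrightarrow> bessel_series m y > 0"
    by (simp_all add: power_mult_distrib)
qed

text \<open>The closed endpoint is admissible: the Bessel factor vanishes there, but the comparison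
  asks for strict positivity only in the interior. Having the endpoint later gives a positive
  minimum on a compact interval.\<close>

lemma laguerre_pos:
  assumes "0 \<le> x" "x \<le> (bessel_first_zero m)\<^sup>2 / (4 * (real k + real (Suc m) / 2))"
  shows "poly (laguerre k (real m)) x > 0"
proof -
  define M where "M = real k + real (Suc m) / 2"
  have M: "M > 0" by (simp add: M_def add_nonneg_pos)
  define X where "X = (bessel_first_zero m)\<^sup>2 / (4 * M)"
  have MX: "M * X = (bessel_first_zero m)\<^sup>2 / 4" using M by (simp add: X_def)
  have pos: "bessel_series m (M * y) > 0" if "0 \<le> y" "y < X" for y
    using that M by (intro bessel_first_zero(3)) (auto simp flip: MX)
  show ?thesis
  proof (rule laguerre_sturm_comparison[where X = X])
    fix y assume "0 \<le> y" "y \<le> X"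
    then show "bessel_series m ((real k + real (Suc m) / 2) * y) \<ge> 0"
      using pos[of y] bessel_first_zero(2)[of m] unfolding M_def[symmetric]
      by (cases "y = X") (simp_all add: MX)
  qed (use assms pos in \<open>auto simp: X_def M_def\<close>)
qed

section \<open>Gaussian integrals\<close>

text \<open>By induction the coefficients below \<open>n\<close> vanish; dividing the rest by
  \<open>x ^ n\<close> leaves a power series with sum 0 off the origin, whose limit at 0 is
  \<open>a n\<close>.\<close>

lemma powser_sums_0_imp_0:
  fixes a :: "nat \<Rightarrow> real"
  assumes e: "e > 0" and s: "\<And>x. \<bar>x\<bar> < e \<Longrightarrow> (\<lambda>n. a n * x ^ n) sums 0"
  shows "a n = 0"
proof (induction n rule: less_induct)
  case (less n)
  have "(\<lambda>k. a (k + n) * x ^ k) sums 0" if "x \<noteq> 0" "norm x < e" for x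
  proof -
    have "(\<lambda>k. a (k + n) * x ^ (k + n)) sums 0"
      using sums_iff_shift[of "\<lambda>k. a k * x ^ k" n 0] s[of x] that less by simp
    then have "(\<lambda>k. (a (k + n) * x ^ (k + n)) / x ^ n) sums (0 / x ^ n)"
      by (rule sums_divide)
    then show ?thesis using that by (simp add: power_add)
  qed
  then have "((\<lambda>x. 0) \<longlongrightarrow> a (0 + n)) (at (0::real))"
    using powser_limit_0_strong[OF e, of "\<lambda>k. a (k + n)" "\<lambda>_. 0"] by simp
  then show ?case
    by (simp add: tendsto_const_iff)
qed

lemma powser_eq_imp_coeff_eq:
  fixes a b :: "nat \<Rightarrow> complex" and G :: "real \<Rightarrow> complex"
  assumes e: "e > 0"
    and a: "\<And>x. \<bar>x\<bar> < e \<Longrightarrow> (\<lambda>n. a n * of_real (x ^ n)) sums G x"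
    and b: "\<And>x. \<bar>x\<bar> < e \<Longrightarrow> (\<lambda>n. b n * of_real (x ^ n)) sums G x"
  shows "a n = b n"
proof -
  have d: "(\<lambda>n. (a n - b n) * of_real (x ^ n)) sums 0" if "\<bar>x\<bar> < e" for x
    using sums_diff[OF a[OF that] b[OF that]] by (simp add: left_diff_distrib)
  have "Re (a n - b n) = 0"
    by (rule powser_sums_0_imp_0[OF e]) (use sums_Re[OF d] in \<open>simp del: of_real_power\<close>)
  moreover have "Im (a n - b n) = 0"
    by (rule powser_sums_0_imp_0[OF e]) (use sums_Im[OF d] in \<open>simp del: of_real_power\<close>)
  ultimately show ?thesis by (simp add: complex_eq_iff)
qed

lemma has_bochner_integral_lborel_prod:
  fixes f :: "'a::euclidean_space \<Rightarrow> real \<Rightarrow> complex"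
  assumes f: "\<And>b. b \<in> Basis \<Longrightarrow> integrable lborel (f b)"
  shows "has_bochner_integral lborel (\<lambda>x::'a. \<Prod>b\<in>Basis. f b (x \<bullet> b)) (\<Prod>b\<in>Basis. LINT x|lborel. f b x)"
proof -
  interpret product_sigma_finite "\<lambda>_::'a. lborel :: real measure"
    by standard
  let ?T = "\<lambda>g::'a \<Rightarrow> real. \<Sum>b\<in>Basis. g b *\<^sub>R b"
  have T: "?T \<in> (\<Pi>\<^sub>M b\<in>Basis. lborel) \<rightarrow>\<^sub>M borel" by measurable
  have m: "(\<lambda>x::'a. \<Prod>b\<in>Basis. f b (x \<bullet> b)) \<in> borel_measurable borel"
    using f[THEN borel_measurable_integrable] by (intro borel_measurable_prod) simp
  have eq: "(\<Prod>b\<in>Basis. f b (?T g \<bullet> b)) = (\<Prod>b\<in>Basis. f b (g b))" for g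
    by (intro prod.cong) (auto simp: inner_sum_left inner_Basis if_distrib sum.delta cong: if_cong)
  have lb: "(lborel :: 'a measure) = distr (\<Pi>\<^sub>M b\<in>Basis. lborel) borel ?T"
    by (rule lborel_eq)
  show ?thesis
    unfolding has_bochner_integral_iff lb
    using product_integrable_prod[OF finite_Basis f] product_integral_prod[OF finite_Basis f]
    by (subst integrable_distr_eq[OF T m], subst integral_distr[OF T m]) (simp add: eq)
qed

text \<open>Completing the square in the real part is the substitution \<open>d + c * x\<close> with
  \<open>c = sqrt (2 * A)\<close>. It turns the phase \<open>q\<close> into the frequency
  \<open>t = q / c\<close>, and what remains is the characteristic function of the standard normal
  law, so no contour has to be shifted.\<close>

lemma gaussian_integral_real:
  fixes A p q :: real
  assumes A: "A > 0"
  shows "has_bochner_integral lborel (\<lambda>x. of_real (exp (- A * x\<^sup>2 + p * x)) * cis (q * x))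
    (of_real (sqrt (pi / A)) * exp ((of_real p + \<i> * of_real q)\<^sup>2 / of_real (4 * A)))"
proof -
  define t where "t = q / sqrt (2 * A)"
  define f :: "real \<Rightarrow> complex" where "f x = of_real (exp (- x\<^sup>2 / 2)) * cis (t * x)" for x
  have int: "integrable lborel f"
  proof (rule Bochner_Integration.integrable_bound)
    have "integrable lborel (\<lambda>x. sqrt (2 * pi) * std_normal_density x)"
      using integrable_normal_moment[where k = 0 and \<mu> = 0 and \<sigma> = 1] by (intro integrable_mult_right) simp
    then show "integrable lborel (\<lambda>x::real. exp (- x\<^sup>2 / 2))"
      by (simp add: std_normal_density_def)
    show "f \<in> borel_measurable lborel"
      unfolding f_def[abs_def] cis_conv_exp by measurable
  qed (simp add: f_def norm_mult)
  have val: "integral\<^sup>L lborel f = of_real (sqrt (2 * pi)) * of_real (exp (- t\<^sup>2 / 2))"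
  proof -
    have "complex_of_real (exp (- t\<^sup>2 / 2)) = (CLINT x|std_normal_distribution. iexp (t * x))"
      using char_std_normal_distribution by (simp add: char_def fun_eq_iff)
    also have "\<dots> = (CLINT x|lborel. std_normal_density x *\<^sub>R iexp (t * x))"
      by (subst integral_density) auto
    also have "\<dots> = (CLINT x|lborel. of_real (1 / sqrt (2 * pi)) * f x)"
      by (intro Bochner_Integration.integral_cong)
        (auto simp: std_normal_density_def f_def cis_conv_exp scaleR_conv_of_real)
    also have "\<dots> = of_real (1 / sqrt (2 * pi)) * integral\<^sup>L lborel f"
      by simp
    finally have "of_real (sqrt (2 * pi)) * complex_of_real (exp (- t\<^sup>2 / 2)) =
        (of_real (sqrt (2 * pi)) * of_real (1 / sqrt (2 * pi))) * integral\<^sup>L lborel f"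
      by (simp only: mult.assoc)
    also have "of_real (sqrt (2 * pi)) * of_real (1 / sqrt (2 * pi)) = (1 :: complex)"
      by (simp flip: of_real_mult)
    finally show ?thesis by simp
  qed
  define c where "c = sqrt (2 * A)"
  define d where "d = - p / c"
  have c: "c > 0" "c\<^sup>2 = 2 * A" using A by (simp_all add: c_def)
  define K where "K = complex_of_real (exp (p\<^sup>2 / (4 * A))) * cis (p * q / (2 * A))"
  have pw: "of_real (exp (- A * x\<^sup>2 + p * x)) * cis (q * x) = K * f (d + c * x)" for x
  proof -
    have "p\<^sup>2 / (4 * A) + (- (d + c * x)\<^sup>2 / 2) = - A * x\<^sup>2 + p * x"
    proof -
      have "(d + c * x)\<^sup>2 = p\<^sup>2 / c\<^sup>2 - 2 * p * x + c\<^sup>2 * x\<^sup>2"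
        using c(1) by (simp add: d_def power2_eq_square field_simps)
      then show ?thesis using A by (simp add: c(2) field_simps)
    qed
    moreover have "p * q / (2 * A) + t * (d + c * x) = q * x"
    proof -
      have tc: "t = q / c" by (simp add: t_def c_def)
      have "t * (d + c * x) = - p * q / c\<^sup>2 + q * x"
        using c(1) by (simp add: tc d_def power2_eq_square field_simps)
      then show ?thesis by (simp add: c(2))
    qed
    moreover have "K * f (d + c * x) =
        of_real (exp (p\<^sup>2 / (4 * A) + (- (d + c * x)\<^sup>2 / 2))) * cis (p * q / (2 * A) + t * (d + c * x))"
      unfolding K_def f_def exp_add of_real_mult cis_mult[symmetric] by (simp only: mult_ac)
    ultimately show ?thesis by (simp only:)
  qed
  have "has_bochner_integral lborel (\<lambda>x. K * f (d + c * x)) (K * (integral\<^sup>L lborel f /\<^sub>R \<bar>c\<bar>))"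
    using c int by (intro has_bochner_integral_mult_right, subst lborel_has_bochner_integral_real_affine_iff[symmetric])
      (auto simp: has_bochner_integral_iff)
  moreover have "K * (integral\<^sup>L lborel f /\<^sub>R \<bar>c\<bar>) =
    of_real (sqrt (pi / A)) * exp ((of_real p + \<i> * of_real q)\<^sup>2 / of_real (4 * A))"
  proof -
    have "sqrt (2 * pi) / c = sqrt (pi / A)"
      by (simp add: c_def flip: real_sqrt_divide)
    moreover have "K * of_real (exp (- t\<^sup>2 / 2)) = exp ((of_real p + \<i> * of_real q)\<^sup>2 / of_real (4 * A))"
    proof -
      have "(of_real p + \<i> * of_real q)\<^sup>2 / of_real (4 * A) =
        of_real (p\<^sup>2 / (4 * A)) + \<i> * of_real (p * q / (2 * A)) + of_real (- t\<^sup>2 / 2)"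
        using A by (simp add: t_def power_divide power2_eq_square field_simps)
      then show ?thesis
        by (simp only: exp_add exp_of_real K_def cis_conv_exp)
    qed
    moreover have "K * (integral\<^sup>L lborel f /\<^sub>R \<bar>c\<bar>) =
        of_real (sqrt (2 * pi) / c) * (K * of_real (exp (- t\<^sup>2 / 2)))"
      unfolding val scaleR_conv_of_real using c(1)
      by (simp only: abs_of_pos of_real_divide of_real_inverse of_real_mult divide_inverse mult_ac)
    ultimately show ?thesis by (simp only:)
  qed
  ultimately show ?thesis unfolding pw by simp
qed

text \<open>The integrand is a product over coordinates. The exponent is the bilinear (not
  Hermitian) square of p + i q divided by 4 A, that is, the sum of the one-dimensional
  exponents.\<close>

lemma gaussian_integral:
  fixes A :: real and p q :: "'a::euclidean_space"
  assumes A: "A > 0"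
  shows "has_bochner_integral lborel (\<lambda>x. of_real (exp (- A * (norm x)\<^sup>2 + p \<bullet> x)) * cis (q \<bullet> x))
    (of_real (sqrt (pi / A) ^ DIM('a)) *
      exp ((of_real ((norm p)\<^sup>2 - (norm q)\<^sup>2) + 2 * \<i> * of_real (p \<bullet> q)) / of_real (4 * A)))"
proof -
  let ?f = "\<lambda>b x. of_real (exp (- A * x\<^sup>2 + (p \<bullet> b) * x)) * cis ((q \<bullet> b) * x)"
  have cis_sum: "cis (\<Sum>b\<in>B. g b) = (\<Prod>b\<in>B. cis (g b))" if "finite B" for B :: "'a set" and g
    using that by induction (auto simp flip: cis_mult)
  have "(\<Prod>b\<in>Basis. ?f b (x \<bullet> b)) =
      of_real (exp (- A * (norm x)\<^sup>2 + p \<bullet> x)) * cis (q \<bullet> x)" for x :: 'a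
  proof -
    have "(norm x)\<^sup>2 = (\<Sum>b\<in>Basis. (x \<bullet> b)\<^sup>2)"
      unfolding power2_norm_eq_inner by (subst euclidean_inner) (simp add: power2_eq_square)
    then have "- A * (norm x)\<^sup>2 + p \<bullet> x = (\<Sum>b\<in>Basis. - A * (x \<bullet> b)\<^sup>2 + (p \<bullet> b) * (x \<bullet> b))"
      by (simp add: euclidean_inner[of p x] sum_subtractf sum_negf sum_distrib_left)
    then show ?thesis
      by (simp add: prod.distrib exp_sum cis_sum euclidean_inner[of q x] flip: of_real_prod)
  qed
  moreover have "(\<Prod>b\<in>Basis. LINT x|lborel. ?f b x) =
    of_real (sqrt (pi / A) ^ DIM('a)) *
      exp ((of_real ((norm p)\<^sup>2 - (norm q)\<^sup>2) + 2 * \<i> * of_real (p \<bullet> q)) / of_real (4 * A))"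
  proof -
    have "(\<Sum>b\<in>Basis. (of_real (p \<bullet> b) + \<i> * of_real (q \<bullet> b))\<^sup>2 / of_real (4 * A)) =
      (of_real ((norm p)\<^sup>2 - (norm q)\<^sup>2) + 2 * \<i> * of_real (p \<bullet> q)) / of_real (4 * A)"
    proof -
      have "(of_real (p \<bullet> b) + \<i> * of_real (q \<bullet> b))\<^sup>2 =
        of_real ((p \<bullet> b)*(p \<bullet> b)) - of_real ((q \<bullet> b) * (q \<bullet> b)) + 2 * \<i> * of_real ((p \<bullet> b) * (q \<bullet> b))" for b
        by (simp add: power2_eq_square algebra_simps)
      then show ?thesis
        unfolding sum_divide_distrib[symmetric]
        by (simp add: sum.distrib sum_subtractf power2_norm_eq_inner euclidean_inner[of p p]
            euclidean_inner[of q q] euclidean_inner[of p q] flip: sum_distrib_left)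
    qed
    then have "(\<Prod>b\<in>Basis. exp ((of_real (p \<bullet> b) + \<i> * of_real (q \<bullet> b))\<^sup>2 / of_real (4 * A))) =
       exp ((of_real ((norm p)\<^sup>2 - (norm q)\<^sup>2) + 2 * \<i> * of_real (p \<bullet> q)) / of_real (4 * A))"
      by (simp only: exp_sum[OF finite_Basis, symmetric])
    then show ?thesis
      using gaussian_integral_real[OF A, THEN has_bochner_integral_integral_eq]
      by (simp add: prod.distrib)
  qed
  ultimately show ?thesis
    using has_bochner_integral_lborel_prod[of ?f, OF gaussian_integral_real[OF A, THEN has_bochner_integral_iff[THEN iffD1, THEN conjunct1]]]
    by (simp add: has_bochner_integral_iff)
qed

section \<open>Twisted convolution of radial functions\<close>

text \<open>Writing the symplectic form as a real inner product with i w makes the phase of the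
  twisted convolution a plane wave in z, to which \<open>gaussian_integral\<close> applies.\<close>

definition cmult_i :: "complex ^ 'n::finite \<Rightarrow> complex ^ 'n" where
  "cmult_i w = (\<chi> j. \<i> * w $ j)"

lemma Im_hermitian: "Im (\<Sum>j\<in>UNIV. z $ j * cnj (w $ j)) = cmult_i w \<bullet> z"
  by (simp add: inner_vec_def cmult_i_def inner_complex_def algebra_simps)

lemma norm_cmult_i: "norm (cmult_i w) = norm w"
  by (simp add: norm_vec_def cmult_i_def norm_mult)

lemma inner_cmult_i: "w \<bullet> cmult_i w = 0"
  by (simp add: inner_vec_def cmult_i_def inner_complex_def)

lemma cmult_i_0: "cmult_i 0 = 0"
  by (simp add: cmult_i_def vec_eq_iff)

lemma laguerre_fun_eq:
  "laguerre_fun k l (z :: complex ^ 'n::finite) =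
     poly (laguerre k (real (CARD('n) - 1))) (2 * (\<bar>l\<bar> / 4) * (norm z)\<^sup>2) * exp (- (\<bar>l\<bar> / 4) * (norm z)\<^sup>2)"
  by (simp add: laguerre_fun_def)

text \<open>Summed against \<open>r ^ k\<close>, the Laguerre functions form a single Gaussian in
  \<open>z\<close> whose exponent is rescaled by the Moebius map (1 + r) / (1 - r).\<close>

lemma laguerre_fun_sums:
  fixes z :: "complex ^ 'n::finite"
  assumes "\<bar>r\<bar> < 1"
  shows "(\<lambda>k. laguerre_fun k l z * r ^ k) sums
    (exp (- (\<bar>l\<bar> / 4 * ((1 + r) / (1 - r))) * (norm z)\<^sup>2) / (1 - r) ^ CARD('n))"
proof -
  define y where "y = \<bar>l\<bar> / 4 * (norm z)\<^sup>2"
  have "(\<lambda>k. r ^ k * poly (laguerre k (real (CARD('n) - 1))) (2 * y) * exp (- y)) sums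
    (exp (- (2 * y) * r / (1 - r)) / (1 - r) ^ Suc (CARD('n) - 1) * exp (- y))"
    by (intro sums_mult2 laguerre_generating_function assms)
  also have "(\<lambda>k. r ^ k * poly (laguerre k (real (CARD('n) - 1))) (2 * y) * exp (- y)) =
      (\<lambda>k. laguerre_fun k l z * r ^ k)"
    by (simp add: laguerre_fun_eq y_def mult_ac)
  also have "Suc (CARD('n) - 1) = CARD('n)" by simp
  also have "exp (- (2 * y) * r / (1 - r)) / (1 - r) ^ CARD('n) * exp (- y) =
      exp (- (2 * y) * r / (1 - r) + - y) / (1 - r) ^ CARD('n)"
    by (simp only: exp_add) simp
  also have "- (2 * y) * r / (1 - r) + - y = - (y * ((1 + r) / (1 - r)))"
    using assms by (simp add: field_simps)
  also have "- (y * ((1 + r) / (1 - r))) = - (\<bar>l\<bar> / 4 * ((1 + r) / (1 - r))) * (norm z)\<^sup>2"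
    by (simp add: y_def)
  finally show ?thesis .
qed

text \<open>The generating function at \<open>r = 1 / 5\<close> and argument
  \<open>- (2 * y)\<close> has non-negative terms, so each is at most the whole sum exp(y/2)
  (5/4)^n. Against the factor exp(-y) half of the decay is left, and the growth in \<open>k\<close>
  is only 5^k.\<close>

lemma laguerre_fun_bound:
  fixes z :: "complex ^ 'n::finite"
  shows "\<bar>laguerre_fun k l z\<bar> \<le> 5 ^ k * (5 / 4) ^ CARD('n) * exp (- (\<bar>l\<bar> / 8) * (norm z)\<^sup>2)"
proof -
  define y where "y = \<bar>l\<bar> / 4 * (norm z)\<^sup>2"
  have y: "y \<ge> 0" by (simp add: y_def)
  let ?L = "\<lambda>k. poly (laguerre k (real (CARD('n) - 1))) (- (2 * y))"
  have L: "?L k \<ge> \<bar>poly (laguerre k (real (CARD('n) - 1))) (2 * y)\<bar>" for k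
    using abs_poly_laguerre_le[of k "CARD('n) - 1" "2 * y"] y by simp
  then have L0: "?L k \<ge> 0" for k by (meson abs_ge_zero order_trans)
  have s: "(\<lambda>k. (1 / 5) ^ k * ?L k) sums (exp (y / 2) * (5 / 4) ^ CARD('n))"
    using laguerre_generating_function[of "1 / 5" "CARD('n) - 1" "- (2 * y)"]
    by (simp add: power_divide del: power_Suc)
  have "(1 / 5) ^ k * ?L k = (\<Sum>i\<in>{k}. (1 / 5) ^ i * ?L i)" by simp
  also have "\<dots> \<le> (\<Sum>i. (1 / 5) ^ i * ?L i)"
    by (rule sum_le_suminf) (use s L0 in \<open>auto simp: sums_iff\<close>)
  also have "\<dots> = exp (y / 2) * (5 / 4) ^ CARD('n)" using s by (simp add: sums_iff)
  finally have "?L k \<le> 5 ^ k * (5 / 4) ^ CARD('n) * exp (y / 2)"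
    by (simp add: power_divide field_simps)
  with L[of k] have "\<bar>poly (laguerre k (real (CARD('n) - 1))) (2 * y)\<bar> * exp (- y)
     \<le> 5 ^ k * (5 / 4) ^ CARD('n) * exp (y / 2) * exp (- y)"
    by (intro mult_right_mono) auto
  also have "\<dots> = 5 ^ k * (5 / 4) ^ CARD('n) * exp (- (y / 2))"
    by (simp add: mult.assoc flip: exp_add)
  finally show ?thesis
    by (simp add: laguerre_fun_eq abs_mult y_def)
qed

lemma laguerre_fun_measurable [measurable]: "laguerre_fun k l \<in> borel_measurable borel"
proof -
  have "continuous_on UNIV (\<lambda>z :: complex ^ 'n. laguerre_fun k l z)"
    unfolding laguerre_fun_def by (intro continuous_intros)
  then show ?thesis by (rule borel_measurable_continuous_onI)
qed

text \<open>What remains of \<open>e\<^sub>a((z,t)\<^sup>-\<^sup>1(w,0))\<close> once the factor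
  \<open>cis (- l * t)\<close> is split off.\<close>

definition twisted_kernel ::
    "nat \<Rightarrow> real \<Rightarrow> complex ^ 'n::finite \<Rightarrow> complex ^ 'n \<Rightarrow> complex" where
  "twisted_kernel k l w z = cis (- (l / 2) * (cmult_i w \<bullet> z)) * of_real (laguerre_fun k l (w - z))"

lemma twisted_kernel_measurable [measurable]: "twisted_kernel k l w \<in> borel_measurable borel"
  unfolding twisted_kernel_def[abs_def] cis_conv_exp by measurable

lemma norm_twisted_kernel: "norm (twisted_kernel k l w z) = \<bar>laguerre_fun k l (w - z)\<bar>"
  by (simp add: twisted_kernel_def norm_mult)

lemma integrable_gaussian:
  fixes w :: "'a::euclidean_space"
  assumes "A > 0"
  shows "integrable lborel (\<lambda>z. exp (- A * (norm (w - z))\<^sup>2))"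
proof -
  have "integrable lborel (\<lambda>z. norm (of_real (exp (- A * (norm z)\<^sup>2 + (2 * A) *\<^sub>R w \<bullet> z)) * cis (0 \<bullet> z)))"
    using gaussian_integral[OF assms, of "(2 * A) *\<^sub>R w" 0]
    by (intro integrable_norm) (simp only: has_bochner_integral_iff)
  then have "integrable lborel (\<lambda>z. exp (- A * (norm w)\<^sup>2) * exp (- A * (norm z)\<^sup>2 + (2 * A) *\<^sub>R w \<bullet> z))"
    by (intro integrable_mult_right) (simp add: norm_mult)
  also have "(\<lambda>z. exp (- A * (norm w)\<^sup>2) * exp (- A * (norm z)\<^sup>2 + (2 * A) *\<^sub>R w \<bullet> z)) =
     (\<lambda>z. exp (- A * (norm (w - z))\<^sup>2))"
    by (rule ext) (simp flip: exp_add add: power2_norm_eq_inner inner_diff inner_commute algebra_simps)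
  finally show ?thesis .
qed

lemma twisted_kernel_integrable:
  fixes w :: "complex ^ 'n::finite"
  assumes "l \<noteq> 0"
  shows "integrable lborel (twisted_kernel k l w)"
proof (rule Bochner_Integration.integrable_bound)
  show "integrable lborel (\<lambda>z :: complex ^ 'n. 5 ^ k * (5 / 4) ^ CARD('n) * exp (- (\<bar>l\<bar> / 8) * (norm (w - z))\<^sup>2))"
    by (intro integrable_mult_right integrable_gaussian) (use assms in auto)
  show "AE z in lborel. norm (twisted_kernel k l w z)
     \<le> norm (5 ^ k * (5 / 4) ^ CARD('n) * exp (- (\<bar>l\<bar> / 8) * (norm (w - z))\<^sup>2))"
    using laguerre_fun_bound[of k l "w - _"] by (simp add: norm_twisted_kernel)
qed simp

text \<open>
  Both sides are the coefficients of a power series in \<open>r\<close>; by the generating function of the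
  Laguerre polynomials the series on the left is a Gaussian integral.
\<close>

lemma twisted_gaussian:
  fixes w :: "complex ^ 'n::finite"
  assumes l: "l \<noteq> 0" and c: "c > 0"
  defines "\<mu> \<equiv> \<bar>l\<bar> / 4"
  shows "(LINT z|lborel. of_real (exp (- c * (norm z)\<^sup>2)) * twisted_kernel k l w z) =
    of_real ((pi / (\<mu> + c)) ^ CARD('n) * ((c - \<mu>) / (c + \<mu>)) ^ k * laguerre_fun k l w)"
proof -
  have \<mu>: "\<mu> > 0" using l by (simp add: \<mu>_def)
  \<comment> \<open>The eigenvalue ratio: composing the Moebius map of the generating function with
    the Gaussian integral of width \<open>c\<close> sends \<open>r\<close> to \<open>r * s\<close>,
    so the \<open>k\<close>-th coefficient is multiplied by \<open>s ^ k\<close>.\<close>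
  define s where "s = (c - \<mu>) / (c + \<mu>)"
  have s: "\<bar>s\<bar> < 1" using c \<mu> by (simp add: s_def abs_less_iff field_simps)
  define n where "n = CARD('n)"
  define B where "B = (5 / 4 :: real) ^ n"
  define F where "F k z = of_real (exp (- c * (norm z)\<^sup>2)) * twisted_kernel k l w z" for k z
  define G where "G r = complex_of_real ((pi / (\<mu> + c)) ^ n *
     (exp (- \<mu> * ((1 + r * s) / (1 - r * s)) * (norm w)\<^sup>2) / (1 - r * s) ^ n))" for r
  have e1: "exp (- c * (norm z)\<^sup>2) \<le> 1" for z :: "complex ^ 'n" using c by simp
  have lf_le: "\<bar>laguerre_fun k l z\<bar> \<le> 5 ^ k * B" for k and z :: "complex ^ 'n"
  proof -
    have "5 ^ k * (5 / 4) ^ CARD('n) * exp (- (\<bar>l\<bar> / 8) * (norm z)\<^sup>2) \<le> 5 ^ k * (5 / 4) ^ CARD('n) * 1"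
      by (intro mult_left_mono) auto
    then show ?thesis using laguerre_fun_bound[of k l z] unfolding B_def n_def by linarith
  qed
  have intc: "integrable lborel (\<lambda>z :: complex ^ 'n. exp (- c * (norm z)\<^sup>2))"
    using integrable_gaussian[OF c, of "0 :: complex ^ 'n"] by simp
  have intF: "integrable lborel (F k)" for k
    unfolding F_def
  proof (rule Bochner_Integration.integrable_bound[OF integrable_mult_right[OF intc, of "5 ^ k * B"]])
    show "AE z in lborel. norm (of_real (exp (- c * (norm z)\<^sup>2)) * twisted_kernel k l w z) \<le>
        norm (5 ^ k * B * exp (- c * (norm z)\<^sup>2))"
      using lf_le[of k] by (simp add: norm_mult norm_twisted_kernel B_def mult.commute[of "exp _"] mult_right_mono)
  qed simp
  \<comment> \<open>The growth 5^k in \<open>laguerre_fun_bound\<close> allows sum and integral to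
    be exchanged for |r| < 1/5; any neighbourhood of 0 is enough to identify coefficients.\<close>
  have lhs: "(\<lambda>k. (LINT z|lborel. F k z) * of_real (r ^ k)) sums G r" if r: "\<bar>r\<bar> < 1 / 5" for r
  proof -
    have r1: "\<bar>r\<bar> < 1" using r by simp
    define b where "b = \<mu> * ((1 + r) / (1 - r))"
    have b: "b > 0" using \<mu> r by (simp add: b_def)
    have rb: "(1 - r) * b = \<mu> * (1 + r)" using r by (simp add: b_def)
    let ?f = "\<lambda>k z. F k z * of_real (r ^ k)"
    let ?g = "\<lambda>z. of_real (exp (- c * (norm z)\<^sup>2)) * cis (- (l / 2) * (cmult_i w \<bullet> z)) *
         complex_of_real (exp (- b * (norm (w - z))\<^sup>2) / (1 - r) ^ n)"
    have le: "norm (?f k z) \<le> (5 * \<bar>r\<bar>) ^ k * (B * exp (- c * (norm z)\<^sup>2))" for k z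
    proof -
      have "norm (?f k z) = exp (- c * (norm z)\<^sup>2) * \<bar>laguerre_fun k l (w - z)\<bar> * \<bar>r\<bar> ^ k"
        by (simp add: F_def norm_mult norm_twisted_kernel power_abs norm_power)
      also have "\<dots> \<le> exp (- c * (norm z)\<^sup>2) * (5 ^ k * B) * \<bar>r\<bar> ^ k"
        by (intro mult_right_mono mult_left_mono lf_le) auto
      finally show ?thesis by (simp add: power_mult_distrib mult_ac)
    qed
    have geo: "summable (\<lambda>k. (5 * \<bar>r\<bar>) ^ k * x)" for x
      using r by (intro summable_mult2 summable_geometric) auto
    have "(\<lambda>k. LINT z|lborel. ?f k z) sums (LINT z|lborel. (\<Sum>k. ?f k z))"
    proof (rule sums_integral)
      show "integrable lborel (\<lambda>z. ?f k z)" for k using intF by simp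
      show "AE z in lborel. summable (\<lambda>k. norm (?f k z))"
        using le by (intro AE_I2 summable_comparison_test'[OF geo]) auto
      show "summable (\<lambda>k. LINT z|lborel. norm (?f k z))"
      proof (rule summable_comparison_test'[OF geo])
        fix k
        have "(LINT z|lborel. norm (?f k z)) \<le> (LINT z|lborel. (5 * \<bar>r\<bar>) ^ k * (B * exp (- c * (norm (z :: complex ^ 'n))\<^sup>2)))"
          using intF intc by (intro integral_mono integrable_norm integrable_mult_right integrable_mult_left le)
        then show "norm (LINT z|lborel. norm (?f k z)) \<le>
            (5 * \<bar>r\<bar>) ^ k * (B * (LINT z|lborel. exp (- c * (norm (z :: complex ^ 'n))\<^sup>2)))"
          by (simp add: abs_of_nonneg)
      qed
    qed
    also have "(\<lambda>z. \<Sum>k. ?f k z) = ?g"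
    proof
      fix z
      have "(\<lambda>k. complex_of_real (laguerre_fun k l (w - z) * r ^ k)) sums
          of_real (exp (- b * (norm (w - z))\<^sup>2) / (1 - r) ^ n)"
        using laguerre_fun_sums[OF r1, of l "w - z"]
        by (intro sums_of_real) (simp add: b_def \<mu>_def n_def)
      then have "(\<lambda>k. of_real (exp (- c * (norm z)\<^sup>2)) * cis (- (l / 2) * (cmult_i w \<bullet> z)) *
          complex_of_real (laguerre_fun k l (w - z) * r ^ k)) sums ?g z"
        by (rule sums_mult)
      also have "(\<lambda>k. of_real (exp (- c * (norm z)\<^sup>2)) * cis (- (l / 2) * (cmult_i w \<bullet> z)) *
          complex_of_real (laguerre_fun k l (w - z) * r ^ k)) = (\<lambda>k. ?f k z)"
        by (simp add: F_def twisted_kernel_def mult_ac)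
      finally show "(\<Sum>k. ?f k z) = ?g z" by (simp add: sums_iff)
    qed
    also have "(LINT z|lborel. ?g z) = G r"
    proof -
      define K where "K = exp (- b * (norm w)\<^sup>2) / (1 - r) ^ n"
      have "?g z = of_real K * (of_real (exp (- (b + c) * (norm z)\<^sup>2 + (2 * b) *\<^sub>R w \<bullet> z)) *
          cis ((- (l / 2)) *\<^sub>R cmult_i w \<bullet> z))" for z
      proof -
        have "- c * (norm z)\<^sup>2 + - b * (norm (w - z))\<^sup>2 =
          - b * (norm w)\<^sup>2 + (- (b + c) * (norm z)\<^sup>2 + (2 * b) *\<^sub>R w \<bullet> z)"
          by (simp add: power2_norm_eq_inner inner_diff inner_commute algebra_simps)
        from arg_cong[OF this, of exp]
        have "exp (- c * (norm z)\<^sup>2) * exp (- b * (norm (w - z))\<^sup>2) =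
          exp (- b * (norm w)\<^sup>2) * exp (- (b + c) * (norm z)\<^sup>2 + (2 * b) *\<^sub>R w \<bullet> z)"
          by (simp only: exp_add)
        then have "exp (- c * (norm z)\<^sup>2) * (exp (- b * (norm (w - z))\<^sup>2) / (1 - r) ^ n) =
          K * exp (- (b + c) * (norm z)\<^sup>2 + (2 * b) *\<^sub>R w \<bullet> z)"
          by (simp add: K_def)
        from arg_cong[OF this, of complex_of_real]
        have E: "of_real (exp (- c * (norm z)\<^sup>2)) * complex_of_real (exp (- b * (norm (w - z))\<^sup>2) / (1 - r) ^ n) =
          of_real K * of_real (exp (- (b + c) * (norm z)\<^sup>2 + (2 * b) *\<^sub>R w \<bullet> z))"
          by (simp only: of_real_mult)
        have "?g z = cis (- (l / 2) * (cmult_i w \<bullet> z)) *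
          (of_real (exp (- c * (norm z)\<^sup>2)) * complex_of_real (exp (- b * (norm (w - z))\<^sup>2) / (1 - r) ^ n))"
          by (simp only: mult_ac)
        then show ?thesis
          unfolding E inner_scaleR_left by (simp only: mult_ac)
      qed
      then have "(LINT z|lborel. ?g z) = of_real K * (of_real (sqrt (pi / (b + c)) ^ DIM(complex ^ 'n)) *
        exp ((of_real ((norm ((2 * b) *\<^sub>R w))\<^sup>2 - (norm ((- (l / 2)) *\<^sub>R cmult_i w))\<^sup>2) +
         2 * \<i> * of_real ((2 * b) *\<^sub>R w \<bullet> (- (l / 2)) *\<^sub>R cmult_i w)) / of_real (4 * (b + c))))"
        using gaussian_integral[of "b + c" "(2 * b) *\<^sub>R w" "(- (l / 2)) *\<^sub>R cmult_i w"] b c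
        by (simp only: integral_mult_right_zero has_bochner_integral_iff)
      \<comment> \<open>The mixed term of the Gaussian formula drops out because w is orthogonal to
        i w, so the value is real; (l/2)^2 / 4 is the square of \<open>\<mu>\<close>.\<close>
      also have "\<dots> = of_real (K * ((pi / (b + c)) ^ n * exp ((b\<^sup>2 - \<mu>\<^sup>2) / (b + c) * (norm w)\<^sup>2)))"
      proof -
        have 1: "sqrt (pi / (b + c)) ^ DIM(complex ^ 'n) = (pi / (b + c)) ^ n"
          using b c by (simp add: n_def power_mult mult.commute[of _ 2])
        have 2: "((norm ((2 * b) *\<^sub>R w))\<^sup>2 - (norm ((- (l / 2)) *\<^sub>R cmult_i w))\<^sup>2) / (4 * (b + c)) =
           (b\<^sup>2 - \<mu>\<^sup>2) / (b + c) * (norm w)\<^sup>2"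
          using b c by (simp add: norm_cmult_i power_mult_distrib \<mu>_def field_simps)
        have 3: "(2 * b) *\<^sub>R w \<bullet> (- (l / 2)) *\<^sub>R cmult_i w = 0"
          by (simp add: inner_cmult_i)
        have 4: "of_real ((norm ((2 * b) *\<^sub>R w))\<^sup>2 - (norm ((- (l / 2)) *\<^sub>R cmult_i w))\<^sup>2) / of_real (4 * (b + c)) =
           complex_of_real ((b\<^sup>2 - \<mu>\<^sup>2) / (b + c) * (norm w)\<^sup>2)"
          by (simp only: of_real_divide[symmetric] 2)
        show ?thesis
          unfolding 1 3 of_real_0 mult_zero_right add_0_right 4 exp_of_real by (simp only: of_real_mult)
      qed
      also have "K * ((pi / (b + c)) ^ n * exp ((b\<^sup>2 - \<mu>\<^sup>2) / (b + c) * (norm w)\<^sup>2)) =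
        (pi / ((1 - r) * (b + c))) ^ n * exp ((- b + (b\<^sup>2 - \<mu>\<^sup>2) / (b + c)) * (norm w)\<^sup>2)"
        by (simp only: distrib_right exp_add) (simp add: K_def power_divide power_mult_distrib)
      also have "(1 - r) * (b + c) = (\<mu> + c) * (1 - r * s)"
      proof -
        have "(1 - r) * (b + c) = \<mu> * (1 + r) + c * (1 - r)"
          using rb by (simp add: distrib_left mult.commute)
        also have "\<dots> = (\<mu> + c) - r * (c - \<mu>)" by (simp add: algebra_simps)
        also have "c - \<mu> = (\<mu> + c) * s" using c \<mu> by (simp add: s_def add.commute)
        finally show ?thesis by (simp add: algebra_simps)
      qed
      also have "- b + (b\<^sup>2 - \<mu>\<^sup>2) / (b + c) = - \<mu> * ((1 + r * s) / (1 - r * s))"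
      proof -
        have bc: "b + c > 0" using b c by simp
        have rs: "1 - r * s > 0"
          using abs_mult_less[OF r1 s] by (simp add: abs_mult[symmetric] abs_less_iff)
        have e2: "(1 - r) * (b + c) = (\<mu> + c) * (1 - r * s)" by fact
        have "(1 - r) * (b * c + \<mu>\<^sup>2) = ((1 - r) * b) * c + (1 - r) * \<mu>\<^sup>2"
          by (simp add: algebra_simps)
        also have "\<dots> = \<mu> * ((1 + r) * c + (1 - r) * \<mu>)"
          unfolding rb by (simp add: algebra_simps power2_eq_square)
        also have "\<dots> = \<mu> * ((\<mu> + c) + r * (c - \<mu>))" by (simp add: algebra_simps)
        also have "c - \<mu> = (\<mu> + c) * s" using c \<mu> by (simp add: s_def add.commute)
        also have "\<mu> * (\<mu> + c + r * ((\<mu> + c) * s)) = \<mu> * ((\<mu> + c) * (1 + r * s))"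
          by (simp add: algebra_simps)
        finally have e3: "(1 - r) * (b * c + \<mu>\<^sup>2) = \<mu> * ((\<mu> + c) * (1 + r * s))" .
        have "(b * c + \<mu>\<^sup>2) / (b + c) = ((1 - r) * (b * c + \<mu>\<^sup>2)) / ((1 - r) * (b + c))"
          using r by simp
        also have "\<dots> = \<mu> * ((1 + r * s) / (1 - r * s))"
          unfolding e2 e3 using c \<mu> rs by simp
        finally have "(b * c + \<mu>\<^sup>2) / (b + c) = \<mu> * ((1 + r * s) / (1 - r * s))" .
        moreover have "- b + (b\<^sup>2 - \<mu>\<^sup>2) / (b + c) = - ((b * c + \<mu>\<^sup>2) / (b + c))"
          using bc by (simp add: field_simps power2_eq_square)
        ultimately show ?thesis by simp
      qed
      finally show ?thesis by (simp add: G_def power_divide power_mult_distrib)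
    qed
    finally show ?thesis by simp
  qed
  have rhs: "(\<lambda>k. of_real ((pi / (\<mu> + c)) ^ n * s ^ k * laguerre_fun k l w) * of_real (r ^ k)) sums G r"
    if r: "\<bar>r\<bar> < 1 / 5" for r
  proof -
    have "\<bar>r * s\<bar> < 1" using abs_mult_less[of r 1 s 1] r s by (simp add: abs_mult)
    from sums_mult[OF laguerre_fun_sums[OF this, of l w], of "(pi / (\<mu> + c)) ^ n"]
    have "(\<lambda>k. ((pi / (\<mu> + c)) ^ n * s ^ k * laguerre_fun k l w) * r ^ k) sums
      ((pi / (\<mu> + c)) ^ n * (exp (- \<mu> * ((1 + r * s) / (1 - r * s)) * (norm w)\<^sup>2) / (1 - r * s) ^ n))"
      by (simp add: power_mult_distrib mult_ac \<mu>_def n_def)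
    from sums_of_real[OF this, where 'a = complex] show ?thesis
      by (simp only: G_def of_real_mult)
  qed
  show ?thesis
    using powser_eq_imp_coeff_eq[OF _ lhs rhs, of "1 / 5" k] unfolding F_def s_def n_def by simp
qed

lemma twisted_kernel_0: "twisted_kernel k l 0 z = of_real (laguerre_fun k l z)"
  by (simp add: twisted_kernel_def cmult_i_0 laguerre_fun_def)

lemma laguerre_fun_0: "laguerre_fun k l (0 :: complex ^ 'n::finite) > 0"
proof -
  have "poly (laguerre k (real (CARD('n) - 1))) 0 > 0"
    by (simp only: poly_laguerre_0 of_nat_0_less_iff zero_less_binomial_iff le_add1)
  then show ?thesis by (simp add: laguerre_fun_def)
qed

text \<open>
  The exponentials \<open>exp (- j x)\<close> with \<open>j \<ge> 1\<close> span a uniformly dense set of functions of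
  \<open>x = norm z ^ 2\<close>, by Weierstrass in the variable \<open>exp (- x)\<close>.
\<close>

lemma twisted_convolution_radial:
  fixes w :: "complex ^ 'n::finite" and g :: "real \<Rightarrow> real"
  assumes l: "l \<noteq> 0" and g: "continuous_on UNIV g" "\<And>x. x \<ge> X \<Longrightarrow> g x = 0"
  shows "of_real (laguerre_fun k l (0 :: complex ^ 'n)) *
      (LINT z|lborel. of_real (g ((norm z)\<^sup>2)) * twisted_kernel k l w z) =
    of_real (laguerre_fun k l w) *
      (LINT z|lborel. of_real (g ((norm z)\<^sup>2)) * of_real (laguerre_fun k l (z :: complex ^ 'n)))"
proof -
  \<comment> \<open>The claim says that integration against \<open>Q\<close> kills radial functions.
    It kills every exp(-c |z|^2) with c > 0, since the factor in \<open>twisted_gaussian\<close> in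
    front of \<open>laguerre_fun k l w\<close> does not depend on \<open>w\<close>.\<close>
  define Q where "Q z = of_real (laguerre_fun k l (0 :: complex ^ 'n)) * twisted_kernel k l w z -
    of_real (laguerre_fun k l w) * twisted_kernel k l (0 :: complex ^ 'n) z" for z
  have intQ: "integrable lborel Q"
    unfolding Q_def by (intro Bochner_Integration.integrable_diff integrable_mult_right twisted_kernel_integrable l)
  have bounded: "integrable lborel (\<lambda>z. of_real (h z) * K z)"
    if "integrable lborel K" "h \<in> borel_measurable borel" "\<And>z. \<bar>h z\<bar> \<le> C"
    for h :: "complex ^ 'n \<Rightarrow> real" and K :: "complex ^ 'n \<Rightarrow> complex" and C
  proof (rule Bochner_Integration.integrable_bound[OF integrable_mult_right[OF that(1), of "of_real C"]])
    show "(\<lambda>z. of_real (h z) * K z) \<in> borel_measurable lborel"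
      using that(2) borel_measurable_integrable[OF that(1)] by simp
    show "AE z in lborel. norm (of_real (h z) * K z) \<le> norm (of_real C * K z)"
    proof (rule AE_I2)
      fix z
      have "\<bar>h z\<bar> \<le> \<bar>C\<bar>" using that(3)[of z] by linarith
      then show "norm (of_real (h z) * K z) \<le> norm (of_real C * K z)"
        by (simp add: norm_mult mult_right_mono)
    qed
  qed
  define \<Lambda> where "\<Lambda> h = (LINT z|lborel. of_real (h z) * Q z)" for h
  have exp0: "\<Lambda> (\<lambda>z. exp (- c * (norm z)\<^sup>2)) = 0" if c: "c > 0" for c
  proof -
    have K: "integrable lborel (\<lambda>z. of_real (exp (- c * (norm z)\<^sup>2)) * twisted_kernel k l w z)" for w :: "complex ^ 'n"
      using c by (intro bounded[where C = 1] twisted_kernel_integrable l) auto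
    have "\<Lambda> (\<lambda>z. exp (- c * (norm z)\<^sup>2)) = (LINT z|lborel.
        of_real (laguerre_fun k l (0 :: complex ^ 'n)) * (of_real (exp (- c * (norm z)\<^sup>2)) * twisted_kernel k l w z)
      - of_real (laguerre_fun k l w) * (of_real (exp (- c * (norm z)\<^sup>2)) * twisted_kernel k l (0 :: complex ^ 'n) z))"
      unfolding \<Lambda>_def Q_def by (simp add: algebra_simps)
    also have "\<dots> = of_real (laguerre_fun k l (0 :: complex ^ 'n)) *
         (LINT z|lborel. of_real (exp (- c * (norm z)\<^sup>2)) * twisted_kernel k l w z)
       - of_real (laguerre_fun k l w) * (LINT z|lborel. of_real (exp (- c * (norm z)\<^sup>2)) * twisted_kernel k l (0 :: complex ^ 'n) z)"
      using K by (subst Bochner_Integration.integral_diff) auto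
    also have "\<dots> = 0" by (simp only: twisted_gaussian[OF l c] of_real_mult[symmetric]) (simp add: mult_ac)
    finally show ?thesis .
  qed
  have gm: "(\<lambda>z :: complex ^ 'n. g ((norm z)\<^sup>2)) \<in> borel_measurable borel"
    by (intro borel_measurable_continuous_onI continuous_on_compose2[OF g(1)] continuous_intros) auto
  have small: "norm (\<Lambda> (\<lambda>z. g ((norm z)\<^sup>2))) \<le> 2 * e * (LINT z|lborel. norm (Q z))" if e: "e > 0" for e
  proof -
    \<comment> \<open>This is \<open>g\<close> in the variable y = exp(-x). Because \<open>g\<close>
      vanishes beyond \<open>X\<close>, \<open>h\<close> vanishes near 0 and stays continuous there,
      so it can be approximated on all of [0, 1].\<close>
    define h where "h y = (if y \<le> 0 then 0 else g (- ln y))" for y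
    have "continuous_on ({..exp (- X)} \<union> {exp (- X)..}) h"
    proof (rule continuous_on_closed_Un)
      have "h y = 0" if "y \<le> exp (- X)" for y
      proof (cases "y \<le> 0")
        case False
        then have "ln y \<le> ln (exp (- X))" using that by (subst ln_le_cancel_iff) auto
        then show ?thesis using g(2)[of "- ln y"] by (simp add: h_def)
      qed (simp add: h_def)
      then show "continuous_on {..exp (- X)} h"
        by (subst continuous_on_cong[OF refl, where g = "\<lambda>_. 0"]) auto
      have "continuous_on {exp (- X)..} (\<lambda>y. g (- ln y))"
        by (intro continuous_on_compose2[OF g(1)] continuous_intros)
          (use exp_gt_zero[of "- X"] in \<open>auto simp del: exp_gt_zero\<close>)
      moreover have "h y = g (- ln y)" if "y \<ge> exp (- X)" for y
        using that less_le_trans[OF exp_gt_zero that] by (simp add: h_def)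
      ultimately show "continuous_on {exp (- X)..} h"
        by (subst continuous_on_cong[OF refl, where g = "\<lambda>y. g (- ln y)"]) auto
    qed auto
    then have "continuous_on {0..1} h" by (rule continuous_on_subset) auto
    then obtain P where P: "real_polynomial_function P" "\<And>y. y \<in> {0..1} \<Longrightarrow> \<bar>h y - P y\<bar> < e"
      using Stone_Weierstrass_real_polynomial_function[OF compact_Icc _ e] by metis
    from P(1) obtain a N where a: "P = (\<lambda>x. \<Sum>i\<le>N. a i * x ^ i)"
      unfolding real_polynomial_function_iff_sum by blast
    \<comment> \<open>The constant term corresponds to c = 0, which \<open>exp0\<close> excludes.
      Since \<open>h 0 = 0\<close> it is smaller than \<open>e\<close>, and discarding it only
      doubles the error.\<close>
    have a0: "\<bar>a 0\<bar> < e"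
    proof -
      have "P 0 = (\<Sum>i\<in>{0}. a i * 0 ^ i)" unfolding a by (rule sum.mono_neutral_right) auto
      then show ?thesis using P(2)[of 0] by (simp add: h_def)
    qed
    define p where "p z = (\<Sum>i\<in>{1..N}. a i * exp (- real i * (norm z)\<^sup>2))" for z :: "complex ^ 'n"
    have pe: "p z = P (exp (- (norm z)\<^sup>2)) - a 0" for z
    proof -
      have "{..N} = insert 0 {1..N}" by auto
      then show ?thesis by (simp add: p_def a exp_of_nat_mult[symmetric])
    qed
    have close: "\<bar>g ((norm z)\<^sup>2) - p z\<bar> \<le> 2 * e" for z
      using P(2)[of "exp (- (norm z)\<^sup>2)"] a0 by (simp add: pe h_def)
    have pint: "integrable lborel (\<lambda>z. of_real (exp (- real i * (norm z)\<^sup>2)) * Q z)" for i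
      by (rule bounded[OF intQ, where C = 1]) auto
    have "\<Lambda> p = (LINT z|lborel. (\<Sum>i\<in>{1..N}. of_real (a i) * (of_real (exp (- real i * (norm z)\<^sup>2)) * Q z)))"
      unfolding \<Lambda>_def p_def by (simp add: sum_distrib_right mult.assoc)
    also have "\<dots> = (\<Sum>i\<in>{1..N}. of_real (a i) * \<Lambda> (\<lambda>z. exp (- real i * (norm z)\<^sup>2)))"
      using pint by (subst Bochner_Integration.integral_sum) (auto simp: \<Lambda>_def)
    also have "\<dots> = 0" using exp0[of "real _"] by (intro sum.neutral) auto
    finally have \<Lambda>p: "\<Lambda> p = 0" .
    have pm: "p \<in> borel_measurable borel" unfolding p_def[abs_def] by measurable
    have dint: "integrable lborel (\<lambda>z. of_real (g ((norm z)\<^sup>2) - p z) * Q z)"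
      using gm pm by (intro bounded[OF intQ, where C = "2 * e"] close) auto
    have pint': "integrable lborel (\<lambda>z. of_real (p z) * Q z)"
    proof -
      have "(\<lambda>z. of_real (p z) * Q z) = (\<lambda>z. \<Sum>i\<in>{1..N}. of_real (a i) * (of_real (exp (- real i * (norm z)\<^sup>2)) * Q z))"
        by (simp add: p_def sum_distrib_right mult.assoc)
      then show ?thesis using pint by simp
    qed
    have "\<Lambda> (\<lambda>z. g ((norm z)\<^sup>2)) = (LINT z|lborel. of_real (g ((norm z)\<^sup>2) - p z) * Q z + of_real (p z) * Q z)"
      unfolding \<Lambda>_def by (simp add: algebra_simps)
    also have "\<dots> = (LINT z|lborel. of_real (g ((norm z)\<^sup>2) - p z) * Q z)"
      using \<Lambda>p unfolding \<Lambda>_def by (subst Bochner_Integration.integral_add[OF dint pint']) simp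
    finally have "norm (\<Lambda> (\<lambda>z. g ((norm z)\<^sup>2))) \<le> (LINT z|lborel. norm (of_real (g ((norm z)\<^sup>2) - p z) * Q z))"
      by simp
    also have "\<dots> \<le> (LINT z|lborel. 2 * e * norm (Q z))"
    proof (rule integral_mono)
      show "norm (of_real (g ((norm z)\<^sup>2) - p z) * Q z) \<le> 2 * e * norm (Q z)" for z
        unfolding norm_mult norm_of_real using close[of z] by (intro mult_right_mono) auto
    qed (use dint intQ in auto)
    finally show ?thesis by simp
  qed
  have "norm (\<Lambda> (\<lambda>z. g ((norm z)\<^sup>2))) \<le> 0"
  proof (rule field_le_epsilon)
    fix d :: real assume d: "d > 0"
    define I where "I = (LINT z|lborel. norm (Q z))"
    have I: "I \<ge> 0" by (simp add: I_def)
    have "2 * (d / (2 * (I + 1))) * I \<le> d" using d I by (simp add: field_simps)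
    then show "norm (\<Lambda> (\<lambda>z. g ((norm z)\<^sup>2))) \<le> 0 + d"
      using small[of "d / (2 * (I + 1))"] d I by (simp add: I_def[symmetric])
  qed
  then have 0: "\<Lambda> (\<lambda>z. g ((norm z)\<^sup>2)) = 0" by simp
  obtain C where C: "\<And>z :: complex ^ 'n. \<bar>g ((norm z)\<^sup>2)\<bar> \<le> C"
  proof -
    have "compact (g ` {0..X})" by (intro compact_continuous_image continuous_on_subset[OF g(1)]) auto
    then obtain C where "\<And>x. x \<in> {0..X} \<Longrightarrow> \<bar>g x\<bar> \<le> C"
      using compact_imp_bounded bounded_iff by (metis image_eqI real_norm_def)
    then have "\<bar>g ((norm z)\<^sup>2)\<bar> \<le> max C 0" for z :: "complex ^ 'n"
      using g(2)[of "(norm z)\<^sup>2"] by (cases "(norm z)\<^sup>2 \<le> X") (auto simp: le_max_iff_disj)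
    then show thesis using that by blast
  qed
  have K: "integrable lborel (\<lambda>z. of_real (g ((norm z)\<^sup>2)) * twisted_kernel k l w z)" for w :: "complex ^ 'n"
    by (intro bounded[OF _ gm C] twisted_kernel_integrable l)
  have "\<Lambda> (\<lambda>z. g ((norm z)\<^sup>2)) = (LINT z|lborel.
        of_real (laguerre_fun k l (0 :: complex ^ 'n)) * (of_real (g ((norm z)\<^sup>2)) * twisted_kernel k l w z)
      - of_real (laguerre_fun k l w) * (of_real (g ((norm z)\<^sup>2)) * twisted_kernel k l (0 :: complex ^ 'n) z))"
    unfolding \<Lambda>_def Q_def by (simp add: algebra_simps)
  also have "\<dots> = of_real (laguerre_fun k l (0 :: complex ^ 'n)) *
         (LINT z|lborel. of_real (g ((norm z)\<^sup>2)) * twisted_kernel k l w z)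
       - of_real (laguerre_fun k l w) * (LINT z|lborel. of_real (g ((norm z)\<^sup>2)) * twisted_kernel k l (0 :: complex ^ 'n) z)"
    using K by (subst Bochner_Integration.integral_diff) auto
  finally show ?thesis using 0 by (simp add: twisted_kernel_0)
qed

section \<open>Smooth functions of compact support\<close>

text \<open>The power \<open>y ^ j\<close> is carried along so that the family is closed under
  differentiation; the cut-off itself uses only \<open>j = 0\<close>.\<close>

definition flat_exp :: "nat \<Rightarrow> real \<Rightarrow> real" where
  "flat_exp j y = (if y \<le> 0 then 0 else exp (- 1 / y) / y ^ j)"

lemma flat_exp_tendsto_0: "(flat_exp j \<longlongrightarrow> 0) (at 0)"
proof -
  have "((\<lambda>y::real. inverse y ^ j / exp (inverse y)) \<longlongrightarrow> 0) (at_right 0)"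
    by (rule filterlim_compose[OF tendsto_power_div_exp_0 filterlim_inverse_at_top_right])
  then have "(flat_exp j \<longlongrightarrow> 0) (at_right 0)"
    by (rule Lim_transform_eventually)
      (auto simp: eventually_at_right_field flat_exp_def exp_minus field_simps intro!: exI[of _ 1])
  moreover have "(flat_exp j \<longlongrightarrow> 0) (at_left 0)"
    by (rule tendsto_eventually)
      (auto simp: eventually_at_left_field flat_exp_def intro!: exI[of _ "-1"])
  ultimately show ?thesis by (simp add: filterlim_at_split)
qed

lemma has_real_derivative_flat_exp:
  "(flat_exp j has_real_derivative flat_exp (j + 2) y - real j * flat_exp (j + 1) y) (at y)"
proof (cases y "0 :: real" rule: linorder_cases)
  case less
  have "((\<lambda>_. 0) has_real_derivative 0) (at y)" by simp
  then have "(flat_exp j has_real_derivative 0) (at y)"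
    by (rule has_field_derivative_transform_within_open[where S = "{..<0}"])
      (use less in \<open>auto simp: flat_exp_def\<close>)
  then show ?thesis using less by (simp add: flat_exp_def)
next
  case equal
  \<comment> \<open>At the origin the difference quotient of \<open>flat_exp j\<close> is
    \<open>flat_exp (j + 1)\<close>.\<close>
  have "((\<lambda>h. (flat_exp j (0 + h) - flat_exp j 0) / h) \<longlongrightarrow> 0) (at 0)"
    by (rule Lim_transform_eventually[OF flat_exp_tendsto_0[of "j + 1"]])
      (auto simp: flat_exp_def eventually_at_filter field_simps)
  then show ?thesis unfolding equal DERIV_def by (simp add: flat_exp_def)
next
  case greater
  have "((\<lambda>y. exp (- 1 / y) * inverse y ^ j) has_real_derivative
     (exp (- 1 / y) * inverse y ^ (j + 2) - real j * (exp (- 1 / y) * inverse y ^ (j + 1)))) (at y)"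
  proof -
    have e: "((\<lambda>y. exp (- 1 / y)) has_real_derivative exp (- 1 / y) * inverse y ^ 2) (at y)"
      using greater by (auto intro!: derivative_eq_intros simp: power2_eq_square divide_inverse)
    have "((\<lambda>y. inverse y ^ j) has_real_derivative
        real j * ((- (inverse y ^ Suc (Suc 0))) * inverse y ^ (j - Suc 0))) (at y)"
      using greater by (intro DERIV_power DERIV_inverse) auto
    also have "real j * ((- (inverse y ^ Suc (Suc 0))) * inverse y ^ (j - Suc 0)) =
        - real j * inverse y ^ (j + 1)"
      by (cases j) (simp_all add: algebra_simps)
    finally have p: "((\<lambda>y. inverse y ^ j) has_real_derivative - real j * inverse y ^ (j + 1)) (at y)" .
    show ?thesis
      using DERIV_mult[OF e p] by (simp only: power_add) (simp add: algebra_simps)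
  qed
  then have "(flat_exp j has_real_derivative
     (exp (- 1 / y) * inverse y ^ (j + 2) - real j * (exp (- 1 / y) * inverse y ^ (j + 1)))) (at y)"
    by (rule has_field_derivative_transform_within_open[where S = "{0<..}"])
      (use greater in \<open>auto simp: flat_exp_def divide_inverse power_inverse\<close>)
  then show ?thesis using greater
    by (simp add: flat_exp_def divide_inverse power_inverse)
qed

text \<open>
  Closed under directional derivatives, so that its compactly supported members are
  Schwartz functions.
\<close>

inductive smooth_alg :: "('a::euclidean_space \<Rightarrow> real) \<Rightarrow> bool" where
  linear: "bounded_linear f \<Longrightarrow> smooth_alg f"
| const: "smooth_alg (\<lambda>x. c)"
| add: "smooth_alg f \<Longrightarrow> smooth_alg g \<Longrightarrow> smooth_alg (\<lambda>x. f x + g x)"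
| mult: "smooth_alg f \<Longrightarrow> smooth_alg g \<Longrightarrow> smooth_alg (\<lambda>x. f x * g x)"
| flat: "smooth_alg f \<Longrightarrow> smooth_alg (\<lambda>x. flat_exp j (f x))"

lemma real_polynomial_function_imp_smooth_alg:
  "real_polynomial_function f \<Longrightarrow> smooth_alg f"
  by (induction rule: real_polynomial_function.induct) (auto intro: smooth_alg.intros)

lemma smooth_alg_has_derivative:
  assumes "smooth_alg f"
  shows "\<exists>D. (\<forall>x. (f has_derivative D x) (at x)) \<and> (\<forall>b. smooth_alg (\<lambda>x. D x b))"
  using assms
proof induction
  case (linear f)
  then show ?case
    by (intro exI[of _ "\<lambda>x. f"]) (auto intro: bounded_linear_imp_has_derivative smooth_alg.const)
next
  case (const c)
  show ?case by (intro exI[of _ "\<lambda>x b. 0"]) (auto intro: smooth_alg.const)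
next
  case (add f g)
  then obtain D E where "\<forall>x. (f has_derivative D x) (at x)" "\<forall>b. smooth_alg (\<lambda>x. D x b)"
    "\<forall>x. (g has_derivative E x) (at x)" "\<forall>b. smooth_alg (\<lambda>x. E x b)" by blast
  then show ?case
    by (intro exI[of _ "\<lambda>x b. D x b + E x b"]) (auto intro: has_derivative_add smooth_alg.add)
next
  case (mult f g)
  then obtain D E where "\<forall>x. (f has_derivative D x) (at x)" "\<forall>b. smooth_alg (\<lambda>x. D x b)"
    "\<forall>x. (g has_derivative E x) (at x)" "\<forall>b. smooth_alg (\<lambda>x. E x b)" by blast
  moreover from this mult.hyps have "smooth_alg (\<lambda>x. f x * E x b + D x b * g x)" for b
    by (intro smooth_alg.add smooth_alg.mult) auto
  ultimately show ?case
    by (intro exI[of _ "\<lambda>x b. f x * E x b + D x b * g x"]) (auto intro: has_derivative_mult)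
next
  case (flat f j)
  then obtain D where D: "\<forall>x. (f has_derivative D x) (at x)" "\<forall>b. smooth_alg (\<lambda>x. D x b)" by blast
  let ?d = "\<lambda>x. flat_exp (j + 2) (f x) + (- real j) * flat_exp (j + 1) (f x)"
  have "((\<lambda>x. flat_exp j (f x)) has_derivative (\<lambda>b. ?d x * D x b)) (at x)" for x
  proof -
    have "(flat_exp j has_derivative (\<lambda>h. ?d x * h)) (at (f x))"
      using has_real_derivative_flat_exp[of j "f x"] by (simp add: has_field_derivative_def)
    from has_derivative_compose[OF D(1)[rule_format] this] show ?thesis .
  qed
  moreover have "smooth_alg ?d"
    using flat.hyps by (intro smooth_alg.add smooth_alg.mult smooth_alg.const smooth_alg.flat)
  ultimately show ?case using D(2)
    by (intro exI[of _ "\<lambda>x b. ?d x * D x b"]) (auto intro: smooth_alg.mult)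
qed

lemma smooth_alg_continuous: "smooth_alg f \<Longrightarrow> continuous_on S f"
  using smooth_alg_has_derivative[of f]
  by (meson continuous_at_imp_continuous_on has_derivative_continuous)

text \<open>Iterated derivatives stay in the algebra, and they vanish on {norm x > R} because that
  set is open. Each weighted derivative is therefore continuous and determined by its values on a
  compact ball.\<close>

lemma smooth_alg_imp_schwartz:
  fixes f :: "'a::euclidean_space \<Rightarrow> real"
  assumes f: "smooth_alg f" and R: "\<And>x. norm x > R \<Longrightarrow> f x = 0"
  shows "schwartz (\<lambda>x. of_real (f x))"
proof -
  have iter: "\<exists>g. smooth_alg g \<and> (\<forall>x. norm x > R \<longrightarrow> g x = 0) \<and>
      iter_pderiv bs (\<lambda>x. of_real (f x)) = (\<lambda>x. of_real (g x))" for bs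
  proof (induction bs)
    case Nil
    then show ?case using f R by auto
  next
    case (Cons b bs)
    then obtain g where g: "smooth_alg g" "\<And>x. norm x > R \<Longrightarrow> g x = 0"
      "iter_pderiv bs (\<lambda>x. of_real (f x)) = (\<lambda>x. of_real (g x))" by blast
    obtain D where D: "\<And>x. (g has_derivative D x) (at x)" "\<And>b. smooth_alg (\<lambda>x. D x b)"
      using smooth_alg_has_derivative[OF g(1)] by blast
    have "frechet_derivative (\<lambda>x. complex_of_real (g x)) (at x) = (\<lambda>h. of_real (D x h))" for x
      by (rule frechet_derivative_at[symmetric]) (rule has_derivative_of_real[OF D(1)])
    moreover have "D x b = 0" if "norm x > R" for x
    proof -
      have "((\<lambda>_. 0) has_derivative (\<lambda>_. 0)) (at x)" by simp
      then have "(g has_derivative (\<lambda>_. 0)) (at x)"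
        by (rule has_derivative_transform_within_open[where s = "{x. R < norm x}"])
          (use that g(2) in \<open>auto intro: open_Collect_less continuous_intros\<close>)
      then have "D x = (\<lambda>_. 0)" by (rule has_derivative_unique[OF D(1)])
      then show ?thesis by simp
    qed
    ultimately show ?case using D(2)[of b] by (intro exI[of _ "\<lambda>x. D x b"]) (simp add: g(3))
  qed
  show ?thesis
    unfolding schwartz_def
  proof (intro allI impI conjI)
    fix bs :: "'a list" and x :: 'a and N :: nat
    obtain g where g: "smooth_alg g" "\<And>x. norm x > R \<Longrightarrow> g x = 0"
      "iter_pderiv bs (\<lambda>x. of_real (f x)) = (\<lambda>x. of_real (g x))" using iter by blast
    obtain D where D: "\<And>x. (g has_derivative D x) (at x)"
      using smooth_alg_has_derivative[OF g(1)] by blast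
    show "iter_pderiv bs (\<lambda>x. of_real (f x)) differentiable at x"
      unfolding g(3) differentiable_def using has_derivative_of_real[OF D] by blast
    let ?F = "\<lambda>x. (1 + norm x) ^ N *\<^sub>R complex_of_real (g x)"
    have "continuous_on (cball 0 R) ?F"
      by (intro continuous_intros smooth_alg_continuous g(1))
    then have "bounded (?F ` cball 0 R)"
      by (intro compact_imp_bounded compact_continuous_image) auto
    moreover have "range ?F \<subseteq> ?F ` cball 0 R \<union> {0}"
    proof
      fix y assume "y \<in> range ?F"
      then obtain x where y: "y = ?F x" by blast
      show "y \<in> ?F ` cball 0 R \<union> {0}"
      proof (cases "norm x \<le> R")
        case True
        then have "x \<in> cball 0 R" by simp
        then show ?thesis unfolding y by blast
      next
        case False
        then show ?thesis unfolding y using g(2)[of x] by simp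
      qed
    qed
    ultimately show "bounded (range (\<lambda>x. (1 + norm x) ^ N *\<^sub>R iter_pderiv bs (\<lambda>x. of_real (f x)) x))"
      unfolding g(3) by (meson bounded_Un bounded_insert bounded_empty bounded_subset)
  qed
qed

section \<open>Radial functions and null sets\<close>

lemma AE_ex_in:
  assumes "AE x in M. Q x" "emeasure M A \<noteq> 0" "A \<subseteq> space M"
  shows "\<exists>x\<in>A. Q x"
proof (rule ccontr)
  assume "\<not> ?thesis"
  with assms(1) have "AE x in M. \<not> x \<in> A" by (auto elim: AE_mp)
  from emeasure_eq_0_AE[OF this] assms(3) have "emeasure M A = 0"
    by (simp add: Collect_conj_eq Int_absorb1)
  with assms(2) show False by simp
qed

lemma AE_lborel_scaleR:
  fixes P :: "'a::euclidean_space \<Rightarrow> bool"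
  assumes "c \<noteq> 0" "Measurable.pred borel P" "AE x in lborel. P x"
  shows "AE x in lborel. P (c *\<^sub>R x)"
  using assms
  by (subst lborel_affine[where t = 0 and c = "1 / c"])
     (simp_all add: AE_density AE_distr_iff field_simps)

lemma AE_lborel_commute:
  fixes P :: "'a::euclidean_space \<Rightarrow> 'b::euclidean_space \<Rightarrow> bool"
  assumes "Measurable.pred borel (\<lambda>x. P (fst x) (snd x))"
  shows "(AE x in lborel. AE y in lborel. P x y) \<longleftrightarrow> (AE y in lborel. AE x in lborel. P x y)"
proof (rule lborel_pair.AE_commute)
  show "{x \<in> space (lborel \<Otimes>\<^sub>M lborel). P (fst x) (snd x)} \<in> sets (lborel \<Otimes>\<^sub>M lborel)"
    unfolding lborel_prod using assms by (simp add: pred_def)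
qed

lemma AE_lborel_prod_iff:
  fixes P :: "'a::euclidean_space \<times> 'b::euclidean_space \<Rightarrow> bool"
  assumes "Measurable.pred borel P"
  shows "(AE x in lborel. P x) \<longleftrightarrow> (AE t in lborel. AE z in lborel. P (z, t))"
proof -
  have "{x \<in> space (lborel \<Otimes>\<^sub>M lborel). P (fst x, snd x)} \<in> sets (lborel \<Otimes>\<^sub>M (lborel :: 'b measure))"
    unfolding lborel_prod using assms by (simp add: pred_def)
  from lborel_pair.AE_pair_iff[of "\<lambda>x y. P (x, y)", OF this, unfolded lborel_prod]
  have "(AE x in lborel. P x) \<longleftrightarrow> (AE z in lborel. AE t in lborel. P (z, t))" by simp
  also have "\<dots> \<longleftrightarrow> (AE t in lborel. AE z in lborel. P (z, t))"
    by (rule AE_lborel_commute) (use assms in simp)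
  finally show ?thesis .
qed

text \<open>Fubini takes the place of polar coordinates. For fixed z \<noteq> 0 the property holds
  at |z| r for almost every r; exchanging the quantifiers yields one r in [1, 2] that serves almost
  every z, and scaling by 1/r preserves null sets.\<close>

lemma AE_lborel_norm:
  fixes P :: "real \<Rightarrow> bool"
  assumes P [measurable]: "Measurable.pred borel P" and AE: "AE x in lborel. P x"
  shows "AE z::'a::euclidean_space in lborel. P (norm z)"
proof -
  have m: "Measurable.pred borel (\<lambda>x :: 'a \<times> real. P (norm (fst x) * snd x))"
    by (rule measurable_compose[OF _ P]) (intro borel_measurable_continuous_onI continuous_intros)
  have "AE z::'a in lborel. AE r in lborel. P (norm z * r)"
    using AE_lborel_singleton[of "0 :: 'a"]
  proof eventually_elim
    case (elim z)
    then show ?case using AE_borel_affine[OF _ P AE, of "norm z" 0] by simp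
  qed
  then have "AE r in lborel. AE z::'a in lborel. P (norm z * r)"
    using AE_lborel_commute[OF m] by simp
  moreover have "emeasure lborel {1..2 :: real} \<noteq> 0" by simp
  ultimately obtain r where r: "1 \<le> r" "AE z::'a in lborel. P (norm z * r)"
    using AE_ex_in[where M = lborel and Q = "\<lambda>r. AE z::'a in lborel. P (norm z * r)" and A = "{1..2}"] by auto
  then have "AE z::'a in lborel. P (norm ((1 / r) *\<^sub>R z) * r)"
    by (intro AE_lborel_scaleR[where P = "\<lambda>z. P (norm z * r)"]) auto
  then show ?thesis using r(1) by simp
qed

lemma AE_lborel_radial:
  fixes P :: "real \<times> real \<Rightarrow> bool"
  assumes P [measurable]: "Measurable.pred borel P" and AE: "AE t in lborel. AE r in lborel. P (r, t)"
    and c: "c \<noteq> 0"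
  shows "AE (z, t) in lborel. P (c * norm (z :: 'a::euclidean_space), t)"
proof -
  have m: "Measurable.pred borel (\<lambda>(z :: 'a, t). P (c * norm z, t))"
    unfolding case_prod_unfold
    by (rule measurable_compose[OF _ P]) (intro borel_measurable_continuous_onI continuous_intros)
  have "AE t in lborel. AE z::'a in lborel. P (c * norm z, t)"
    using AE
  proof eventually_elim
    case (elim t)
    have mt: "Measurable.pred borel (\<lambda>r. P (r, t))" by measurable
    then have "AE r in lborel. P (c * r, t)"
      using AE_borel_affine[OF c mt elim, of 0] by simp
    then show ?case by (intro AE_lborel_norm[where P = "\<lambda>r. P (c * r, t)"]) measurable
  qed
  then show ?thesis using AE_lborel_prod_iff[OF m] by simp
qed

text \<open>Restricting \<open>v\<close> to a plane of points (r y, t) could land inside the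
  exceptional null set \<open>N\<close>. By Fubini over all dilations, almost every \<open>y\<close>
  has the property that (r y, t) avoids \<open>N\<close> for almost all t and r. Fixing one such y
  \<noteq> 0 and reading the Borel version \<open>v'\<close> along it gives
  \<open>V\<close>.\<close>

lemma radial_borel_representative:
  fixes v :: "'a::euclidean_space \<times> real \<Rightarrow> real"
  assumes v: "v \<in> borel_measurable (completion lborel)"
    and rad: "\<And>z z' t. norm z = norm z' \<Longrightarrow> v (z, t) = v (z', t)"
  obtains V :: "real \<times> real \<Rightarrow> real"
  where "V \<in> borel_measurable borel" "AE (z, t) in lborel. v (z, t) = V (norm z, t)"
proof -
  obtain v' where v' [measurable]: "v' \<in> borel_measurable borel" and eq: "AE x in lborel. v x = v' x"
    using completion_ex_borel_measurable_real[OF v] by auto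
  obtain N where N: "N \<in> sets lborel" "emeasure lborel N = 0" "{x \<in> space lborel. v x \<noteq> v' x} \<subseteq> N"
    using eq by (auto elim: AE_E)
  define P where "P x \<longleftrightarrow> x \<notin> N" for x
  have P [measurable]: "Measurable.pred borel P"
    unfolding P_def using N(1) by (intro pred_intros_logic pred_sets2) auto
  have Peq: "v x = v' x" if "P x" for x using that N(3) by (auto simp: P_def)
  have "AE x in lborel. P x"
    unfolding P_def using N by (intro AE_not_in) (auto simp: null_sets_def)
  then have AEP: "AE t in lborel. AE z in lborel. P (z, t)"
    using AE_lborel_prod_iff[OF P] by simp
  have scaled: "AE x in lborel. P (r *\<^sub>R fst x, snd x)" if "r \<noteq> 0" for r
  proof -
    have "AE t in lborel. AE z in lborel. P (r *\<^sub>R z, t)"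
      using AEP
    proof eventually_elim
      case (elim t)
      then show ?case by (intro AE_lborel_scaleR[OF that, where P = "\<lambda>z. P (z, t)"]) measurable
    qed
    moreover have "Measurable.pred borel (\<lambda>x. P (r *\<^sub>R fst x, snd x))"
      by (rule measurable_compose[OF _ P]) (intro borel_measurable_continuous_onI continuous_intros)
    ultimately show ?thesis using AE_lborel_prod_iff[of "\<lambda>x. P (r *\<^sub>R fst x, snd x)"] by simp
  qed
  have "AE r in lborel. AE x in lborel. P (r *\<^sub>R fst x, snd x)"
    using AE_lborel_singleton[of "0 :: real"] by eventually_elim (rule scaled)
  moreover have "Measurable.pred borel (\<lambda>y. P (fst y *\<^sub>R fst (snd y), snd (snd y)))"
    by (rule measurable_compose[OF _ P]) (intro borel_measurable_continuous_onI continuous_intros)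
  ultimately have "AE x in lborel. AE r in lborel. P (r *\<^sub>R fst x, snd x)"
    using AE_lborel_commute[of "\<lambda>r x. P (r *\<^sub>R fst x, snd x)"] by simp
  then have "AE y in lborel. AE t in lborel. AE r in lborel. P (r *\<^sub>R y, t)"
    using lborel_pair.AE_pair[where Q = "\<lambda>x. AE r in lborel. P (r *\<^sub>R fst x, snd x)", unfolded lborel_prod] by simp
  moreover have "AE y in lborel. y \<noteq> (0 :: 'a)" by (rule AE_lborel_singleton)
  ultimately have "AE y in lborel. (y :: 'a) \<noteq> 0 \<and> (AE t in lborel. AE r in lborel. P (r *\<^sub>R y, t))"
    by eventually_elim simp
  from AE_ex_in[OF this, where A = UNIV] obtain y :: 'a where y: "y \<noteq> 0" "AE t in lborel. AE r in lborel. P (r *\<^sub>R y, t)"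
    by (auto simp: emeasure_lborel_UNIV)
  have "Measurable.pred borel (\<lambda>x. P (fst x *\<^sub>R y, snd x))"
    by (rule measurable_compose[OF _ P]) (intro borel_measurable_continuous_onI continuous_intros)
  then have "AE (z, t) in lborel. P ((1 / norm y * norm (z :: 'a)) *\<^sub>R y, t)"
    using AE_lborel_radial[where P = "\<lambda>x. P (fst x *\<^sub>R y, snd x)" and c = "1 / norm y" and 'a = 'a] y by simp
  then have "AE (z, t) in lborel. v (z, t) = v' ((1 / norm y * norm z) *\<^sub>R y, t)"
  proof (rule AE_mp, intro AE_I2 impI)
    fix x :: "'a \<times> real"
    assume a: "case x of (z, t) \<Rightarrow> P ((1 / norm y * norm z) *\<^sub>R y, t)"
    obtain z t where x: "x = (z, t)" by fastforce
    have "v (z, t) = v ((1 / norm y * norm z) *\<^sub>R y, t)" by (rule rad) (use y in simp)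
    with a show "case x of (z, t) \<Rightarrow> v (z, t) = v' ((1 / norm y * norm z) *\<^sub>R y, t)"
      using Peq by (simp add: x)
  qed
  moreover have "(\<lambda>x. v' ((1 / norm y * fst x) *\<^sub>R y, snd x)) \<in> borel_measurable borel"
    by (rule measurable_compose[OF _ v']) (intro borel_measurable_continuous_onI continuous_intros)
  ultimately show thesis
    using that[of "\<lambda>x. v' ((1 / norm y * fst x) *\<^sub>R y, snd x)"] by simp
qed

section \<open>Restriction to a ray of the fan\<close>

text \<open>\<open>\<nu>\<^sub>2\<close> is a sum over the rays of non-negative contributions, and
  only the \<open>k\<close>-th is kept.\<close>

lemma nn_integral_nu2_ray_le:
  fixes g :: "(real \<times> real) \<times> 'a::euclidean_space \<Rightarrow> ennreal" and n k :: nat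
  assumes g: "g \<in> borel_measurable (nu2 n \<Otimes>\<^sub>M lborel)"
  defines "c \<equiv> ennreal (1 / (2 * pi) ^ (2 * n + 1)) * ennreal ((fact (k + n - 1) / (fact k * fact (n - 1)))\<^sup>2)"
  shows "c * (\<integral>\<^sup>+l. (\<integral>\<^sup>+w. g ((l, real (2 * k + n) * \<bar>l\<bar>), w) * ennreal (\<bar>l\<bar> ^ (2 * n)) \<partial>lborel) \<partial>lborel)
    \<le> (\<integral>\<^sup>+x. g x \<partial>(nu2 n \<Otimes>\<^sub>M lborel))"
proof -
  define T where "T l = (l, real (2 * k + n) * \<bar>l\<bar>)" for l :: real
  define \<phi> where "\<phi> a = (\<integral>\<^sup>+w. g (a, w) \<partial>lborel)" for a
  define d where "d k = ennreal ((fact (k + n - 1) / (fact k * fact (n - 1)))\<^sup>2)" for k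
  have sets: "sets (nu2 n) = sets (restrict_space borel (heisenberg_fan n))"
    by (simp add: nu2_def)
  have T: "T \<in> lborel \<rightarrow>\<^sub>M nu2 n"
    unfolding measurable_cong_sets[OF refl sets]
  proof (rule measurable_restrict_space2)
    show "T \<in> space lborel \<rightarrow> heisenberg_fan n"
      by (auto simp: T_def heisenberg_fan_def fan_ray_def fan_ray_inf_def)
    show "T \<in> lborel \<rightarrow>\<^sub>M borel"
      unfolding T_def by (auto intro!: borel_measurable_Pair)
  qed
  have \<phi>: "\<phi> \<in> borel_measurable (nu2 n)"
    unfolding \<phi>_def using lborel.borel_measurable_nn_integral_fst[OF g] by simp
  have \<phi>T [measurable]: "(\<lambda>l. \<phi> (T l)) \<in> borel_measurable borel"
    using measurable_compose[OF T \<phi>] by simp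
  have gT: "(\<lambda>w. g (T l, w)) \<in> borel_measurable borel" for l
  proof -
    have "T l \<in> space (nu2 n)" using measurable_space[OF T] by simp
    from measurable_compose[OF measurable_Pair1'[OF this] g] show ?thesis by simp
  qed
  have "(\<integral>\<^sup>+l. (\<integral>\<^sup>+w. g ((l, real (2 * k + n) * \<bar>l\<bar>), w) * ennreal (\<bar>l\<bar> ^ (2 * n)) \<partial>lborel) \<partial>lborel) =
      (\<integral>\<^sup>+l. \<phi> (T l) * ennreal (\<bar>l\<bar> ^ (2 * n)) \<partial>lborel)"
    unfolding \<phi>_def T_def[symmetric] using gT by (simp add: nn_integral_multc)
  then have "c * (\<integral>\<^sup>+l. (\<integral>\<^sup>+w. g ((l, real (2 * k + n) * \<bar>l\<bar>), w) * ennreal (\<bar>l\<bar> ^ (2 * n)) \<partial>lborel) \<partial>lborel) =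
     ennreal (1 / (2 * pi) ^ (2 * n + 1)) * (\<integral>\<^sup>+l. d k * (\<phi> (T l) * ennreal (\<bar>l\<bar> ^ (2 * n))) \<partial>lborel)"
    by (simp add: c_def d_def nn_integral_cmult mult.assoc)
  also have "\<dots> \<le> ennreal (1 / (2 * pi) ^ (2 * n + 1)) *
    (\<integral>\<^sup>+l. (\<Sum>k. d k * \<phi> (l, real (2 * k + n) * \<bar>l\<bar>)) * ennreal (\<bar>l\<bar> ^ (2 * n)) \<partial>lborel)"
  proof (intro mult_left_mono nn_integral_mono)
    fix l
    have "d k * \<phi> (T l) \<le> (\<Sum>k. d k * \<phi> (l, real (2 * k + n) * \<bar>l\<bar>))"
      using sum_le_suminf[of "\<lambda>k. d k * \<phi> (l, real (2 * k + n) * \<bar>l\<bar>)" "{k}"] by (simp add: T_def)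
    then show "d k * (\<phi> (T l) * ennreal (\<bar>l\<bar> ^ (2 * n))) \<le>
        (\<Sum>k. d k * \<phi> (l, real (2 * k + n) * \<bar>l\<bar>)) * ennreal (\<bar>l\<bar> ^ (2 * n))"
      unfolding mult.assoc[symmetric] by (rule mult_right_mono) simp
  qed simp
  also have "\<dots> = (\<integral>\<^sup>+a. \<phi> a \<partial>nu2 n)"
    unfolding d_def using \<phi> by (subst nn_integral_nu2) (simp_all cong: measurable_cong_sets add: sets)
  also have "\<dots> = (\<integral>\<^sup>+x. g x \<partial>(nu2 n \<Otimes>\<^sub>M lborel))"
    unfolding \<phi>_def by (rule lborel.nn_integral_fst[OF g])
  finally show ?thesis .
qed

text \<open>Since \<open>u\<close> is measurable only for the completion, null sets of the product
  have to be null along each single ray. They are, because \<open>\<nu>\<^sub>2\<close> has on the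
  ray a density that is positive off l = 0.\<close>

lemma AE_nu2_ray:
  assumes AE: "AE x in nu2 n \<Otimes>\<^sub>M (lborel :: 'a::euclidean_space measure). P x"
  shows "AE l in lborel. AE w in lborel. P ((l, real (2 * k + n) * \<bar>l\<bar>), w :: 'a)"
proof -
  obtain N where N: "N \<in> sets (nu2 n \<Otimes>\<^sub>M lborel)" "emeasure (nu2 n \<Otimes>\<^sub>M (lborel :: 'a measure)) N = 0"
    "{x \<in> space (nu2 n \<Otimes>\<^sub>M lborel). \<not> P x} \<subseteq> N"
    using AE by (auto elim: AE_E)
  define T where "T l = (l, real (2 * k + n) * \<bar>l\<bar>)" for l :: real
  have Tfan: "T l \<in> heisenberg_fan n" for l
    by (auto simp: T_def heisenberg_fan_def fan_ray_def fan_ray_inf_def)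
  have sets: "sets (nu2 n) = sets (restrict_space borel (heisenberg_fan n))"
    by (simp add: nu2_def)
  have T: "T \<in> borel \<rightarrow>\<^sub>M nu2 n"
    unfolding measurable_cong_sets[OF refl sets]
    by (rule measurable_restrict_space2) (use Tfan in \<open>auto simp: T_def[abs_def] intro!: borel_measurable_Pair\<close>)
  have meas: "(\<lambda>x. (T (fst x), snd x)) \<in> (borel \<Otimes>\<^sub>M borel) \<rightarrow>\<^sub>M (nu2 n \<Otimes>\<^sub>M (lborel :: 'a measure))"
    using T by (intro measurable_Pair measurable_compose[OF measurable_fst T]) auto
  define h where "h l w = indicator N (T l, w :: 'a) * ennreal (\<bar>l\<bar> ^ (2 * n))" for l w
  have h: "(\<lambda>x. h (fst x) (snd x)) \<in> borel_measurable (borel \<Otimes>\<^sub>M borel)"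
  proof -
    have "(\<lambda>x. indicator N (T (fst x), snd x) :: ennreal) \<in> borel_measurable (borel \<Otimes>\<^sub>M borel)"
      by (rule measurable_compose[OF meas borel_measurable_indicator[OF N(1)]])
    then show ?thesis unfolding h_def by (rule borel_measurable_times_ennreal) measurable
  qed
  have hl: "(\<lambda>w. h l w) \<in> borel_measurable borel" for l
    using measurable_compose[OF measurable_Pair1' h, of l] by simp
  have "(\<integral>\<^sup>+l. (\<integral>\<^sup>+w. h l w \<partial>lborel) \<partial>lborel) = 0"
  proof -
    have "ennreal (1 / (2 * pi) ^ (2 * n + 1)) * ennreal ((fact (k + n - 1) / (fact k * fact (n - 1)))\<^sup>2) *
       (\<integral>\<^sup>+l. (\<integral>\<^sup>+w. h l w \<partial>lborel) \<partial>lborel) \<le> 0"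
      using nn_integral_nu2_ray_le[of "indicator N" n k] N(1,2) by (simp add: h_def T_def)
    then show ?thesis by simp
  qed
  moreover have "(\<lambda>l. \<integral>\<^sup>+w. h l w \<partial>lborel) \<in> borel_measurable lborel"
  proof -
    have "(\<lambda>x. h (fst x) (snd x)) \<in> borel_measurable (lborel \<Otimes>\<^sub>M lborel)"
      using h by (simp cong: measurable_cong_sets)
    from lborel.borel_measurable_nn_integral_fst[OF this] show ?thesis by simp
  qed
  ultimately have "AE l in lborel. (\<integral>\<^sup>+w. h l w \<partial>lborel) = 0"
    by (subst (asm) nn_integral_0_iff_AE) auto
  then show ?thesis
    using AE_lborel_singleton[of "0 :: real"]
  proof eventually_elim
    case (elim l)
    then have "AE w in lborel. h l w = 0"
      using hl by (subst (asm) nn_integral_0_iff_AE) auto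
    then show ?case
    proof eventually_elim
      case (elim w)
      then have "(T l, w) \<notin> N" using \<open>l \<noteq> 0\<close> by (auto simp: h_def indicator_def)
      moreover have "(T l, w) \<in> space (nu2 n \<Otimes>\<^sub>M lborel)"
        using Tfan by (simp add: space_pair_measure space_nu2)
      ultimately show ?case using N(3) by (auto simp: T_def)
    qed
  qed
qed

lemma nn_integral_nu2_ray_le_completion:
  fixes g :: "(real \<times> real) \<times> 'a::euclidean_space \<Rightarrow> ennreal" and n k :: nat
  assumes g: "g \<in> borel_measurable (completion (nu2 n \<Otimes>\<^sub>M lborel))"
  defines "c \<equiv> ennreal (1 / (2 * pi) ^ (2 * n + 1)) * ennreal ((fact (k + n - 1) / (fact k * fact (n - 1)))\<^sup>2)"
  shows "c * (\<integral>\<^sup>+l. (\<integral>\<^sup>+w. g ((l, real (2 * k + n) * \<bar>l\<bar>), w) * ennreal (\<bar>l\<bar> ^ (2 * n)) \<partial>lborel) \<partial>lborel)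
    \<le> (\<integral>\<^sup>+x. g x \<partial>(nu2 n \<Otimes>\<^sub>M lborel))"
proof -
  obtain g' where g': "g' \<in> borel_measurable (nu2 n \<Otimes>\<^sub>M lborel)"
    and eq: "AE x in nu2 n \<Otimes>\<^sub>M lborel. g x = g' x"
    using completion_ex_borel_measurable[OF g] by blast
  have "(\<integral>\<^sup>+l. (\<integral>\<^sup>+w. g ((l, real (2 * k + n) * \<bar>l\<bar>), w) * ennreal (\<bar>l\<bar> ^ (2 * n)) \<partial>lborel) \<partial>lborel) =
    (\<integral>\<^sup>+l. (\<integral>\<^sup>+w. g' ((l, real (2 * k + n) * \<bar>l\<bar>), w) * ennreal (\<bar>l\<bar> ^ (2 * n)) \<partial>lborel) \<partial>lborel)"
    using AE_nu2_ray[OF eq, of k]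
    by (intro nn_integral_cong_AE) (auto elim!: AE_mp intro!: nn_integral_cong_AE)
  moreover have "(\<integral>\<^sup>+x. g x \<partial>(nu2 n \<Otimes>\<^sub>M lborel)) = (\<integral>\<^sup>+x. g' x \<partial>(nu2 n \<Otimes>\<^sub>M lborel))"
    by (rule nn_integral_cong_AE[OF eq])
  ultimately show ?thesis
    unfolding c_def using nn_integral_nu2_ray_le[OF g', of k] by simp
qed

section \<open>The transform of a radial function\<close>

lemma radial_profile_integrable:
  fixes F :: "real \<times> real \<Rightarrow> real" and K :: "'a::euclidean_space \<times> real \<Rightarrow> complex"
  assumes F: "continuous_on UNIV F" "\<And>x t. x \<ge> X \<or> \<bar>t\<bar> \<ge> s \<Longrightarrow> F (x, t) = 0"
    and K: "continuous_on UNIV K"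
  shows "integrable lborel (\<lambda>h. of_real (F ((norm (fst h))\<^sup>2, snd h)) * K h)"
proof -
  define Y where "Y = cball (0 :: 'a) (sqrt (max X 0)) \<times> {-s..s}"
  have Y: "compact Y" unfolding Y_def by (intro compact_Times) auto
  have cF: "continuous_on UNIV (\<lambda>h :: 'a \<times> real. F ((norm (fst h))\<^sup>2, snd h))"
    by (intro continuous_on_compose2[OF F(1)] continuous_intros) auto
  have "set_integrable lborel Y (\<lambda>h. of_real (F ((norm (fst h))\<^sup>2, snd h)) * K h)"
    unfolding set_integrable_def
    by (intro borel_integrable_compact[OF Y] continuous_intros continuous_on_subset[OF cF] continuous_on_subset[OF K]) auto
  also have "set_integrable lborel Y (\<lambda>h. of_real (F ((norm (fst h))\<^sup>2, snd h)) * K h) \<longleftrightarrow>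
    integrable lborel (\<lambda>h. of_real (F ((norm (fst h))\<^sup>2, snd h)) * K h)"
    unfolding set_integrable_def
  proof (intro Bochner_Integration.integrable_cong refl)
    fix h :: "'a \<times> real"
    obtain z t where h: "h = (z, t)" by fastforce
    show "indicat_real Y h *\<^sub>R (of_real (F ((norm (fst h))\<^sup>2, snd h)) * K h) =
        of_real (F ((norm (fst h))\<^sup>2, snd h)) * K h"
    proof (cases "h \<in> Y")
      case False
      then have "norm z > sqrt (max X 0) \<or> \<bar>t\<bar> \<ge> s" by (auto simp: h Y_def)
      moreover have "(norm z)\<^sup>2 \<ge> X" if "norm z > sqrt (max X 0)"
      proof -
        have "(sqrt (max X 0))\<^sup>2 \<le> (norm z)\<^sup>2" using that by (intro power_mono) auto
        then show ?thesis by simp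
      qed
      ultimately show ?thesis using F(2) by (auto simp: h)
    qed simp
  qed
  finally show ?thesis .
qed

text \<open>After Fubini the inner integral over z is, for each t, a twisted convolution of a radial
  slice, to which \<open>twisted_convolution_radial\<close> applies; undoing Fubini at w = 0
  restores the integral over the group. The factor \<open>laguerre_fun k l 0\<close> stays on the
  left to avoid a division.\<close>

lemma strichartz_ft_radial:
  fixes F :: "real \<times> real \<Rightarrow> real" and w :: "complex ^ 'n::finite"
  assumes F: "continuous_on UNIV F" "\<And>x t. x \<ge> X \<or> \<bar>t\<bar> \<ge> s \<Longrightarrow> F (x, t) = 0"
    and l: "l \<noteq> 0"
  shows "of_real (laguerre_fun k l (0 :: complex ^ 'n)) *
     strichartz_ft (\<lambda>h :: 'n heis. of_real (F ((norm (fst h))\<^sup>2, snd h))) (l, real (2 * k + CARD('n)) * \<bar>l\<bar>) w =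
   of_real (laguerre_fun k l w) *
     (LINT h|lborel. of_real (F ((norm (fst h))\<^sup>2, snd h)) * (cis (- l * snd h) * of_real (laguerre_fun k l (fst h :: complex ^ 'n))))"
proof -
  let ?f = "\<lambda>h :: 'n heis. complex_of_real (F ((norm (fst h))\<^sup>2, snd h))"
  let ?c0 = "complex_of_real (laguerre_fun k l (0 :: complex ^ 'n))"
  have "(l, real (2 * k + CARD('n)) * \<bar>l\<bar>) \<in> fan_ray CARD('n) k"
    using l by (auto simp: fan_ray_def)
  from fan_index_eq[OF this] have idx: "fan_index CARD('n) (l, real (2 * k + CARD('n)) * \<bar>l\<bar>) = k" .
  have je: "joint_eigenfun k l (heis_mult (heis_inv h) (w, 0)) = cis (- l * snd h) * twisted_kernel k l w (fst h)" for h :: "'n heis"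
  proof -
    have "snd (heis_mult (heis_inv h) (w, 0)) = - snd h - 1 / 2 * (cmult_i w \<bullet> fst h)"
      unfolding Im_hermitian[symmetric] by (simp add: heis_mult_def heis_inv_def sum_negf)
    moreover have "fst (heis_mult (heis_inv h) (w, 0)) = w - fst h"
      by (simp add: heis_mult_def heis_inv_def)
    moreover have "exp (\<i> * of_real (l * (- snd h - 1 / 2 * (cmult_i w \<bullet> fst h)))) =
        cis (- l * snd h) * cis (- (l / 2) * (cmult_i w \<bullet> fst h))"
      unfolding cis_conv_exp[symmetric] cis_mult by (simp add: algebra_simps)
    ultimately show ?thesis
      unfolding joint_eigenfun_def twisted_kernel_def by (simp only: mult.assoc)
  qed
  have clf: "continuous_on UNIV (\<lambda>z :: complex ^ 'n. laguerre_fun k l z)"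
    unfolding laguerre_fun_def by (intro continuous_intros)
  have cK: "continuous_on UNIV (\<lambda>h :: 'n heis. cis (- l * snd h) * twisted_kernel k l w (fst h))" for w
    unfolding twisted_kernel_def cis_conv_exp
    by (intro continuous_intros continuous_on_compose2[OF clf]) auto
  have int: "integrable lborel (\<lambda>h. ?f h * (cis (- l * snd h) * twisted_kernel k l w (fst h)))" for w
    by (rule radial_profile_integrable[OF F cK])
  have fub: "(LINT h|lborel. ?f h * (cis (- l * snd h) * twisted_kernel k l w (fst h))) =
     (LINT t|lborel. cis (- l * t) * (LINT z|lborel. of_real (F ((norm z)\<^sup>2, t)) * twisted_kernel k l w z))" for w
  proof -
    have "integrable (lborel \<Otimes>\<^sub>M lborel) (\<lambda>(z, t). ?f (z, t) * (cis (- l * t) * twisted_kernel k l w z))"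
      unfolding lborel_prod using int[of w] by (simp add: case_prod_unfold)
    from lborel_pair.integral_snd[OF this]
    have "(LINT h|lborel. ?f h * (cis (- l * snd h) * twisted_kernel k l w (fst h))) =
       (LINT t|lborel. (LINT z|lborel. of_real (F ((norm z)\<^sup>2, t)) * (cis (- l * t) * twisted_kernel k l w z)))"
      unfolding lborel_prod by (simp add: case_prod_unfold)
    also have "\<dots> = (LINT t|lborel. (LINT z|lborel. cis (- l * t) * (of_real (F ((norm z)\<^sup>2, t)) * twisted_kernel k l w z)))"
      by (simp only: mult.left_commute)
    finally show ?thesis by simp
  qed
  have slice: "?c0 * (LINT z|lborel. of_real (F ((norm z)\<^sup>2, t)) * twisted_kernel k l w z) =
     of_real (laguerre_fun k l w) * (LINT z|lborel. of_real (F ((norm z)\<^sup>2, t)) * twisted_kernel k l (0 :: complex ^ 'n) z)" for t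
  proof -
    have "continuous_on UNIV (\<lambda>x. F (x, t))"
      by (intro continuous_on_compose2[OF F(1)] continuous_intros) auto
    from twisted_convolution_radial[OF l this, of X k w] F(2) show ?thesis
      by (simp add: twisted_kernel_0)
  qed
  have "?c0 * strichartz_ft ?f (l, real (2 * k + CARD('n)) * \<bar>l\<bar>) w =
     ?c0 * (LINT h|lborel. ?f h * (cis (- l * snd h) * twisted_kernel k l w (fst h)))"
    unfolding strichartz_ft_def idx fst_conv je using l by simp
  also have "\<dots> = (LINT t|lborel. cis (- l * t) * (?c0 * (LINT z|lborel. of_real (F ((norm z)\<^sup>2, t)) * twisted_kernel k l w z)))"
    unfolding fub by (simp only: integral_mult_right_zero mult.left_commute[of "cis _"])
  also have "\<dots> = of_real (laguerre_fun k l w) *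
     (LINT t|lborel. cis (- l * t) * (LINT z|lborel. of_real (F ((norm z)\<^sup>2, t)) * twisted_kernel k l (0 :: complex ^ 'n) z))"
    unfolding slice by (simp only: integral_mult_right_zero mult.left_commute[of "cis _"])
  also have "\<dots> = of_real (laguerre_fun k l w) *
     (LINT h|lborel. ?f h * (cis (- l * snd h) * twisted_kernel k l 0 (fst h)))"
    unfolding fub ..
  finally show ?thesis by (simp add: twisted_kernel_0)
qed

text \<open>The constant \<open>\<kappa>\<close> enters twice, once for the factor at
  \<open>w\<close> and once for the Laguerre function inside the integral; \<open>cos 1\<close>
  bounds the real part of the phase, as |l t| < 1 on the support. Both balls have radius squared 2
  X0 s, so that |l| |z|^2 / 2 stays within [0, X0].\<close>

lemma normalized_ft_lower_bound:
  fixes F :: "real \<times> real \<Rightarrow> real" and w :: "complex ^ 'n::finite"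
  assumes F: "continuous_on UNIV F" "\<And>x t. x \<ge> 2 * X0 * s \<or> \<bar>t\<bar> \<ge> s \<Longrightarrow> F (x, t) = 0" "\<And>x. F x \<ge> 0"
    and \<kappa>: "\<kappa> > 0" "\<And>x. 0 \<le> x \<Longrightarrow> x \<le> X0 \<Longrightarrow> poly (laguerre k (real (CARD('n) - 1))) x * exp (- x / 2) \<ge> \<kappa>"
    and s: "s > 0" and l: "l \<noteq> 0" "\<bar>l\<bar> < 1 / s" and w: "(norm w)\<^sup>2 < 2 * X0 * s"
  shows "norm (normalized_ft (\<lambda>h :: 'n heis. of_real (F ((norm (fst h))\<^sup>2, snd h))) (l, real (2 * k + CARD('n)) * \<bar>l\<bar>) w)
    \<ge> fact k * fact (CARD('n) - 1) / fact (k + CARD('n) - 1) *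
        (\<kappa> * (\<kappa> * cos 1) / poly (laguerre k (real (CARD('n) - 1))) 0) *
        (LINT h|lborel. F ((norm (fst h :: complex ^ 'n))\<^sup>2, snd h))"
proof -
  let ?f = "\<lambda>h :: 'n heis. complex_of_real (F ((norm (fst h))\<^sup>2, snd h))"
  let ?a = "(l, real (2 * k + CARD('n)) * \<bar>l\<bar>)"
  define I where "I = (LINT h|lborel. F ((norm (fst h :: complex ^ 'n))\<^sup>2, snd h))"
  define c0 where "c0 = poly (laguerre k (real (CARD('n) - 1))) 0"
  have c0: "laguerre_fun k l (0 :: complex ^ 'n) = c0" "c0 > 0"
    using laguerre_fun_0[where 'n = 'n, of k l] by (simp_all add: laguerre_fun_def c0_def)
  have lf: "laguerre_fun k l z \<ge> \<kappa>" if "(norm z)\<^sup>2 < 2 * X0 * s" for z :: "complex ^ 'n"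
  proof -
    have "\<bar>l\<bar> * (norm z)\<^sup>2 \<le> (1 / s) * (2 * X0 * s)"
      using that l s by (intro mult_mono) auto
    then have "1 / 2 * \<bar>l\<bar> * (norm z)\<^sup>2 \<le> X0" using s by simp
    from \<kappa>(2)[OF _ this] show ?thesis by (simp add: laguerre_fun_def)
  qed
  have intF: "integrable lborel (\<lambda>h :: 'n heis. F ((norm (fst h))\<^sup>2, snd h))"
    using integrable_Re[OF radial_profile_integrable[OF F(1,2), where K = "\<lambda>_. 1" and 'a = "complex ^ 'n"]] by simp
  have clf: "continuous_on UNIV (\<lambda>z :: complex ^ 'n. laguerre_fun k l z)"
    unfolding laguerre_fun_def by (intro continuous_intros)
  let ?G = "\<lambda>h :: 'n heis. ?f h * (cis (- l * snd h) * of_real (laguerre_fun k l (fst h)))"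
  have intG: "integrable lborel ?G"
  proof (rule radial_profile_integrable[OF F(1,2)])
    show "continuous_on UNIV (\<lambda>h :: 'n heis. cis (- l * snd h) * complex_of_real (laguerre_fun k l (fst h)))"
      unfolding cis_conv_exp by (intro continuous_intros continuous_on_compose2[OF clf]) auto
  qed
  have "\<kappa> * cos 1 * I = (LINT h|lborel. \<kappa> * cos 1 * F ((norm (fst h :: complex ^ 'n))\<^sup>2, snd h))"
    by (simp add: I_def)
  also have "\<dots> \<le> (LINT h|lborel. Re (?G h))"
  proof (rule integral_mono)
    fix h :: "'n heis"
    let ?F = "F ((norm (fst h))\<^sup>2, snd h)"
    have Re: "Re (?G h) = ?F * (cos (l * snd h) * laguerre_fun k l (fst h))" by simp
    show "\<kappa> * cos 1 * ?F \<le> Re (?G h)"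
    proof (cases "(norm (fst h))\<^sup>2 < 2 * X0 * s \<and> \<bar>snd h\<bar> < s")
      case True
      have "\<bar>l * snd h\<bar> \<le> (1 / s) * s"
        unfolding abs_mult using True l by (intro mult_mono) auto
      then have "\<bar>l * snd h\<bar> \<le> 1" using s by simp
      then have "cos 1 \<le> cos \<bar>l * snd h\<bar>"
        using pi_gt3 by (intro cos_monotone_0_pi_le) auto
      then have "cos 1 \<le> cos (l * snd h)" by simp
      moreover have "0 \<le> cos (1 :: real)" using pi_gt3 by (intro cos_ge_zero) auto
      ultimately have "cos 1 * \<kappa> \<le> cos (l * snd h) * laguerre_fun k l (fst h)"
        using lf[of "fst h"] True \<kappa>(1) by (intro mult_mono) auto
      then have "?F * (cos 1 * \<kappa>) \<le> ?F * (cos (l * snd h) * laguerre_fun k l (fst h))"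
        using F(3) by (intro mult_left_mono) auto
      then show ?thesis unfolding Re by (simp add: mult_ac)
    next
      case False
      then have "?F = 0" using F(2) by (auto simp: not_less)
      then show ?thesis by simp
    qed
  qed (use intF integrable_Re[OF intG] in auto)
  also have "\<dots> = Re (LINT h|lborel. ?G h)" by (rule integral_Re[OF intG])
  also have "\<dots> \<le> norm (LINT h|lborel. ?G h)" by (rule complex_Re_le_cmod)
  finally have "\<kappa> * (\<kappa> * cos 1 * I) \<le> laguerre_fun k l w * norm (LINT h|lborel. ?G h)"
    using lf[OF w] \<kappa>(1) cos_ge_zero[of 1] pi_gt3 F(3)
    by (intro mult_mono) (auto simp: I_def intro!: mult_nonneg_nonneg)
  also have "\<dots> = norm (of_real (laguerre_fun k l w) * (LINT h|lborel. ?G h))"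
    using lf[OF w] \<kappa>(1) by (simp add: norm_mult)
  also have "of_real (laguerre_fun k l w) * (LINT h|lborel. ?G h) =
      of_real (laguerre_fun k l (0 :: complex ^ 'n)) * strichartz_ft ?f ?a w"
    by (rule strichartz_ft_radial[OF F(1,2) l(1), symmetric])
  also have "norm \<dots> = c0 * norm (strichartz_ft ?f ?a w)"
    using c0 by (simp add: norm_mult)
  finally have le: "\<kappa> * (\<kappa> * cos 1) / c0 * I \<le> norm (strichartz_ft ?f ?a w)"
    using c0 by (simp add: field_simps)
  have "?a \<in> fan_ray CARD('n) k" using l by (auto simp: fan_ray_def)
  from fan_index_eq[OF this]
  have "norm (normalized_ft ?f ?a w) = fact k * fact (CARD('n) - 1) / fact (k + CARD('n) - 1) * norm (strichartz_ft ?f ?a w)"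
    using l by (simp add: normalized_ft_def norm_mult norm_divide)
  moreover have "fact k * fact (CARD('n) - 1) / fact (k + CARD('n) - 1) * (\<kappa> * (\<kappa> * cos 1) / c0 * I) \<le>
     fact k * fact (CARD('n) - 1) / fact (k + CARD('n) - 1) * norm (strichartz_ft ?f ?a w)"
    by (rule mult_left_mono[OF le]) simp
  ultimately show ?thesis unfolding I_def c0_def by (simp only: mult.assoc)
qed

section \<open>Duality for the weight\<close>

lemma ennreal_powr_ennreal: "x \<ge> 0 \<Longrightarrow> ennreal_powr (ennreal x) r = ennreal (x powr r)"
  by (simp add: ennreal_powr_def)

lemma ennreal_powr_mono:
  assumes "x \<le> y" "r \<ge> 0"
  shows "ennreal_powr x r \<le> ennreal_powr y r"
proof (cases "y = \<infinity>")
  case False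
  then have "x \<noteq> \<infinity>" using assms(1) by (auto simp: top_unique)
  moreover have "enn2real x \<le> enn2real y"
    using assms(1) False by (intro enn2real_mono) (auto simp: less_top)
  ultimately show ?thesis
    using False assms(2) by (auto simp: ennreal_powr_def intro!: ennreal_leI powr_mono2)
qed (simp add: ennreal_powr_def)

lemma ennreal_powr_mult:
  assumes "r > 0"
  shows "ennreal_powr (x * y) r = ennreal_powr x r * ennreal_powr y r"
proof (cases x; cases y)
  fix a b assume "x = ennreal a" "0 \<le> a" "y = ennreal b" "0 \<le> b"
  then show ?thesis
    by (simp add: ennreal_powr_ennreal powr_mult flip: ennreal_mult)
next
  fix a assume a: "x = ennreal a" "0 \<le> a" "y = top"
  then show ?thesis
    by (cases "a = 0") (simp_all add: ennreal_powr_def ennreal_mult_top ennreal_top_eq_mult_iff)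
next
  fix a assume a: "y = ennreal a" "0 \<le> a" "x = top"
  then show ?thesis
    by (cases "a = 0") (simp_all add: ennreal_powr_def ennreal_top_mult ennreal_top_eq_mult_iff)
qed (simp add: ennreal_powr_def ennreal_top_mult)

lemma tendsto_ennreal_powr:
  assumes x: "(x \<longlongrightarrow> y) F" and y: "y \<noteq> top" and r: "r > 0"
  shows "((\<lambda>i. ennreal_powr (x i) r) \<longlongrightarrow> ennreal_powr y r) F"
proof -
  have "((\<lambda>i. enn2real (x i)) \<longlongrightarrow> enn2real y) F"
    using x y by (intro tendsto_enn2real) (auto simp: less_top)
  then have "((\<lambda>i. enn2real (x i) powr r) \<longlongrightarrow> enn2real y powr r) F"
    using r by (intro tendsto_powr') auto
  then have "((\<lambda>i. ennreal (enn2real (x i) powr r)) \<longlongrightarrow> ennreal (enn2real y powr r)) F"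
    by (rule tendsto_ennrealI)
  moreover have "eventually (\<lambda>i. x i < top) F"
    using order_tendstoD(2)[OF x, of top] y by (simp add: less_top)
  then have "eventually (\<lambda>i. ennreal (enn2real (x i) powr r) = ennreal_powr (x i) r) F"
    by eventually_elim (auto simp: ennreal_powr_def)
  ultimately have "((\<lambda>i. ennreal_powr (x i) r) \<longlongrightarrow> ennreal (enn2real y powr r)) F"
    by (rule Lim_transform_eventually)
  moreover have "ennreal_powr y r = ennreal (enn2real y powr r)"
    using y by (simp add: ennreal_powr_def)
  ultimately show ?thesis by simp
qed

text \<open>Used where \<open>W\<close> contains the integral of \<open>u\<close>, which may be
  infinite a priori. In that case letting \<open>A\<close> grow forces \<open>y = 0\<close> or
  \<open>z = top\<close>.\<close>

lemma ennreal_mult_le_of_real_le: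
  fixes W y z :: ennreal
  assumes "\<And>A. 0 \<le> A \<Longrightarrow> ennreal A \<le> W \<Longrightarrow> ennreal A * y \<le> z"
  shows "W * y \<le> z"
proof (cases W)
  case (real A)
  then show ?thesis using assms[of A] by simp
next
  case top
  show ?thesis
  proof (cases "y = 0 \<or> z = top")
    case True
    then show ?thesis by auto
  next
    case False
    then obtain c where c: "z = ennreal c" "c \<ge> 0" by (cases z) auto
    have "ennreal 1 * y \<le> z" by (rule assms) (auto simp: top)
    with c obtain b where b: "y = ennreal b" "b > 0"
      using False by (cases y) (auto simp: top_unique less_le)
    have "ennreal ((c + 1) / b) * y \<le> z"
      by (rule assms) (use b c in \<open>auto simp: top\<close>)
    then have "c + 1 \<le> c" using b c by (simp flip: ennreal_mult)
    then show ?thesis by simp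
  qed
qed

lemma flat_exp_le_1: "flat_exp 0 y \<le> 1"
  by (simp add: flat_exp_def)

lemma flat_exp_nonneg: "flat_exp 0 y \<ge> 0"
  by (simp add: flat_exp_def)

lemma flat_exp_pos_iff: "flat_exp 0 y > 0 \<longleftrightarrow> y > 0"
  by (simp add: flat_exp_def)

lemma continuous_on_flat_exp: "continuous_on S (flat_exp j)"
  by (intro continuous_at_imp_continuous_on ballI DERIV_isCont[OF has_real_derivative_flat_exp])

text \<open>A measurable function is an almost everywhere limit of continuous ones; clamping these
  to [0, m] keeps the limit and gives a uniform bound. The polynomials are taken in r^2 because
  |z|^2, unlike |z|, is a polynomial; the square root needed to pass to that variable is continuous,
  so Stone-Weierstrass still applies.\<close>

lemma polynomial_approximation_ae:
  fixes H :: "real \<times> real \<Rightarrow> real"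
  assumes H: "H \<in> borel_measurable borel" and bd: "\<And>x. 0 \<le> H x" "\<And>x. H x \<le> m"
  obtains P N where "\<And>j. real_polynomial_function (P j)"
    "N \<in> null_sets lborel"
    "\<And>j r t. r \<ge> 0 \<Longrightarrow> r\<^sup>2 \<le> X \<Longrightarrow> \<bar>t\<bar> \<le> s \<Longrightarrow> \<bar>P j (r\<^sup>2, t)\<bar> \<le> m + 1"
    "\<And>r t. r \<ge> 0 \<Longrightarrow> r\<^sup>2 \<le> X \<Longrightarrow> \<bar>t\<bar> \<le> s \<Longrightarrow> (r, t) \<notin> N \<Longrightarrow> (\<lambda>j. P j (r\<^sup>2, t)) \<longlonglongrightarrow> H (r, t)"
proof -
  have "H measurable_on UNIV"
    using H by (intro lebesgue_measurable_imp_measurable_on) (auto intro: measurable_completion)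
  then obtain N g where N: "negligible N" and g: "\<And>j. continuous_on UNIV (g j)"
    "\<And>x. x \<notin> N \<Longrightarrow> (\<lambda>j. g j x) \<longlonglongrightarrow> H x"
    unfolding measurable_on_def by auto
  from N obtain N' where N': "N' \<in> null_sets lborel" "N \<subseteq> N'"
    by (auto simp: negligible_iff_null_sets null_sets_completion_iff2)
  define g' where "g' j x = max 0 (min m (g j x))" for j x
  have m: "m \<ge> 0" using bd[of 0] by linarith
  have g'bd: "\<bar>g' j x\<bar> \<le> m" for j x using m by (auto simp: g'_def)
  have "\<exists>P. real_polynomial_function P \<and>
      (\<forall>x\<in>{0..X} \<times> {-s..s}. \<bar>g' j (sqrt (fst x), snd x) - P x\<bar> < 1 / real (Suc j))" for j
  proof -
    have c: "continuous_on ({0..X} \<times> {-s..s}) (\<lambda>x. g' j (sqrt (fst x), snd x))"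
      unfolding g'_def by (intro continuous_intros continuous_on_compose2[OF g(1)]) auto
    have "0 < 1 / real (Suc j)" by simp
    with c obtain P where "real_polynomial_function P"
      "\<And>x. x \<in> {0..X} \<times> {-s..s} \<Longrightarrow> \<bar>g' j (sqrt (fst x), snd x) - P x\<bar> < 1 / real (Suc j)"
      by (rule Stone_Weierstrass_real_polynomial_function[OF compact_Times[OF compact_Icc compact_Icc]]) blast
    then show ?thesis by blast
  qed
  then obtain P where P: "\<And>j. real_polynomial_function (P j)"
    "\<And>j x. x \<in> {0..X} \<times> {-s..s} \<Longrightarrow> \<bar>g' j (sqrt (fst x), snd x) - P j x\<bar> < 1 / real (Suc j)"
    by metis
  have close: "\<bar>g' j (r, t) - P j (r\<^sup>2, t)\<bar> < 1 / real (Suc j)" if "r \<ge> 0" "r\<^sup>2 \<le> X" "\<bar>t\<bar> \<le> s" for j r t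
    using P(2)[of "(r\<^sup>2, t)" j] that by (auto simp: abs_le_iff)
  show thesis
  proof (rule that[OF P(1) N'(1)])
    fix j r t assume a: "(r::real) \<ge> 0" "r\<^sup>2 \<le> X" "\<bar>t\<bar> \<le> s"
    have "1 / real (Suc j) \<le> 1" by simp
    then show "\<bar>P j (r\<^sup>2, t)\<bar> \<le> m + 1"
      using close[OF a, of j] g'bd[of j "(r, t)"] by linarith
  next
    fix r t assume a: "(r::real) \<ge> 0" "r\<^sup>2 \<le> X" "\<bar>t\<bar> \<le> s" and nN: "(r, t) \<notin> N'"
    have "(\<lambda>j. g' j (r, t)) \<longlonglongrightarrow> max 0 (min m (H (r, t)))"
      unfolding g'_def using nN N'(2) by (intro tendsto_intros g(2)) auto
    also have "max 0 (min m (H (r, t))) = H (r, t)" using bd[of "(r, t)"] by simp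
    finally have 1: "(\<lambda>j. g' j (r, t)) \<longlonglongrightarrow> H (r, t)" .
    have "(\<lambda>j. g' j (r, t) - P j (r\<^sup>2, t)) \<longlonglongrightarrow> 0"
    proof (rule Lim_null_comparison)
      show "\<forall>\<^sub>F j in sequentially. norm (g' j (r, t) - P j (r\<^sup>2, t)) \<le> 1 / real (Suc j)"
        using close[OF a] by (auto intro!: always_eventually less_imp_le)
      show "(\<lambda>j. 1 / real (Suc j)) \<longlonglongrightarrow> 0" by (rule lim_1_over_n[THEN LIMSEQ_Suc])
    qed
    from tendsto_diff[OF 1 this] show "(\<lambda>j. P j (r\<^sup>2, t)) \<longlonglongrightarrow> H (r, t)" by simp
  qed
qed

text \<open>
  The extremal choice \<open>f = v powr (- p')\<close>, for which \<open>(f v) powr p = f\<close>, turns the norm inequality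
  into a bound for the integral of \<open>v powr (- p')\<close>. It is approximated by smooth functions:
  truncate, then take a smooth bump times the square of a polynomial in \<open>(norm z ^ 2, t)\<close>.
\<close>

lemma weight_duality:
  fixes v :: "'a::euclidean_space \<times> real \<Rightarrow> real"
  assumes p: "1 < p" and p': "1 / p + 1 / p' = 1"
    and v_nonneg: "\<And>h. 0 \<le> v h"
    and v_meas: "v \<in> borel_measurable (completion lborel)"
    and v_loc: "locally_integrable lborel (\<lambda>h. neg_powr (v h) p')"
    and v_pow_loc: "locally_integrable lborel (\<lambda>h. ennreal (v h powr p))"
    and v_radial: "\<And>z z' t. norm z = norm z' \<Longrightarrow> v (z, t) = v (z', t)"
    and Xs: "X > 0" "s > 0" and A: "A \<ge> 0"
    and ineq: "\<And>F :: real \<times> real \<Rightarrow> real. continuous_on UNIV F \<Longrightarrow>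
      (\<And>x t. x \<ge> X \<or> \<bar>t\<bar> \<ge> s \<Longrightarrow> F (x, t) = 0) \<Longrightarrow> (\<And>x. F x \<ge> 0) \<Longrightarrow>
      smooth_alg (\<lambda>h :: 'a \<times> real. F ((norm (fst h))\<^sup>2, snd h)) \<Longrightarrow>
      ennreal A * (\<integral>\<^sup>+h. ennreal (F ((norm (fst h :: 'a))\<^sup>2, snd h)) \<partial>lborel) \<le>
      ennreal C * ennreal_powr (\<integral>\<^sup>+h. ennreal (F ((norm (fst h))\<^sup>2, snd h) powr p * v h powr p) \<partial>lborel) (1 / p)"
  shows "ennreal A * ennreal_powr (\<integral>\<^sup>+z\<in>{z. (norm z)\<^sup>2 < X}. (\<integral>\<^sup>+t\<in>{t. \<bar>t\<bar> < s}.
             neg_powr (v (z, t)) p' \<partial>lborel) \<partial>lborel) (1 / p') \<le> ennreal C"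
proof -
  have p'0: "p' > 0" and pp: "p' * (p - 1) = p"
  proof -
    have "p' \<noteq> 0" using p p' by auto
    then have "p' + p = p * p'" using p p' by (simp add: field_simps)
    then show e: "p' * (p - 1) = p" by (simp add: algebra_simps)
    have "p' * (p - 1) > 0" unfolding e using p by simp
    then show "p' > 0" using p by (simp add: zero_less_mult_iff)
  qed
  obtain V0 where V0: "V0 \<in> borel_measurable borel" "AE (z, t) in lborel. v (z, t) = V0 (norm z, t)"
    using radial_borel_representative[OF v_meas v_radial] by blast
  \<comment> \<open>The absolute value makes the Borel profile non-negative everywhere and keeps the
    almost everywhere equality, because \<open>v\<close> is non-negative.\<close>
  define V where "V x = \<bar>V0 x\<bar>" for x
  have V [measurable]: "V \<in> borel_measurable borel" unfolding V_def[abs_def] using V0(1) by measurable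
  have Vnn: "V x \<ge> 0" for x by (simp add: V_def)
  have Veq: "AE h in lborel. v h = V (norm (fst h), snd h)"
    using V0(2)
  proof eventually_elim
    case (elim h)
    then show ?case using v_nonneg[of h] by (cases h) (simp add: V_def)
  qed
  \<comment> \<open>The first variable stands for |z|^2. With s^2 - t^2 in place of s - |t| the bump
    is smooth and still positive exactly on the region of integration.\<close>
  define b where "b x = flat_exp 0 (X - fst x) * flat_exp 0 (s\<^sup>2 - (snd x)\<^sup>2)" for x :: "real \<times> real"
  have b01: "0 \<le> b x" "b x \<le> 1" for x
    unfolding b_def using flat_exp_nonneg flat_exp_le_1 by (auto intro: mult_le_one)
  have bpos: "b (x, t) > 0 \<longleftrightarrow> x < X \<and> \<bar>t\<bar> < s" for x t
  proof -
    have "s\<^sup>2 - t\<^sup>2 > 0 \<longleftrightarrow> \<bar>t\<bar> < s"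
      using abs_le_square_iff[of s t] Xs by auto
    moreover have "\<not> flat_exp 0 y < 0" for y by (simp add: not_less flat_exp_nonneg)
    ultimately show ?thesis
      by (simp add: b_def zero_less_mult_iff flat_exp_pos_iff)
  qed
  have cb: "continuous_on UNIV b"
    unfolding b_def[abs_def] by (intro continuous_intros continuous_on_compose2[OF continuous_on_flat_exp]) auto
  have b_meas [measurable]: "b \<in> borel_measurable borel"
    using cb by (rule borel_measurable_continuous_onI)
  define Y where "Y = cball (0 :: 'a) (sqrt X) \<times> {-s..s}"
  have Y: "compact Y" unfolding Y_def by (intro compact_Times) auto
  have inY: "h \<in> Y" if "b ((norm (fst h))\<^sup>2, snd h) > 0" for h
  proof -
    from that have "(norm (fst h))\<^sup>2 < X" "\<bar>snd h\<bar> < s" unfolding bpos by auto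
    then have "norm (fst h) \<le> sqrt X" by (intro real_le_rsqrt) simp
    with \<open>\<bar>snd h\<bar> < s\<close> show ?thesis by (cases h) (auto simp: Y_def)
  qed
  define D where "D = (\<integral>\<^sup>+h. neg_powr (V (norm (fst h :: 'a), snd h)) p' * indicator {h. b ((norm (fst h))\<^sup>2, snd h) > 0} h \<partial>lborel)"
  have nm: "(\<lambda>h :: 'a \<times> real. (norm (fst h), snd h)) \<in> borel \<rightarrow>\<^sub>M borel"
    "(\<lambda>h :: 'a \<times> real. ((norm (fst h))\<^sup>2, snd h)) \<in> borel \<rightarrow>\<^sub>M borel"
    by (intro borel_measurable_continuous_onI continuous_intros)+
  note [measurable] = measurable_compose[OF nm(1) V] measurable_compose[OF nm(2) b_meas]
  have np_meas: "(\<lambda>h :: 'a \<times> real. neg_powr (V (norm (fst h), snd h)) p' * indicator {h. b ((norm (fst h))\<^sup>2, snd h) > 0} h) \<in> borel_measurable borel"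
    unfolding neg_powr_def by measurable
  have D_eq: "(\<integral>\<^sup>+z\<in>{z. (norm z)\<^sup>2 < X}. (\<integral>\<^sup>+t\<in>{t. \<bar>t\<bar> < s}. neg_powr (v (z, t)) p' \<partial>lborel) \<partial>lborel) = D"
  proof -
    have ae: "AE z in lborel. AE t in lborel. v (z, t) = V (norm z, t)"
      using lborel_pair.AE_pair[of "\<lambda>h. v h = V (norm (fst h), snd h)", unfolded lborel_prod] Veq by simp
    have "(\<integral>\<^sup>+z\<in>{z. (norm z)\<^sup>2 < X}. (\<integral>\<^sup>+t\<in>{t. \<bar>t\<bar> < s}. neg_powr (v (z, t)) p' \<partial>lborel) \<partial>lborel) =
      (\<integral>\<^sup>+z. (\<integral>\<^sup>+t. neg_powr (V (norm (z :: 'a), t)) p' * indicator {h. b ((norm (fst h))\<^sup>2, snd h) > 0} (z, t) \<partial>lborel) \<partial>lborel)"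
    proof (rule nn_integral_cong_AE, use ae in eventually_elim)
      case (elim z)
      then have "(\<integral>\<^sup>+t\<in>{t. \<bar>t\<bar> < s}. neg_powr (v (z, t)) p' \<partial>lborel) = (\<integral>\<^sup>+t\<in>{t. \<bar>t\<bar> < s}. neg_powr (V (norm z, t)) p' \<partial>lborel)"
        by (intro nn_integral_cong_AE) auto
      then show ?case
        by (cases "(norm z)\<^sup>2 < X") (auto simp: bpos indicator_def intro!: nn_integral_cong)
    qed
    also have "\<dots> = D"
    proof -
      have "(\<lambda>h :: 'a \<times> real. neg_powr (V (norm (fst h), snd h)) p' * indicator {h. b ((norm (fst h))\<^sup>2, snd h) > 0} h)
          \<in> borel_measurable (lborel \<Otimes>\<^sub>M lborel)"
        unfolding lborel_prod using np_meas by simp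
      from lborel.nn_integral_fst[OF this] show ?thesis
        unfolding lborel_prod D_def by simp
    qed
    finally show ?thesis .
  qed
  have D_fin: "D < top"
  proof -
    have "D \<le> (\<integral>\<^sup>+h. neg_powr (v h) p' * indicator Y h \<partial>lborel)"
      unfolding D_def
    proof (rule nn_integral_mono_AE, use Veq in eventually_elim)
      case (elim h)
      then show ?case using inY[of h] by (auto simp: indicator_def)
    qed
    also have "\<dots> < top" using v_loc Y by (auto simp: locally_integrable_def)
    finally show ?thesis .
  qed
  have step: "ennreal A * D \<le> ennreal C * ennreal_powr D (1 / p)"
  proof -
    \<comment> \<open>Truncation of y^(-p') at height m. The value at \<open>y = 0\<close> is set by
      hand, as \<open>0 powr (- p')\<close> is 0 whereas \<open>neg_powr 0 p'\<close> is
      infinite.\<close>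
    define \<omega> where "\<omega> m y = (if y = 0 then real m else min (real m) (y powr (- p')))" for m and y :: real
    \<comment> \<open>Cutting off where the bump is below 1/m makes the quotient of
      \<open>h m\<close> by the bump bounded by m^2.\<close>
    define h where "h m x = (if b ((fst x)\<^sup>2, snd x) \<ge> 1 / real m \<and> m > 0 then \<omega> m (V x) else 0)" for m and x :: "real \<times> real"
    have \<omega>: "0 \<le> \<omega> m y" "\<omega> m y \<le> real m" "ennreal (\<omega> m y) \<le> neg_powr y p'" if "y \<ge> 0" for m y
    proof -
      show "0 \<le> \<omega> m y" "\<omega> m y \<le> real m" by (auto simp: \<omega>_def)
      show "ennreal (\<omega> m y) \<le> neg_powr y p'"
      proof (cases "y = 0")
        case False
        then have "neg_powr y p' = ennreal (y powr (- p'))"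
          using that by (simp add: neg_powr_def inverse_ennreal powr_minus)
        then show ?thesis using False by (auto simp: \<omega>_def intro!: ennreal_leI)
      qed (simp add: neg_powr_def)
    qed
    have h_bd: "0 \<le> h m x" "h m x \<le> real m" for m x
      using \<omega>(1,2)[OF Vnn] by (auto simp: h_def)
    have sq_meas: "(\<lambda>x :: real \<times> real. ((fst x)\<^sup>2, snd x)) \<in> borel \<rightarrow>\<^sub>M borel"
      by (intro borel_measurable_continuous_onI continuous_intros)
    note [measurable] = measurable_compose[OF sq_meas b_meas]
    have h_meas [measurable]: "h m \<in> borel_measurable borel" for m
      unfolding h_def[abs_def] \<omega>_def by measurable
    have hn_meas [measurable]: "(\<lambda>x :: 'a \<times> real. h m (norm (fst x), snd x)) \<in> borel_measurable borel" for m
      by (rule measurable_compose[OF nm(1) h_meas])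
    define a where "a m = (\<integral>\<^sup>+x. ennreal (h m (norm (fst x :: 'a), snd x)) \<partial>lborel)" for m
    have a_le: "a m \<le> D" for m
      unfolding a_def D_def
    proof (rule nn_integral_mono)
      fix x :: "'a \<times> real"
      have "b ((norm (fst x))\<^sup>2, snd x) > 0" if "b ((norm (fst x))\<^sup>2, snd x) \<ge> 1 / real m" "m > 0"
        using that by (meson divide_pos_pos less_le_trans of_nat_0_less_iff zero_less_one)
      then show "ennreal (h m (norm (fst x), snd x)) \<le>
        neg_powr (V (norm (fst x), snd x)) p' * indicator {h. b ((norm (fst h))\<^sup>2, snd h) > 0} x"
        using \<omega>(3)[OF Vnn] by (auto simp: h_def)
    qed
    have a_ineq: "ennreal A * a m \<le> ennreal C * ennreal_powr D (1 / p)" for m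
    proof -
      \<comment> \<open>If polynomials \<open>P j\<close> converge to \<open>H\<close>, then the
        bump times their squares converges to \<open>h m\<close>; the squares keep the test
        functions non-negative.\<close>
      define H where "H x = sqrt (h m x / b ((fst x)\<^sup>2, snd x))" for x
      have H_meas: "H \<in> borel_measurable borel" unfolding H_def[abs_def] by measurable
      have H0: "0 \<le> H x" for x using h_bd b01 by (simp add: H_def)
      have Hm: "H x \<le> real m" for x
      proof (cases "b ((fst x)\<^sup>2, snd x) \<ge> 1 / real m \<and> m > 0")
        case True
        then have "h m x / b ((fst x)\<^sup>2, snd x) \<le> real m / (1 / real m)"
          using h_bd[of m x] by (intro frac_le) auto
        then have "H x \<le> sqrt ((real m)\<^sup>2)"
          unfolding H_def by (intro real_sqrt_le_mono) (simp add: power2_eq_square)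
        then show ?thesis by simp
      next
        case False
        then have "h m x = 0" unfolding h_def by (rule if_not_P)
        then show ?thesis by (simp add: H_def)
      qed
      have Hb: "b ((fst x)\<^sup>2, snd x) * (H x)\<^sup>2 = h m x" for x
      proof (cases "b ((fst x)\<^sup>2, snd x) \<ge> 1 / real m \<and> m > 0")
        case True
        then have "b ((fst x)\<^sup>2, snd x) > 0"
          by (meson divide_pos_pos less_le_trans of_nat_0_less_iff zero_less_one)
        then show ?thesis using h_bd[of m x] by (simp add: H_def)
      next
        case False
        then have "h m x = 0" unfolding h_def by (rule if_not_P)
        then show ?thesis by (simp add: H_def)
      qed
      obtain P N where P: "\<And>j. real_polynomial_function (P j)"
        and N: "N \<in> null_sets lborel"
        and P_bd: "\<And>j r t. r \<ge> 0 \<Longrightarrow> r\<^sup>2 \<le> X \<Longrightarrow> \<bar>t\<bar> \<le> s \<Longrightarrow> \<bar>P j (r\<^sup>2, t)\<bar> \<le> real m + 1"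
        and P_lim: "\<And>r t. r \<ge> 0 \<Longrightarrow> r\<^sup>2 \<le> X \<Longrightarrow> \<bar>t\<bar> \<le> s \<Longrightarrow> (r, t) \<notin> N \<Longrightarrow> (\<lambda>j. P j (r\<^sup>2, t)) \<longlonglongrightarrow> H (r, t)"
        using polynomial_approximation_ae[OF H_meas H0 Hm, of X s] by blast
      define F where "F j x = b x * (P j x)\<^sup>2" for j x
      let ?f = "\<lambda>j (x :: 'a \<times> real). F j ((norm (fst x))\<^sup>2, snd x)"
      let ?h = "\<lambda>x :: 'a \<times> real. h m (norm (fst x), snd x)"
      have cF: "continuous_on UNIV (F j)" for j
        unfolding F_def[abs_def] using P[of j]
        by (intro continuous_intros cb continuous_on_polymonial_function) (simp add: real_polynomial_function_eq)
      have F0: "F j (x, t) = 0" if "x \<ge> X \<or> \<bar>t\<bar> \<ge> s" for j x t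
        using bpos[of x t] b01[of "(x, t)"] that by (auto simp: F_def)
      have Fnn: "F j x \<ge> 0" for j x using b01 by (simp add: F_def)
      have F_bd: "?f j x \<le> (real m + 1)\<^sup>2 * indicator Y x" for j x
      proof (cases "b ((norm (fst x))\<^sup>2, snd x) > 0")
        case True
        then have "\<bar>P j ((norm (fst x))\<^sup>2, snd x)\<bar> \<le> real m + 1" by (intro P_bd) (auto simp: bpos)
        then have "(P j ((norm (fst x))\<^sup>2, snd x))\<^sup>2 \<le> (real m + 1)\<^sup>2"
          by (metis abs_le_square_iff abs_of_nonneg add_nonneg_nonneg of_nat_0_le_iff zero_le_one)
        then have "?f j x \<le> 1 * (real m + 1)\<^sup>2"
          unfolding F_def using b01 by (intro mult_mono) auto
        then show ?thesis using inY[OF True] by simp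
      next
        case False
        then have "?f j x = 0" using b01(1)[of "((norm (fst x))\<^sup>2, snd x)"] by (simp add: F_def)
        then show ?thesis by simp
      qed
      have F_lim: "AE x in lborel. (\<lambda>j. ?f j x) \<longlonglongrightarrow> ?h x"
      proof -
        have aeN: "AE x in lborel. x \<notin> N" by (rule AE_not_in[OF N])
        have pr: "Measurable.pred borel (\<lambda>x. x \<notin> N)" using N by auto
        have "AE (z, t) in lborel. (1 * norm (z :: 'a), t) \<notin> N"
          by (rule AE_lborel_radial[OF pr iffD1[OF AE_lborel_prod_iff[OF pr] aeN]]) simp
        then show ?thesis
        proof eventually_elim
          case (elim x)
          then have nN: "(norm (fst x), snd x) \<notin> N" by (cases x) simp
          show ?case
          proof (cases "b ((norm (fst x))\<^sup>2, snd x) > 0")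
            case True
            then have "(\<lambda>j. P j ((norm (fst x))\<^sup>2, snd x)) \<longlonglongrightarrow> H (norm (fst x), snd x)"
              by (intro P_lim nN) (auto simp: bpos)
            then have "(\<lambda>j. ?f j x) \<longlonglongrightarrow> b ((norm (fst x))\<^sup>2, snd x) * (H (norm (fst x), snd x))\<^sup>2"
              unfolding F_def by (intro tendsto_intros)
            then show ?thesis using Hb[of "(norm (fst x), snd x)"] by simp
          next
            case False
            then have 0: "b ((norm (fst x))\<^sup>2, snd x) = 0" using b01(1)[of "((norm (fst x))\<^sup>2, snd x)"] by simp
            then have "?h x = 0" using Hb[of "(norm (fst x), snd x)"] by simp
            with 0 show ?thesis by (simp add: F_def)
          qed
        qed
      qed
      have f_meas [measurable]: "(\<lambda>x. ?f j x) \<in> borel_measurable borel" for j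
        by (rule measurable_compose[OF nm(2) borel_measurable_continuous_onI[OF cF]])
      have Ym [measurable]: "Y \<in> sets borel" using Y by (simp add: borel_compact)
      have smooth: "smooth_alg (\<lambda>x. ?f j x)" for j
      proof -
        have pn: "real_polynomial_function (\<lambda>x :: 'a \<times> real. (norm (fst x))\<^sup>2)"
        proof -
          have "(\<lambda>x :: 'a \<times> real. (norm (fst x))\<^sup>2) = (\<lambda>x. \<Sum>i\<in>Basis. (fst x \<bullet> i) * (fst x \<bullet> i))"
            unfolding power2_norm_eq_inner by (subst euclidean_inner) simp
          moreover have "real_polynomial_function (\<lambda>x :: 'a \<times> real. fst x \<bullet> i)" for i
            by (intro real_polynomial_function.intros(1) bounded_linear_intros)
          ultimately show ?thesis
            by (auto intro!: real_polynomial_function_sum real_polynomial_function.intros(4))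
        qed
        have ps: "real_polynomial_function (\<lambda>x :: 'a \<times> real. snd x)"
          by (intro real_polynomial_function.intros(1) bounded_linear_snd)
        have "polynomial_function (\<lambda>x :: 'a \<times> real. ((norm (fst x))\<^sup>2, snd x))"
        proof -
          have "polynomial_function (\<lambda>x :: 'a \<times> real. (norm (fst x))\<^sup>2 *\<^sub>R (1 :: real, 0 :: real) + snd x *\<^sub>R (0, 1))"
            using pn ps by (intro polynomial_function_add polynomial_function_mult) (auto simp: real_polynomial_function_eq)
          then show ?thesis by simp
        qed
        from real_polynomial_function_compose[OF this P[of j]]
        have pP: "smooth_alg (\<lambda>x :: 'a \<times> real. P j ((norm (fst x))\<^sup>2, snd x))"
          by (intro real_polynomial_function_imp_smooth_alg) (simp add: o_def)
        have d1: "smooth_alg (\<lambda>x :: 'a \<times> real. X + (- 1) * (norm (fst x))\<^sup>2)"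
          by (intro smooth_alg.add smooth_alg.mult smooth_alg.const real_polynomial_function_imp_smooth_alg[OF pn])
        have d2: "smooth_alg (\<lambda>x :: 'a \<times> real. s\<^sup>2 + (- 1) * (snd x * snd x))"
          by (intro smooth_alg.add smooth_alg.mult smooth_alg.const real_polynomial_function_imp_smooth_alg[OF ps])
        show ?thesis
          unfolding F_def b_def power2_eq_square[of "P j _"]
          using smooth_alg.mult[OF smooth_alg.mult[OF smooth_alg.flat[OF d1, of 0] smooth_alg.flat[OF d2, of 0]] smooth_alg.mult[OF pP pP]]
          by (simp add: power2_eq_square[of "snd _"])
      qed
      have ineq_j: "ennreal A * (\<integral>\<^sup>+x. ennreal (?f j x) \<partial>lborel) \<le>
        ennreal C * ennreal_powr (\<integral>\<^sup>+x. ennreal (?f j x powr p * V (norm (fst x), snd x) powr p) \<partial>lborel) (1 / p)" for j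
      proof -
        have "(\<integral>\<^sup>+x. ennreal (?f j x powr p * v x powr p) \<partial>lborel) =
          (\<integral>\<^sup>+x. ennreal (?f j x powr p * V (norm (fst x), snd x) powr p) \<partial>lborel)"
          by (intro nn_integral_cong_AE, use Veq in eventually_elim) simp
        with ineq[OF cF F0 Fnn smooth[of j]] show ?thesis by (simp only:)
      qed
      have lim1: "(\<lambda>j. \<integral>\<^sup>+x. ennreal (?f j x) \<partial>lborel) \<longlonglongrightarrow> a m"
        unfolding a_def
      proof (rule nn_integral_dominated_convergence[where w = "\<lambda>x. ennreal ((real m + 1)\<^sup>2) * indicator Y x"])
        show "(\<integral>\<^sup>+x. ennreal ((real m + 1)\<^sup>2) * indicator Y x \<partial>lborel) < \<infinity>"
          using emeasure_bounded_finite[OF compact_imp_bounded[OF Y]] by (simp add: nn_integral_cmult_indicator ennreal_mult_less_top)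
        show "AE x in lborel. ennreal (?f j x) \<le> ennreal ((real m + 1)\<^sup>2) * indicator Y x" for j
        proof (rule AE_I2)
          fix x
          show "ennreal (?f j x) \<le> ennreal ((real m + 1)\<^sup>2) * indicator Y x"
            using F_bd[of j x] by (cases "x \<in> Y") (simp_all add: ennreal_leI ennreal_neg)
        qed
        show "AE x in lborel. (\<lambda>j. ennreal (?f j x)) \<longlonglongrightarrow> ennreal (?h x)"
          using F_lim by eventually_elim (rule tendsto_ennrealI)
      qed measurable
      define a' where "a' = (\<integral>\<^sup>+x. ennreal (?h x powr p * V (norm (fst x), snd x) powr p) \<partial>lborel)"
      \<comment> \<open>The majorant is a constant times v^p on the compact set \<open>Y\<close>,
        integrable by the local integrability of v^p.\<close>
      have lim2: "(\<lambda>j. \<integral>\<^sup>+x. ennreal (?f j x powr p * V (norm (fst x), snd x) powr p) \<partial>lborel) \<longlonglongrightarrow> a'"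
        unfolding a'_def
      proof (rule nn_integral_dominated_convergence[where w = "\<lambda>x. ennreal (((real m + 1)\<^sup>2) powr p) * (ennreal (V (norm (fst x), snd x) powr p) * indicator Y x)"])
        show "(\<integral>\<^sup>+x. ennreal (((real m + 1)\<^sup>2) powr p) * (ennreal (V (norm (fst x), snd x) powr p) * indicator Y x) \<partial>lborel) < \<infinity>"
        proof -
          have "(\<integral>\<^sup>+x. ennreal (V (norm (fst x), snd x) powr p) * indicator Y x \<partial>lborel) = (\<integral>\<^sup>+x\<in>Y. ennreal (v x powr p) \<partial>lborel)"
            by (intro nn_integral_cong_AE, use Veq in eventually_elim) simp
          also have "\<dots> < \<infinity>" using v_pow_loc Y by (auto simp: locally_integrable_def)
          finally show ?thesis by (simp add: nn_integral_cmult ennreal_mult_less_top)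
        qed
        show "AE x in lborel. ennreal (?f j x powr p * V (norm (fst x), snd x) powr p) \<le>
          ennreal (((real m + 1)\<^sup>2) powr p) * (ennreal (V (norm (fst x), snd x) powr p) * indicator Y x)" for j
        proof (rule AE_I2)
          fix x :: "'a \<times> real"
          show "ennreal (?f j x powr p * V (norm (fst x), snd x) powr p) \<le>
            ennreal (((real m + 1)\<^sup>2) powr p) * (ennreal (V (norm (fst x), snd x) powr p) * indicator Y x)"
          proof (cases "x \<in> Y")
            case True
            have "?f j x powr p \<le> ((real m + 1)\<^sup>2) powr p"
              using F_bd[of j x] Fnn p True by (intro powr_mono2) auto
            then show ?thesis using True
              by (auto simp flip: ennreal_mult intro!: ennreal_leI mult_right_mono)
          next
            case False
            then have "?f j x = 0" using F_bd[of j x] Fnn[of j "((norm (fst x))\<^sup>2, snd x)"] by simp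
            then show ?thesis by simp
          qed
        qed
        show "AE x in lborel. (\<lambda>j. ennreal (?f j x powr p * V (norm (fst x), snd x) powr p)) \<longlonglongrightarrow>
          ennreal (?h x powr p * V (norm (fst x), snd x) powr p)"
          using F_lim
        proof eventually_elim
          case (elim x)
          then have "(\<lambda>j. ?f j x powr p) \<longlonglongrightarrow> ?h x powr p"
            using p Fnn by (intro tendsto_powr') auto
          then show ?case by (intro tendsto_ennrealI tendsto_mult_right)
        qed
      qed measurable
      \<comment> \<open>Truncation preserves one half of the extremal identity: from h \<le> y^(-p')
        and p' (p - 1) = p follows h^(p-1) y^p \<le> 1. Where y = 0 the left side vanishes.\<close>
      have a'_le: "a' \<le> a m"
        unfolding a'_def a_def
      proof (intro nn_integral_mono ennreal_leI)
        fix x :: "'a \<times> real"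
        let ?y = "V (norm (fst x), snd x)"
        show "?h x powr p * ?y powr p \<le> ?h x"
        proof (cases "?y = 0 \<or> ?h x = 0")
          case True
          then show ?thesis using h_bd[of m "(norm (fst x), snd x)"] by auto
        next
          case False
          then have y: "?y > 0" and hp: "?h x > 0"
            using Vnn[of "(norm (fst x), snd x)"] h_bd[of m "(norm (fst x), snd x)"] by (auto simp: less_le)
          have "?h x \<le> ?y powr (- p')" using False by (auto simp: h_def \<omega>_def split: if_splits)
          then have "?h x powr (p - 1) \<le> (?y powr (- p')) powr (p - 1)"
            using p hp by (intro powr_mono2) auto
          also have "\<dots> = ?y powr (- p)"
            using pp by (simp add: powr_powr)
          finally have "?h x powr (p - 1) * ?y powr p \<le> ?y powr (- p) * ?y powr p"
            by (rule mult_right_mono) simp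
          also have "\<dots> = 1" using y by (simp flip: powr_add)
          finally have "?h x * (?h x powr (p - 1) * ?y powr p) \<le> ?h x * 1"
            using hp by (intro mult_left_mono) auto
          moreover have "?h x * ?h x powr (p - 1) = ?h x powr p"
            using hp by (simp add: powr_mult_base)
          ultimately show ?thesis by (simp add: mult.assoc[symmetric])
        qed
      qed
      then have a'D: "a' \<le> D" using a_le[of m] by (rule order_trans)
      have "ennreal A * a m \<le> ennreal C * ennreal_powr a' (1 / p)"
      proof (rule LIMSEQ_le)
        show "(\<lambda>j. ennreal A * (\<integral>\<^sup>+x. ennreal (?f j x) \<partial>lborel)) \<longlonglongrightarrow> ennreal A * a m"
          by (intro ennreal_tendsto_cmult lim1) simp
        show "(\<lambda>j. ennreal C * ennreal_powr (\<integral>\<^sup>+x. ennreal (?f j x powr p * V (norm (fst x), snd x) powr p) \<partial>lborel) (1 / p))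
          \<longlonglongrightarrow> ennreal C * ennreal_powr a' (1 / p)"
          using a'D D_fin p by (intro ennreal_tendsto_cmult tendsto_ennreal_powr lim2) (auto simp: top_unique)
      qed (use ineq_j in blast)
      also have "\<dots> \<le> ennreal C * ennreal_powr D (1 / p)"
        using p by (intro mult_left_mono ennreal_powr_mono a'D) auto
      finally show ?thesis .
    qed
    \<comment> \<open>Both truncations relax as \<open>m\<close> grows, the threshold 1/m falling
      and the cap m rising, so monotone convergence recovers the full weight.\<close>
    have "a \<longlonglongrightarrow> D"
      unfolding a_def D_def
    proof (rule nn_integral_LIMSEQ)
      show "incseq (\<lambda>m x. ennreal (h m (norm (fst x :: 'a), snd x)))"
      proof (intro incseq_SucI le_funI ennreal_leI)
        fix m and x :: "'a \<times> real"
        have "1 / real (Suc m) \<le> 1 / real m" if "m > 0" using that by (intro divide_left_mono) auto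
        moreover have "\<omega> m y \<le> \<omega> (Suc m) y" for y by (auto simp: \<omega>_def)
        ultimately show "h m (norm (fst x), snd x) \<le> h (Suc m) (norm (fst x), snd x)"
          using \<omega>(1)[OF Vnn[of "(norm (fst x), snd x)"]] unfolding h_def by (fastforce intro: order_trans)
      qed
      fix x :: "'a \<times> real"
      let ?b = "b ((norm (fst x))\<^sup>2, snd x)" and ?y = "V (norm (fst x), snd x)"
      show "(\<lambda>m. ennreal (h m (norm (fst x), snd x))) \<longlonglongrightarrow>
          neg_powr ?y p' * indicator {h. b ((norm (fst h))\<^sup>2, snd h) > 0} x"
      proof (cases "?b > 0")
        case True
        obtain M where M: "1 / ?b < real M" using reals_Archimedean2 by blast
        have ev: "h m (norm (fst x), snd x) = \<omega> m ?y" if "m \<ge> M" for m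
        proof -
          have "1 / ?b < real m" using M that by simp
          moreover then have "m > 0" using True by (metis divide_pos_pos less_trans of_nat_0_less_iff zero_less_one)
          ultimately show ?thesis using True by (simp add: h_def field_simps)
        qed
        have "(\<lambda>m. ennreal (\<omega> m ?y)) \<longlonglongrightarrow> neg_powr ?y p'"
        proof (cases "?y = 0")
          case True
          then show ?thesis
            using of_nat_tendsto_top_ennreal by (simp add: \<omega>_def neg_powr_def ennreal_of_nat_eq_real_of_nat)
        next
          case False
          then have y: "neg_powr ?y p' = ennreal (?y powr (- p'))"
            using Vnn[of "(norm (fst x), snd x)"] by (simp add: neg_powr_def inverse_ennreal powr_minus)
          obtain M' where M': "?y powr (- p') < real M'" using reals_Archimedean2 by blast
          have "\<omega> m ?y = ?y powr (- p')" if "m \<ge> M'" for m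
            using False M' that by (simp add: \<omega>_def)
          then show ?thesis
            unfolding y by (intro tendsto_eventually) (auto simp: eventually_sequentially intro!: exI[of _ M'])
        qed
        then have "(\<lambda>m. ennreal (h m (norm (fst x), snd x))) \<longlonglongrightarrow> neg_powr ?y p'"
          by (rule Lim_transform_eventually) (auto simp: eventually_sequentially ev intro!: exI[of _ M])
        then show ?thesis using True by simp
      next
        case False
        have "h m (norm (fst x), snd x) = 0" for m
          using False by (auto simp: h_def) (meson divide_pos_pos less_le_trans of_nat_0_less_iff zero_less_one)
        then show ?thesis using False by simp
      qed
    qed measurable
    then have "(\<lambda>m. ennreal A * a m) \<longlonglongrightarrow> ennreal A * D"
      by (intro ennreal_tendsto_cmult) simp_all
    then show ?thesis
      by (rule LIMSEQ_le_const2) (use a_ineq in blast)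
  qed
  show ?thesis
  proof (cases "D = 0")
    case True
    then show ?thesis unfolding D_eq by (simp add: ennreal_powr_def)
  next
    case False
    then obtain d where d: "D = ennreal d" "d > 0" using D_fin by (cases D) (auto simp: less_le)
    \<comment> \<open>\<open>C\<close> may be negative, and \<open>ennreal C\<close> is then
      0.\<close>
    have "ennreal (A * d) \<le> ennreal (max 0 C * d powr (1 / p))"
      using step d A by (simp add: ennreal_powr_ennreal ennreal_mult ennreal_max_0)
    then have "A * d \<le> max 0 C * d powr (1 / p)"
      using d by (subst (asm) ennreal_le_iff) auto
    moreover have "d = d powr (1 / p) * d powr (1 / p')"
      using d p' by (simp flip: powr_add)
    ultimately have "(A * d powr (1 / p')) * d powr (1 / p) \<le> max 0 C * d powr (1 / p)"
      by (metis mult.assoc mult.commute)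
    then have "A * d powr (1 / p') \<le> max 0 C"
      using d by simp
    then have "ennreal (A * d powr (1 / p')) \<le> ennreal (max 0 C)" by (rule ennreal_leI)
    then show ?thesis unfolding D_eq using d A by (simp add: ennreal_powr_ennreal ennreal_mult ennreal_max_0)
  qed
qed

section \<open>Necessity\<close>

text \<open>
  \<open>X\<close> plays the role of \<open>\<beta>\<^sub>k\<close> (of \<open>1\<close> if \<open>k = 0\<close>): what matters is that \<open>L\<^sub>k\<close> has no zero on
  \<open>[0, X]\<close>.
\<close>

lemma pitt_necessary:
  fixes p q p' X :: real and k :: nat
    and u :: "(real \<times> real) \<times> (complex ^ 'n::finite) \<Rightarrow> real"
    and v :: "'n heis \<Rightarrow> real"
  assumes p: "1 < p" and q: "1 < q" and p': "1 / p + 1 / p' = 1"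
    and u_meas: "u \<in> borel_measurable (completion (nu2 CARD('n) \<Otimes>\<^sub>M lborel))"
    and v_nonneg: "\<And>h. 0 \<le> v h"
    and v_meas: "v \<in> borel_measurable (completion lborel)"
    and v_loc: "locally_integrable lborel (\<lambda>h. neg_powr (v h) p')"
    and v_pow_loc: "locally_integrable lborel (\<lambda>h. ennreal (v h powr p))"
    and v_radial: "radial v"
    and pitt: "\<forall>f. schwartz f \<longrightarrow>
      ennreal_powr
        (\<integral>\<^sup>+(a, w). ennreal (norm (normalized_ft f a w) powr q * u (a, w) powr q)
           \<partial>(nu2 CARD('n) \<Otimes>\<^sub>M lborel)) (1 / q)
      \<le> ennreal C * ennreal_powr (\<integral>\<^sup>+h. ennreal (norm (f h) powr p * v h powr p) \<partial>lborel) (1 / p)"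
    and X: "X > 0" and pos: "\<forall>x\<in>{0..X}. poly (laguerre k (real (CARD('n) - 1))) x > 0"
  shows "(SUP s\<in>{0<..}.
        ennreal_powr
          (\<integral>\<^sup>+l\<in>{l. \<bar>l\<bar> < 1 / s}. (\<integral>\<^sup>+w\<in>{w. (norm w)\<^sup>2 < 2 * X * s}.
             ennreal (u ((l, real (2 * k + CARD('n)) * \<bar>l\<bar>), w) powr q * \<bar>l\<bar> ^ (2 * CARD('n)))
           \<partial>lborel) \<partial>lborel) (1 / q) *
        ennreal_powr
          (\<integral>\<^sup>+z\<in>{z. (norm z)\<^sup>2 < 2 * X * s}. (\<integral>\<^sup>+t\<in>{t. \<bar>t\<bar> < s}.
             neg_powr (v (z, t)) p' \<partial>lborel) \<partial>lborel) (1 / p')) < \<infinity>"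
proof -
  let ?n = "CARD('n)"
  let ?M = "nu2 ?n \<Otimes>\<^sub>M (lborel :: (complex ^ 'n) measure)"
  let ?L = "poly (laguerre k (real (?n - 1)))"
  obtain \<kappa> where \<kappa>: "\<kappa> > 0" "\<And>x. 0 \<le> x \<Longrightarrow> x \<le> X \<Longrightarrow> \<kappa> \<le> ?L x * exp (- x / 2)"
  proof -
    have "continuous_on {0..X} (\<lambda>x. ?L x * exp (- x / 2))" by (intro continuous_intros) auto
    from continuous_attains_inf[OF compact_Icc _ this] X
    obtain y where y: "y \<in> {0..X}" "\<forall>x\<in>{0..X}. ?L y * exp (- y / 2) \<le> ?L x * exp (- x / 2)"
      by auto
    show thesis by (rule that[of "?L y * exp (- y / 2)"]) (use y pos in auto)
  qed
  define c1 where "c1 = fact k * fact (?n - 1) / fact (k + ?n - 1) * (\<kappa> * (\<kappa> * cos 1) / ?L 0)"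
  have c1: "c1 > 0"
    unfolding c1_def using \<kappa>(1) pos X cos_gt_zero_pi[of 1] pi_gt3
    by (intro mult_pos_pos divide_pos_pos) auto
  \<comment> \<open>The constant that \<open>\<nu>\<^sub>2\<close> attaches to the
    \<open>k\<close>-th ray; taking the root of order q turns it into the first factor of
    \<open>c\<close>.\<close>
  define K where "K = 1 / (2 * pi) ^ (2 * ?n + 1) * ((fact (k + ?n - 1) / (fact k * fact (?n - 1)))\<^sup>2 :: real)"
  have K: "K > 0" unfolding K_def by (intro mult_pos_pos) (auto intro!: divide_pos_pos mult_pos_pos)
  define c where "c = K powr (1 / q) * c1"
  have c: "c > 0" using K c1 by (simp add: c_def)
  define U where "U s = (\<integral>\<^sup>+l\<in>{l. \<bar>l\<bar> < 1 / s}. (\<integral>\<^sup>+w\<in>{w. (norm w)\<^sup>2 < 2 * X * s}.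
             ennreal (u ((l, real (2 * k + ?n) * \<bar>l\<bar>), w) powr q * \<bar>l\<bar> ^ (2 * ?n))
           \<partial>lborel) \<partial>lborel)" for s
  define D where "D s = (\<integral>\<^sup>+z\<in>{z. (norm z)\<^sup>2 < 2 * X * s}. (\<integral>\<^sup>+t\<in>{t. \<bar>t\<bar> < s}.
             neg_powr (v (z, t)) p' \<partial>lborel) \<partial>lborel)" for s
  have main: "ennreal c * (ennreal_powr (U s) (1 / q) * ennreal_powr (D s) (1 / p')) \<le> ennreal C"
    if s: "s > 0" for s
  proof -
    define S where "S = {x \<in> space ?M. \<bar>fst (fst x)\<bar> < 1 / s \<and> fst (fst x) \<noteq> 0 \<and>
        snd (fst x) = real (2 * k + ?n) * \<bar>fst (fst x)\<bar> \<and> (norm (snd x))\<^sup>2 < 2 * X * s}"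
    have S: "S \<in> sets ?M"
    proof -
      have "sets (nu2 ?n) = sets (restrict_space borel (heisenberg_fan ?n))" by (simp add: nu2_def)
      then have "(\<lambda>a. a) \<in> nu2 ?n \<rightarrow>\<^sub>M borel"
        using measurable_restrict_space1[OF measurable_ident] by (simp cong: measurable_cong_sets add: id_def)
      from measurable_compose[OF measurable_fst[of "nu2 ?n" "lborel :: (complex ^ 'n) measure"] this]
      have [measurable]: "(fst :: (real \<times> real) \<times> (complex ^ 'n) \<Rightarrow> _) \<in> ?M \<rightarrow>\<^sub>M borel" by simp
      have [measurable]: "(\<lambda>x. fst (fst x)) \<in> borel_measurable ?M" "(\<lambda>x. snd (fst x)) \<in> borel_measurable ?M"
        by (rule measurable_compose[of fst ?M borel]; simp add: borel_measurable_continuous_onI continuous_on_fst continuous_on_snd)+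
      have [measurable]: "(\<lambda>x. snd x) \<in> borel_measurable ?M" by measurable
      show ?thesis unfolding S_def by measurable
    qed
    define g where "g x = ennreal (u x powr q) * indicator S x" for x
    have g: "g \<in> borel_measurable (completion ?M)"
    proof -
      have "(\<lambda>x. ennreal (u x powr q)) \<in> borel_measurable (completion ?M)" using u_meas by measurable
      moreover have "S \<in> sets (completion ?M)" using S by (rule sets_completionI_sets)
      ultimately show ?thesis unfolding g_def[abs_def] by measurable
    qed
    have Ug: "ennreal K * U s \<le> (\<integral>\<^sup>+x. g x \<partial>?M)"
    proof -
      have "(\<integral>\<^sup>+l. (\<integral>\<^sup>+w. g ((l, real (2 * k + ?n) * \<bar>l\<bar>), w) * ennreal (\<bar>l\<bar> ^ (2 * ?n)) \<partial>lborel) \<partial>lborel) = U s"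
        unfolding U_def
      proof (rule nn_integral_cong)
        fix l :: real
        have fan: "(l, real (2 * k + ?n) * \<bar>l\<bar>) \<in> heisenberg_fan ?n"
          by (auto simp: heisenberg_fan_def fan_ray_def fan_ray_inf_def)
        show "(\<integral>\<^sup>+w. g ((l, real (2 * k + ?n) * \<bar>l\<bar>), w) * ennreal (\<bar>l\<bar> ^ (2 * ?n)) \<partial>lborel) =
          (\<integral>\<^sup>+w\<in>{w. (norm w)\<^sup>2 < 2 * X * s}. ennreal (u ((l, real (2 * k + ?n) * \<bar>l\<bar>), w) powr q * \<bar>l\<bar> ^ (2 * ?n)) \<partial>lborel)
            * indicator {l. \<bar>l\<bar> < 1 / s} l"
        proof (cases "\<bar>l\<bar> < 1 / s \<and> l \<noteq> 0")
          case True
          have "g ((l, real (2 * k + ?n) * \<bar>l\<bar>), w) * ennreal (\<bar>l\<bar> ^ (2 * ?n)) =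
            ennreal (u ((l, real (2 * k + ?n) * \<bar>l\<bar>), w) powr q * \<bar>l\<bar> ^ (2 * ?n)) * indicator {w. (norm w)\<^sup>2 < 2 * X * s} w" for w
            using True fan by (auto simp: g_def S_def indicator_def space_pair_measure space_nu2 ennreal_mult)
          then show ?thesis using True by simp
        next
          case False
          then have "g ((l, real (2 * k + ?n) * \<bar>l\<bar>), w) = 0" for w
            by (auto simp: g_def S_def indicator_def)
          \<comment> \<open>At l = 0 both sides agree because
            \<open>\<bar>l\<bar> ^ (2 * ?n)\<close> is 0, the dimension being positive.\<close>
          then show ?thesis using False by (auto simp: indicator_def power_0_left)
        qed
      qed
      moreover have "ennreal (1 / (2 * pi) ^ (2 * ?n + 1)) * ennreal ((fact (k + ?n - 1) / (fact k * fact (?n - 1)))\<^sup>2) = ennreal K"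
        unfolding K_def by (subst ennreal_mult[symmetric]) auto
      ultimately show ?thesis using nn_integral_nu2_ray_le_completion[OF g, of k] by simp
    qed
    \<comment> \<open>\<open>weight_duality\<close> takes a real factor, while \<open>U s\<close> is
      not yet known to be finite.\<close>
    have "ennreal A * ennreal_powr (D s) (1 / p') \<le> ennreal C"
      if A: "0 \<le> A" "ennreal A \<le> ennreal c * ennreal_powr (U s) (1 / q)" for A
      unfolding D_def
    proof (rule weight_duality[OF p p' v_nonneg v_meas v_loc v_pow_loc _ _ s A(1)])
      show "v (z, t) = v (z', t)" if "norm z = norm z'" for z z' t
        using v_radial that unfolding radial_def by blast
      show "0 < 2 * X * s" using X s by simp
      fix F :: "real \<times> real \<Rightarrow> real"
      assume F: "continuous_on UNIV F" "\<And>x t. x \<ge> 2 * X * s \<or> \<bar>t\<bar> \<ge> s \<Longrightarrow> F (x, t) = 0" "\<And>x. F x \<ge> 0"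
        and smooth: "smooth_alg (\<lambda>h :: 'n heis. F ((norm (fst h))\<^sup>2, snd h))"
      let ?F = "\<lambda>h :: 'n heis. F ((norm (fst h))\<^sup>2, snd h)"
      let ?f = "\<lambda>h :: 'n heis. complex_of_real (?F h)"
      have intF: "integrable lborel ?F"
        using integrable_Re[OF radial_profile_integrable[OF F(1,2), where K = "\<lambda>_. 1" and 'a = "complex ^ 'n"]] by simp
      define I where "I = (LINT h|lborel. ?F h)"
      have I: "I \<ge> 0" unfolding I_def using F(3) by simp
      have I_eq: "(\<integral>\<^sup>+h. ennreal (?F h) \<partial>lborel) = ennreal I"
        unfolding I_def by (rule nn_integral_eq_integral[OF intF]) (use F(3) in auto)
      have schw: "schwartz ?f"
      proof (rule smooth_alg_imp_schwartz[OF smooth])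
        fix h :: "'n heis"
        assume h: "norm h > sqrt (2 * X * s) + s"
        show "?F h = 0"
        proof (rule F(2), rule ccontr)
          assume "\<not> (2 * X * s \<le> (norm (fst h))\<^sup>2 \<or> s \<le> \<bar>snd h\<bar>)"
          then have "norm (fst h) \<le> sqrt (2 * X * s)" "\<bar>snd h\<bar> \<le> s"
            by (auto intro!: real_le_rsqrt)
          moreover have "norm h \<le> norm (fst h) + norm (snd h)" by (metis norm_Pair_le prod.collapse)
          ultimately show False using h by simp
        qed
      qed
      have le: "ennreal ((c1 * I) powr q) * g x \<le>
          (case x of (a, w) \<Rightarrow> ennreal (norm (normalized_ft ?f a w) powr q * u (a, w) powr q))" for x
      proof (cases "x \<in> S")
        case True
        obtain a w where x: "x = (a, w)" by fastforce
        define l where "l = fst a"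
        from True have l: "\<bar>l\<bar> < 1 / s" "l \<noteq> 0" "a = (l, real (2 * k + ?n) * \<bar>l\<bar>)" "(norm w)\<^sup>2 < 2 * X * s"
          by (auto simp: S_def x l_def prod_eq_iff)
        have "c1 * I \<le> norm (normalized_ft ?f a w)"
          unfolding c1_def I_def l(3)
          by (rule normalized_ft_lower_bound[OF F \<kappa> s l(2,1,4)])
        then have "(c1 * I) powr q \<le> norm (normalized_ft ?f a w) powr q"
          using q c1 I by (intro powr_mono2) auto
        then have "(c1 * I) powr q * u (a, w) powr q \<le> norm (normalized_ft ?f a w) powr q * u (a, w) powr q"
          by (rule mult_right_mono) simp
        then show ?thesis using True by (simp add: x g_def ennreal_leI flip: ennreal_mult)
      qed (simp add: g_def)
      have "ennreal A * ennreal I \<le> ennreal c * ennreal_powr (U s) (1 / q) * ennreal I"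
        by (intro mult_right_mono A) simp
      also have "\<dots> = ennreal_powr (ennreal ((c1 * I) powr q) * (ennreal K * U s)) (1 / q)"
      proof -
        have "ennreal_powr (ennreal ((c1 * I) powr q)) (1 / q) = ennreal c1 * ennreal I"
          using q c1 I by (simp add: ennreal_powr_ennreal powr_powr ennreal_mult)
        moreover have "ennreal_powr (ennreal K) (1 / q) = ennreal (K powr (1 / q))"
          using K by (simp add: ennreal_powr_ennreal)
        moreover have "ennreal c = ennreal (K powr (1 / q)) * ennreal c1"
          unfolding c_def using c1 by (simp add: ennreal_mult)
        ultimately show ?thesis
          using q by (simp add: ennreal_powr_mult mult_ac)
      qed
      also have "\<dots> \<le> ennreal_powr (\<integral>\<^sup>+(a, w). ennreal (norm (normalized_ft ?f a w) powr q * u (a, w) powr q) \<partial>?M) (1 / q)"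
      proof (rule ennreal_powr_mono)
        have "ennreal ((c1 * I) powr q) * (ennreal K * U s) \<le> ennreal ((c1 * I) powr q) * (\<integral>\<^sup>+x. g x \<partial>?M)"
          by (intro mult_left_mono Ug) simp
        also have "\<dots> = (\<integral>\<^sup>+x. ennreal ((c1 * I) powr q) * g x \<partial>?M)"
          using nn_integral_cmult[OF g] by (simp only: nn_integral_completion)
        also have "\<dots> \<le> (\<integral>\<^sup>+(a, w). ennreal (norm (normalized_ft ?f a w) powr q * u (a, w) powr q) \<partial>?M)"
          by (rule nn_integral_mono) (rule le)
        finally show "ennreal ((c1 * I) powr q) * (ennreal K * U s) \<le>
          (\<integral>\<^sup>+(a, w). ennreal (norm (normalized_ft ?f a w) powr q * u (a, w) powr q) \<partial>?M)" .
      qed (use q in simp)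
      also have "\<dots> \<le> ennreal C * ennreal_powr (\<integral>\<^sup>+h. ennreal (norm (?f h) powr p * v h powr p) \<partial>lborel) (1 / p)"
        by (rule pitt[rule_format, OF schw])
      finally show "ennreal A * (\<integral>\<^sup>+h. ennreal (?F h) \<partial>lborel) \<le>
          ennreal C * ennreal_powr (\<integral>\<^sup>+h. ennreal (?F h powr p * v h powr p) \<partial>lborel) (1 / p)"
        unfolding I_eq using F(3) by simp
    qed
    then have "ennreal c * ennreal_powr (U s) (1 / q) * ennreal_powr (D s) (1 / p') \<le> ennreal C"
      by (rule ennreal_mult_le_of_real_le)
    then show ?thesis by (simp only: mult.assoc)
  qed
  have "ennreal_powr (U s) (1 / q) * ennreal_powr (D s) (1 / p') \<le> ennreal (1 / c) * ennreal C" if "s > 0" for s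
  proof -
    have "ennreal_powr (U s) (1 / q) * ennreal_powr (D s) (1 / p') =
      (ennreal (1 / c) * ennreal c) * (ennreal_powr (U s) (1 / q) * ennreal_powr (D s) (1 / p'))"
      using c by (simp flip: ennreal_mult)
    also have "\<dots> \<le> ennreal (1 / c) * ennreal C"
      unfolding mult.assoc by (intro mult_left_mono) (use main[OF that] in \<open>simp_all add: mult.assoc\<close>)
    finally show ?thesis .
  qed
  then have "(SUP s\<in>{0<..}. ennreal_powr (U s) (1 / q) * ennreal_powr (D s) (1 / p')) \<le> ennreal (1 / c) * ennreal C"
    by (intro SUP_least) auto
  also have "\<dots> < \<infinity>" by (simp add: ennreal_mult_less_top)
  finally show ?thesis unfolding U_def D_def .
qed

theorem theorem4p1:
  fixes p q p' :: real
    and u :: "(real \<times> real) \<times> (complex ^ 'n::finite) \<Rightarrow> real"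
    and v :: "'n heis \<Rightarrow> real"
    and \<beta> :: "nat \<Rightarrow> real"
  assumes p: "1 < p" and q: "1 < q" and p': "1 / p + 1 / p' = 1"
    and u_nonneg: "\<And>a w. a \<in> heisenberg_fan CARD('n) \<Longrightarrow> 0 \<le> u (a, w)"
    and u_meas: "u \<in> borel_measurable (completion (nu2 CARD('n) \<Otimes>\<^sub>M lborel))"
    and u_loc: "locally_integrable (nu2 CARD('n) \<Otimes>\<^sub>M lborel) (\<lambda>x. ennreal (u x))"
    and v_nonneg: "\<And>h. 0 \<le> v h"
    and v_meas: "v \<in> borel_measurable (completion lborel)"
    and v_loc: "locally_integrable lborel (\<lambda>h. neg_powr (v h) p')"
    and v_pow_loc: "locally_integrable lborel (\<lambda>h. ennreal (v h powr p))"
    and v_radial: "radial v"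
    and pitt: "\<exists>C::real. \<forall>f. schwartz f \<longrightarrow>
      ennreal_powr
        (\<integral>\<^sup>+(a, w). ennreal (norm (normalized_ft f a w) powr q * u (a, w) powr q)
           \<partial>(nu2 CARD('n) \<Otimes>\<^sub>M lborel)) (1 / q)
      \<le> ennreal C * ennreal_powr (\<integral>\<^sup>+h. ennreal (norm (f h) powr p * v h powr p) \<partial>lborel) (1 / p)"
    and \<beta>: "\<And>k. \<beta> k = (bessel_first_zero (CARD('n) - 1))\<^sup>2 / (4 * (real k + real CARD('n) / 2))"
  shows
    "(\<forall>k\<ge>1. (SUP s\<in>{0<..}.
        ennreal_powr
          (\<integral>\<^sup>+l\<in>{l. \<bar>l\<bar> < 1 / s}. (\<integral>\<^sup>+w\<in>{w. (norm w)\<^sup>2 < 2 * \<beta> k * s}.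
             ennreal (u ((l, real (2 * k + CARD('n)) * \<bar>l\<bar>), w) powr q * \<bar>l\<bar> ^ (2 * CARD('n)))
           \<partial>lborel) \<partial>lborel) (1 / q) *
        ennreal_powr
          (\<integral>\<^sup>+z\<in>{z. (norm z)\<^sup>2 < 2 * \<beta> k * s}. (\<integral>\<^sup>+t\<in>{t. \<bar>t\<bar> < s}.
             neg_powr (v (z, t)) p' \<partial>lborel) \<partial>lborel) (1 / p')) < \<infinity>)
     \<and> (SUP s\<in>{0<..}.
        ennreal_powr
          (\<integral>\<^sup>+l\<in>{l. \<bar>l\<bar> < 1 / s}. (\<integral>\<^sup>+w\<in>{w. (norm w)\<^sup>2 < 2 * s}.
             ennreal (u ((l, real CARD('n) * \<bar>l\<bar>), w) powr q * \<bar>l\<bar> ^ (2 * CARD('n)))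
           \<partial>lborel) \<partial>lborel) (1 / q) *
        ennreal_powr
          (\<integral>\<^sup>+z\<in>{z. (norm z)\<^sup>2 < 2 * s}. (\<integral>\<^sup>+t\<in>{t. \<bar>t\<bar> < s}.
             neg_powr (v (z, t)) p' \<partial>lborel) \<partial>lborel) (1 / p')) < \<infinity>"
proof -
  obtain C where C: "\<forall>f. schwartz f \<longrightarrow>
      ennreal_powr
        (\<integral>\<^sup>+(a, w). ennreal (norm (normalized_ft f a w) powr q * u (a, w) powr q)
           \<partial>(nu2 CARD('n) \<Otimes>\<^sub>M lborel)) (1 / q)
      \<le> ennreal C * ennreal_powr (\<integral>\<^sup>+h. ennreal (norm (f h) powr p * v h powr p) \<partial>lborel) (1 / p)"
    using pitt by blast
  note nec = pitt_necessary[OF p q p' u_meas v_nonneg v_meas v_loc v_pow_loc v_radial C]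
  have \<beta>_pos: "\<beta> k > 0" for k
    unfolding \<beta> using bessel_first_zero(1)[of "CARD('n) - 1"]
    by (intro divide_pos_pos zero_less_power mult_pos_pos add_nonneg_pos) auto
  have "poly (laguerre k (real (CARD('n) - 1))) x > 0" if "0 \<le> x" "x \<le> \<beta> k" for k x
  proof -
    have "Suc (CARD('n) - 1) = CARD('n)" by simp
    then show ?thesis using laguerre_pos[of x "CARD('n) - 1" k] that unfolding \<beta> by simp
  qed
  then have pos: "\<forall>x\<in>{0..\<beta> k}. poly (laguerre k (real (CARD('n) - 1))) x > 0" for k by simp
  have i: "(SUP s\<in>{0<..}.
        ennreal_powr
          (\<integral>\<^sup>+l\<in>{l. \<bar>l\<bar> < 1 / s}. (\<integral>\<^sup>+w\<in>{w. (norm w)\<^sup>2 < 2 * \<beta> k * s}.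
             ennreal (u ((l, real (2 * k + CARD('n)) * \<bar>l\<bar>), w) powr q * \<bar>l\<bar> ^ (2 * CARD('n)))
           \<partial>lborel) \<partial>lborel) (1 / q) *
        ennreal_powr
          (\<integral>\<^sup>+z\<in>{z. (norm z)\<^sup>2 < 2 * \<beta> k * s}. (\<integral>\<^sup>+t\<in>{t. \<bar>t\<bar> < s}.
             neg_powr (v (z, t)) p' \<partial>lborel) \<partial>lborel) (1 / p')) < \<infinity>" for k
    by (rule nec[OF \<beta>_pos pos])
  \<comment> \<open>The polynomial for \<open>k = 0\<close> is the constant 1, so the radius is
    free; \<open>X = 1\<close> gives the ball |w|^2 < 2 s of part (ii).\<close>
  have "\<forall>x\<in>{0..1}. poly (laguerre 0 (real (CARD('n) - 1))) x > 0"
    by (simp only: poly_laguerre) simp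
  note ii = nec[OF zero_less_one this, unfolded mult_0_right add_0 mult_1_right]
  show ?thesis using i ii by blast
qed

end
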